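(* Let $K>0$, $T>0$, $r>0$ and $\sigma>0$ be constants. Let $N$ and $n$ denote the cumulative distribution function and the density of the standard normal law $\mathcal N(0,1)$. Assume that the dividend yield is the deterministic function $$\delta(t)=r-\frac{n\left(\sqrt{(2r+\sigma^2)(T-t)}\right)}{1-\frac{2\sigma}{\sqrt{2r+\sigma^2}}\left(N\left(\sqrt{(2r+\sigma^2)(T-t)}\right)-\frac12\right)}\cdot\frac{\sigma}{\sqrt{T-t}}+\frac{\sigma^2}{2},\qquad t\in[0,T),$$ that the asset price satisfies $dX_t=(r-\delta(t))X_t\,dt+\sigma X_t\,dW_t$ under the risk-neutral measure $\mathsf Q$, and consider the American put option with strike $K$ and maturity $T$, with value function $$V(t,x)=\sup_{t\le\tau\le T}\mathsf E_{t,x}\left[e^{-r(\tau-t)}(K-X_\tau)^+\right],\qquad t\in[0,T),\ x>0.$$ Then the optimal exercise boundary of this option is $$b(t)=K\left(1-\frac{2\sigma}{\sqrt{2r+\sigma^2}}\left(N\left(\sqrt{(2r+\sigma^2)(T-t)}\right)-\frac12\right)\right),\qquad t\in[0,T);$$ that is, $\{(t,x)\in[0,T)\times(0,\infty): V(t,x)=K-x\}=\{(t,x)\in[0,T)\times(0,\infty): x\le b(t)\}$.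
   Context: $W$ is a standard Brownian motion under the risk-neutral measure $\mathsf Q$; $\mathsf E_{t,x}$ is the expectation under $\mathsf Q$ given $X_t=x$; the supremum is over all stopping times $\tau$ of the filtration $\mathcal F^X$ generated by $X$ taking values in $[t,T]$. The exercise region is $\mathcal E=\{(t,x)\in[0,T)\times(0,\infty): V(t,x)=K-x\}$. The optimal exercise boundary is the function $b:[0,T)\to(0,\infty)$ such that $\mathcal E=\{(t,x)\in[0,T)\times(0,\infty): x\le b(t)\}$. The dividend yield $\delta(t)$ is real-valued and may take negative values. *)

theory Defs
  imports "HOL-Probability.Probability"
begin

definition natural_filtration ::
    "'a measure \<Rightarrow> real \<Rightarrow> real \<Rightarrow> (real \<Rightarrow> 'a \<Rightarrow> real) \<Rightarrow> real \<Rightarrow> 'a measure" where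
  "natural_filtration M t T X s =
     sigma (space M) {X u -` B \<inter> space M | u B. u \<in> {t..min s T} \<and> B \<in> sets borel}"

text \<open>
  Time is \<^typ>\<open>real\<close>; only the \<open>\<sigma>\<close>-algebras \<open>F s\<close> with \<open>s \<ge> 0\<close> matter. No completeness or
  right-continuity is imposed on \<open>F\<close>, so both the filtration generated by \<open>W\<close> and any larger
  one for which \<open>W\<close> remains a Brownian motion are admitted.
\<close>

definition brownian_motion ::
    "'a measure \<Rightarrow> (real \<Rightarrow> 'a measure) \<Rightarrow> (real \<Rightarrow> 'a \<Rightarrow> real) \<Rightarrow> bool" where
  "brownian_motion M F W \<longleftrightarrow>
     prob_space M \<and>
     filtration (space M) F \<and>
     (\<forall>s\<ge>0. sets (F s) \<subseteq> sets M) \<and>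
     (\<forall>s\<ge>0. W s \<in> borel_measurable (F s)) \<and>
     (AE \<omega> in M. W 0 \<omega> = 0) \<and>
     (\<forall>\<omega>\<in>space M. continuous_on {0..} (\<lambda>s. W s \<omega>)) \<and>
     (\<forall>u s. 0 \<le> u \<and> u < s \<longrightarrow>
        distributed M lborel (\<lambda>\<omega>. W s \<omega> - W u \<omega>) (normal_density 0 (sqrt (s - u))) \<and>
        prob_space.indep_set M (sets (F u))
          (sets (vimage_algebra (space M) (\<lambda>\<omega>. W s \<omega> - W u \<omega>) borel)))"

definition null_in_probability :: "'a measure \<Rightarrow> (nat \<Rightarrow> 'a \<Rightarrow> ennreal) \<Rightarrow> bool" where
  "null_in_probability M Z \<longleftrightarrow>
     (\<forall>\<epsilon>>0. (\<lambda>n. measure M {\<omega> \<in> space M. ennreal \<epsilon> < Z n \<omega>}) \<longlonglongrightarrow> 0)"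

text \<open>
  A triple \<open>(k, p, \<xi>)\<close> encodes the simple process taking the value \<open>\<xi> i\<close> on
  \<open>(p i, p (i + 1)]\<close> for \<open>i < k\<close>, where \<open>a = p 0 \<le> \<dots> \<le> p k = b\<close>.
\<close>

definition simple_process ::
    "'a measure \<Rightarrow> (real \<Rightarrow> 'a measure) \<Rightarrow> real \<Rightarrow> real \<Rightarrow>
     nat \<Rightarrow> (nat \<Rightarrow> real) \<Rightarrow> (nat \<Rightarrow> 'a \<Rightarrow> real) \<Rightarrow> bool" where
  "simple_process M F a b k p \<xi> \<longleftrightarrow>
     p 0 = a \<and> p k = b \<and>
     (\<forall>i<k. p i \<le> p (Suc i) \<and>
            \<xi> i \<in> borel_measurable (F (p i)) \<and>
            (\<exists>C. \<forall>\<omega>\<in>space M. \<bar>\<xi> i \<omega>\<bar> \<le> C))"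

definition simple_value ::
    "nat \<Rightarrow> (nat \<Rightarrow> real) \<Rightarrow> (nat \<Rightarrow> 'a \<Rightarrow> real) \<Rightarrow> real \<Rightarrow> 'a \<Rightarrow> real" where
  "simple_value k p \<xi> u \<omega> = (\<Sum>i<k. \<xi> i \<omega> * indicator {p i<..p (Suc i)} u)"

definition simple_integral ::
    "(real \<Rightarrow> 'a \<Rightarrow> real) \<Rightarrow> nat \<Rightarrow> (nat \<Rightarrow> real) \<Rightarrow> (nat \<Rightarrow> 'a \<Rightarrow> real) \<Rightarrow> 'a \<Rightarrow> real" where
  "simple_integral W k p \<xi> \<omega> = (\<Sum>i<k. \<xi> i \<omega> * (W (p (Suc i)) \<omega> - W (p i) \<omega>))"

definition progressively_measurable ::
    "(real \<Rightarrow> 'a measure) \<Rightarrow> real \<Rightarrow> real \<Rightarrow> (real \<Rightarrow> 'a \<Rightarrow> real) \<Rightarrow> bool" where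
  "progressively_measurable F a b H \<longleftrightarrow>
     (\<forall>s\<in>{a..b}. (\<lambda>(u, \<omega>). H u \<omega>) \<in> borel_measurable (restrict_space borel {a..s} \<Otimes>\<^sub>M F s))"

text \<open>
  The Ito integral of \<open>H\<close> with respect to \<open>W\<close> over \<open>[a, b]\<close> is determined only up to a null set,
  hence a relation: \<open>I\<close> is a limit in probability of integrals of simple processes that
  approximate \<open>H\<close> in the sense that \<open>\<integral>\<^sub>a\<^sup>b (S\<^sub>n - H)\<^sup>2 du \<rightarrow> 0\<close> in probability.
\<close>

definition has_ito_integral ::
    "'a measure \<Rightarrow> (real \<Rightarrow> 'a measure) \<Rightarrow> (real \<Rightarrow> 'a \<Rightarrow> real) \<Rightarrow>
     (real \<Rightarrow> 'a \<Rightarrow> real) \<Rightarrow> real \<Rightarrow> real \<Rightarrow> ('a \<Rightarrow> real) \<Rightarrow> bool" where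
  "has_ito_integral M F W H a b I \<longleftrightarrow>
     progressively_measurable F a b H \<and>
     I \<in> borel_measurable M \<and>
     (\<exists>k p \<xi>.
        (\<forall>n. simple_process M F a b (k n) (p n) (\<xi> n)) \<and>
        null_in_probability M
          (\<lambda>n \<omega>. \<integral>\<^sup>+u\<in>{a..b}. ennreal ((simple_value (k n) (p n) (\<xi> n) u \<omega> - H u \<omega>)\<^sup>2) \<partial>lborel) \<and>
        null_in_probability M
          (\<lambda>n \<omega>. ennreal \<bar>simple_integral W (k n) (p n) (\<xi> n) \<omega> - I \<omega>\<bar>))"

text \<open>
  \<open>X\<close> is a continuous adapted solution on \<open>[t, T]\<close> of
  \<open>dX\<^sub>s = \<mu>(s, X\<^sub>s) ds + \<gamma>(s, X\<^sub>s) dW\<^sub>s\<close> with \<open>X\<^sub>t = x\<close>.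
\<close>

definition sde_solution ::
    "'a measure \<Rightarrow> (real \<Rightarrow> 'a measure) \<Rightarrow> (real \<Rightarrow> 'a \<Rightarrow> real) \<Rightarrow>
     (real \<Rightarrow> real \<Rightarrow> real) \<Rightarrow> (real \<Rightarrow> real \<Rightarrow> real) \<Rightarrow> real \<Rightarrow> real \<Rightarrow> real \<Rightarrow>
     (real \<Rightarrow> 'a \<Rightarrow> real) \<Rightarrow> bool" where
  "sde_solution M F W \<mu> \<gamma> t T x X \<longleftrightarrow>
     (\<forall>s\<in>{t..T}. X s \<in> borel_measurable (F s)) \<and>
     (\<forall>\<omega>\<in>space M. continuous_on {t..T} (\<lambda>s. X s \<omega>)) \<and>
     (AE \<omega> in M. X t \<omega> = x) \<and>
     (\<forall>s\<in>{t..T}. \<exists>I.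
        has_ito_integral M F W (\<lambda>u \<omega>. \<gamma> u (X u \<omega>)) t s I \<and>
        (AE \<omega> in M.
           set_integrable lborel {t..s} (\<lambda>u. \<mu> u (X u \<omega>)) \<and>
           X s \<omega> = x + (LINT u:{t..s}|lborel. \<mu> u (X u \<omega>)) + I \<omega>))"

text \<open>
  \<open>X t x\<close> is the price process started from \<open>x\<close> at time \<open>t\<close>, so that the expectation given
  \<open>X\<^sub>t = x\<close> becomes the expectation under \<open>M\<close> of a functional of \<open>X t x\<close>.
  The expected payoffs lie in \<open>[0, K]\<close>, so the real supremum is a genuine one.
\<close>

definition american_put_value ::
    "'a measure \<Rightarrow> (real \<Rightarrow> real \<Rightarrow> real \<Rightarrow> 'a \<Rightarrow> real) \<Rightarrow> real \<Rightarrow> real \<Rightarrow> real \<Rightarrow>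
     real \<Rightarrow> real \<Rightarrow> real" where
  "american_put_value M X r K T t x =
     (SUP \<tau>\<in>{\<tau>. stopping_time (natural_filtration M t T (X t x)) \<tau> \<and>
                (\<forall>\<omega>\<in>space M. \<tau> \<omega> \<in> {t..T})}.
        (\<integral>\<omega>. exp (- r * (\<tau> \<omega> - t)) * max 0 (K - X t x (\<tau> \<omega>) \<omega>) \<partial>M))"

definition exercise_region :: "(real \<Rightarrow> real \<Rightarrow> real) \<Rightarrow> real \<Rightarrow> real \<Rightarrow> (real \<times> real) set" where
  "exercise_region V K T = {(t, x). t \<in> {0..<T} \<and> x > 0 \<and> V t x = K - x}"

definition optimal_exercise_boundary ::
    "(real \<Rightarrow> real \<Rightarrow> real) \<Rightarrow> real \<Rightarrow> real \<Rightarrow> (real \<Rightarrow> real) \<Rightarrow> bool" where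
  "optimal_exercise_boundary V K T b \<longleftrightarrow>
     (\<forall>t\<in>{0..<T}. b t > 0) \<and>
     exercise_region V K T = {(t, x). t \<in> {0..<T} \<and> x > 0 \<and> x \<le> b t}"

end

theory Submission
  imports Defs "HOL-Real_Asymp.Real_Asymp"
begin

text \<open>Relative to the boundary \<open>b\<close>, the asset price is \<open>X s = b s * exp (\<sigma> * Y s)\<close> with a Brownian motion
  \<open>Y\<close> of drift \<open>- \<sigma>\<close>: the prescribed dividend yield is exactly the one for which the drift of \<open>X\<close> is
  that of \<open>b\<close>, and pathwise uniqueness for the linear equation identifies the given solution.
  The stopping problem thus becomes one for \<open>Y\<close> with the constant boundary \<open>0\<close>. Below it, the payoff
  loses value at the rate \<open>lam\<close>, and the European put plus the accumulated expected loss can be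
  evaluated in closed form by the first-passage decomposition of the heat kernel. The result \<open>U\<close>
  equals the payoff for \<open>Y \<le> 0\<close> and exceeds it strictly for \<open>Y > 0\<close>. Since \<open>U\<close> together with the
  accumulated loss is a martingale and the loss is nonnegative, \<open>U\<close> dominates the expected payoff of
  every stopping time; stopping at the first grid point with \<open>Y \<le> 0\<close> loses a vanishing amount as
  the grid is refined, so \<open>U\<close> is the value.\<close>

section \<open>The standard normal law\<close>

text \<open>The constant \<open>\<alpha>\<close> arises because discounting at rate \<open>r\<close>
  and the exponential tilt that removes the drift \<open>- \<sigma>\<close> combine into killing at
  rate \<open>\<alpha>\<^sup>2 / 2\<close>. The boundary is such that \<open>1 - B c\<close> is
  \<sigma> times \<open>G c 0\<close>, the damped heat kernel at 0 integrated over time; this lets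
  the integral over hitting times close up. The dividend yield is unbounded near \<open>T\<close>,
  since \<open>dB c\<close> behaves like \<open>- \<sigma> * phi 0 / sqrt c\<close>. The
  coefficients of the equation are therefore used only on \<open>[t, S]\<close> with
  \<open>S < T\<close>, and the loss rate is dominated by a constant plus an integrable multiple of
  \<open>1 / sqrt (T - u)\<close>. The stochastic integral is given only as a limit in probability,
  and Ito's formula is never proved. Instead, the given price and the explicit exponential are both
  limits of the same Euler sums. This property is linear in the process, so second moments control
  the difference. The filtration need not be complete and the price formula holds only almost
  surely. The nearly optimal rules must be stopping times of the price filtration, so they read the
  price itself, at finitely many times, and not \<open>Y\<close>.\<close>

lemma has_integral_ftc_limits:
  fixes F f :: "real \<Rightarrow> real"
  assumes "a < b"
    and "\<And>x. a < x \<Longrightarrow> x < b \<Longrightarrow> (F has_real_derivative f x) (at x)"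
    and "(F \<longlongrightarrow> A) (at_right a)" and "(F \<longlongrightarrow> B) (at_left b)"
  shows "(f has_integral (B - A)) {a..b}"
proof -
  \<comment> \<open>The antiderivatives used below contain terms such as \<open>y / sqrt v\<close>,
    whose value at an end point is a default of division by zero. Overwriting the end values by the
    one-sided limits gives a function continuous on the closed interval.\<close>
  define G where "G x = (if x \<le> a then A else if x \<ge> b then B else F x)" for x
  have ev: "eventually (\<lambda>y. G y = F y) (nhds x)" if "a < x" "x < b" for x
    using eventually_nhds_in_open[of "{a<..<b}" x] that
    by (auto simp: G_def elim!: eventually_mono)
  have der: "(G has_real_derivative f x) (at x)" if "a < x" "x < b" for x
    using assms(2)[OF that] DERIV_cong_ev[OF refl ev[OF that] refl] by simp
  have "continuous_on {a..b} G"
  proof (rule continuous_on_IccI[OF _ _ _ \<open>a < b\<close>])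
    show "(G \<longlongrightarrow> G a) (at_right a)"
    proof (subst tendsto_cong[where g = F])
      show "\<forall>\<^sub>F x in at_right a. G x = F x"
        using \<open>a < b\<close> by (auto simp: G_def eventually_at_right intro!: exI[of _ b])
    qed (use assms(3) in \<open>simp add: G_def\<close>)
    show "(G \<longlongrightarrow> G b) (at_left b)"
    proof (subst tendsto_cong[where g = F])
      show "\<forall>\<^sub>F x in at_left b. G x = F x"
        using \<open>a < b\<close> by (auto simp: G_def eventually_at_left intro!: exI[of _ a])
    qed (use assms(4) \<open>a < b\<close> in \<open>simp add: G_def\<close>)
    show "(G \<longlongrightarrow> G x) (at x)" if "a < x" "x < b" for x
      using der[OF that] DERIV_isCont isCont_def by blast
  qed
  then have "(f has_integral (G b - G a)) {a..b}"
    using assms(1) der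
    by (intro fundamental_theorem_of_calculus_interior)
       (auto simp: has_real_derivative_iff_has_vector_derivative[symmetric])
  then show ?thesis using \<open>a < b\<close> by (simp add: G_def)
qed

definition Phi :: "real \<Rightarrow> real" where "Phi = cdf std_normal_distribution"
abbreviation "phi \<equiv> std_normal_density"

interpretation std_normal: real_distribution std_normal_distribution
  by (rule real_dist_normal_dist)

lemma phi_minus: "phi (- x) = phi x"
  by (simp add: normal_density_def)

lemma phi_pos: "phi x > 0"
  by (simp add: normal_density_pos)

lemma continuous_phi: "continuous_on S phi"
  unfolding normal_density_def by (intro continuous_intros) auto

lemma Phi_eq_integral: "Phi x = (LINT z:{..x}|lborel. phi z)"
proof -
  have "Phi x = (LINT z|std_normal_distribution. indicator {..x} z)"
    by (simp add: Phi_def cdf_def)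
  also have "\<dots> = (LINT z|lborel. phi z * indicator {..x} z)"
    by (subst integral_real_density) auto
  finally show ?thesis by (simp add: set_lebesgue_integral_def mult.commute)
qed

lemma set_integrable_phi: "A \<in> sets borel \<Longrightarrow> set_integrable lborel A phi"
  unfolding set_integrable_def
  by (intro integrable_mult_indicator) (auto intro!: integrable_normal_density)

lemma Phi_diff:
  assumes "x \<le> y" shows "Phi y - Phi x = integral {x..y} phi"
proof -
  have "Phi y = (LINT z:{..x} \<union> {x<..y}|lborel. phi z)"
    using assms by (simp add: Phi_eq_integral ivl_disj_un)
  also have "\<dots> = Phi x + (LINT z:{x<..y}|lborel. phi z)"
    by (subst set_integral_Un) (auto simp: Phi_eq_integral intro!: set_integrable_phi)
  also have "(LINT z:{x<..y}|lborel. phi z) = (LINT z:{x..y}|lborel. phi z)"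
    unfolding set_lebesgue_integral_def
  proof (rule integral_cong_AE)
    show "AE z in lborel. indicat_real {x<..y} z *\<^sub>R phi z = indicat_real {x..y} z *\<^sub>R phi z"
      using AE_lborel_singleton[of x] by eventually_elim (auto simp: indicator_def)
  qed simp_all
  also have "\<dots> = integral {x..y} phi"
    by (rule set_borel_integral_eq_integral) (auto intro!: set_integrable_phi)
  finally show ?thesis by simp
qed

lemma Phi_has_real_derivative: "(Phi has_real_derivative phi x) (at x)"
proof -
  have "((\<lambda>u. integral {x-1..u} phi) has_real_derivative phi x) (at x within {x-1..x+1})"
    by (intro integral_has_real_derivative continuous_phi) auto
  then have "((\<lambda>u. integral {x-1..u} phi) has_real_derivative phi x) (at x)"
    by (subst (asm) at_within_interior) simp_all
  then have "((\<lambda>u. Phi (x-1) + integral {x-1..u} phi) has_real_derivative phi x) (at x)"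
    by (rule DERIV_cong[OF DERIV_add[OF DERIV_const]]) simp
  moreover have "eventually (\<lambda>u. Phi (x-1) + integral {x-1..u} phi = Phi u) (nhds x)"
    using eventually_nhds_in_open[of "{x-1<..}" x]
    by (auto elim!: eventually_mono simp: Phi_diff[symmetric])
  ultimately show ?thesis by (rule iffD1[OF DERIV_cong_ev[OF refl _ refl], rotated])
qed

lemmas Phi_deriv [derivative_intros] = DERIV_chain2[OF Phi_has_real_derivative]

lemma continuous_Phi: "isCont Phi x"
  using Phi_has_real_derivative DERIV_isCont by blast

lemma Phi_at_top: "(Phi \<longlongrightarrow> 1) at_top" and Phi_at_bot: "(Phi \<longlongrightarrow> 0) at_bot"
  unfolding Phi_def
  by (fact std_normal.cdf_lim_at_top_prob std_normal.cdf_lim_at_bot)+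

text \<open>The sum \<open>Phi x + Phi (- x)\<close> has derivative zero because \<open>phi\<close>
  is even; its limit at infinity fixes the constant.\<close>

lemma Phi_minus: "Phi (- x) = 1 - Phi x"
proof -
  have "((\<lambda>x. Phi x + Phi (- x)) has_real_derivative 0) (at z)" for z
    by (rule derivative_eq_intros refl | simp add: phi_minus)+
  then have c: "Phi z + Phi (- z) = 2 * Phi 0" for z
    using DERIV_isconst_all[of "\<lambda>x. Phi x + Phi (- x)" z 0] by auto
  have "((\<lambda>z. Phi z + Phi (- z)) \<longlongrightarrow> 1 + 0) at_top"
    by (intro tendsto_add Phi_at_top
          filterlim_compose[OF Phi_at_bot filterlim_uminus_at_bot_at_top])
  then have "((\<lambda>z::real. 2 * Phi 0) \<longlongrightarrow> 1) at_top"
    unfolding c by simp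
  then have "2 * Phi 0 = 1"
    by (simp add: tendsto_const_iff)
  with c[of x] show ?thesis by simp
qed

lemma Phi_0: "Phi 0 = 1/2"
  using Phi_minus[of 0] by simp

lemma Phi_strict_mono: "x < y \<Longrightarrow> Phi x < Phi y"
  by (rule DERIV_pos_imp_increasing) (use Phi_has_real_derivative phi_pos in blast)+

lemma Phi_less_1: "Phi x < 1"
  using Phi_strict_mono[of x "x+1"] std_normal.cdf_bounded_prob[of "x+1", folded Phi_def] by linarith

section \<open>The boundary and the candidate value function\<close>

lemma phi_mult: "phi x * phi y = phi 0 * phi (sqrt (x\<^sup>2 + y\<^sup>2))"
proof -
  have "exp (- x\<^sup>2 / 2) * exp (- y\<^sup>2 / 2) = exp (- (x\<^sup>2 + y\<^sup>2) / 2)"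
    by (simp add: exp_add[symmetric] field_simps)
  then show ?thesis by (simp add: std_normal_density_def)
qed

lemma phi_deriv: "(phi has_real_derivative - x * phi x) (at x)"
proof -
  have "((\<lambda>x. exp (- x\<^sup>2 / 2)) has_real_derivative exp (- x\<^sup>2 / 2) * - x) (at x)"
    by (auto intro!: derivative_eq_intros)
  from DERIV_cmult[OF this, of "1 / sqrt (2 * pi)"] show ?thesis
    unfolding std_normal_density_def by (simp only: mult_ac)
qed

text \<open>The function \<open>Phi y + phi y / y\<close> has derivative
  \<open>- phi y / y\<^sup>2\<close> and therefore decreases to its limit 1. The bound is what keeps
  the loss rate nonnegative, see \<open>D_le\<close>.\<close>

lemma mills_ratio: assumes "z > 0" shows "1 - Phi z \<le> phi z / z"
proof -
  have "Phi z + phi z / z \<ge> 1"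
  proof (rule tendsto_upperbound)
    show "((\<lambda>y. Phi y + phi y / y) \<longlongrightarrow> 1) at_top"
    proof -
      have "((\<lambda>y. phi y / y) \<longlongrightarrow> 0) at_top"
        unfolding std_normal_density_def by real_asymp
      from tendsto_add[OF Phi_at_top this] show ?thesis by simp
    qed
    have "Phi y + phi y / y \<le> Phi z + phi z / z" if "y \<ge> z" for y
    proof (rule DERIV_nonpos_imp_nonincreasing[OF that])
      fix x assume x: "z \<le> x" "x \<le> y"
      have "((\<lambda>y. Phi y + phi y / y) has_real_derivative
              phi x + (- x * phi x * x - phi x * 1) / (x * x)) (at x)"
        using x \<open>z > 0\<close> by (intro DERIV_add DERIV_divide phi_deriv Phi_has_real_derivative) auto
      moreover have "phi x + (- x * phi x * x - phi x * 1) / (x * x) \<le> 0"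
        using x \<open>z > 0\<close> by (simp add: field_simps)
      ultimately show "\<exists>d. ((\<lambda>y. Phi y + phi y / y) has_real_derivative d) (at x) \<and> d \<le> 0"
        by blast
    qed
    then show "\<forall>\<^sub>F y in at_top. Phi y + phi y / y \<le> Phi z + phi z / z"
      by (auto simp: eventually_at_top_linorder)
  qed simp
  then show ?thesis by simp
qed

locale put_boundary =
  fixes r \<sigma> :: real
  assumes r_pos: "r > 0" and \<sigma>_pos: "\<sigma> > 0"
begin

definition \<alpha> :: real where "\<alpha> = sqrt (2 * r + \<sigma>\<^sup>2)"

lemma \<alpha>_sq: "\<alpha>\<^sup>2 = 2 * r + \<sigma>\<^sup>2"
  using r_pos by (simp add: \<alpha>_def)

lemma \<alpha>_gt: "\<alpha> > \<sigma>"
  unfolding \<alpha>_def using r_pos \<sigma>_pos by (intro real_less_rsqrt) simp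

lemma \<alpha>_pos: "\<alpha> > 0"
  using \<alpha>_gt \<sigma>_pos by simp

text \<open>The boundary of the theorem divided by \<open>K\<close>, as a function of the time to
  maturity \<open>c = T - t\<close>.\<close>

definition B :: "real \<Rightarrow> real" where
  "B c = 1 - 2 * \<sigma> / \<alpha> * (Phi (\<alpha> * sqrt c) - 1 / 2)"

definition dB :: "real \<Rightarrow> real" where
  "dB c = - \<sigma> * phi (\<alpha> * sqrt c) / sqrt c"

text \<open>At \<open>c = T - t\<close> this equals \<open>\<delta> t * B c\<close>, the dividend
  paid per unit time by an asset sitting on the boundary, in units of the strike. For
  \<open>Y = y\<close> below the boundary, the payoff loses
  \<open>r - D c * exp (\<sigma> * y)\<close> per unit time before discounting.\<close>

definition D :: "real \<Rightarrow> real" where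
  "D c = \<alpha>\<^sup>2 / 2 * B c + dB c"

lemma B_0: "B 0 = 1" by (simp add: B_def Phi_0)

lemma B_deriv: "c > 0 \<Longrightarrow> (B has_real_derivative dB c) (at c)"
  unfolding B_def dB_def using \<alpha>_pos
  by (auto intro!: derivative_eq_intros simp: field_simps)

lemma isCont_B: "isCont B c"
  unfolding B_def by (intro continuous_intros isCont_o2[OF _ continuous_Phi]) auto

lemma B_le_1: "c \<ge> 0 \<Longrightarrow> B c \<le> 1"
proof -
  assume "c \<ge> 0"
  then have "Phi 0 \<le> Phi (\<alpha> * sqrt c)"
    using Phi_strict_mono[of 0 "\<alpha> * sqrt c"] \<alpha>_pos by (cases "c = 0") auto
  then show ?thesis using \<sigma>_pos \<alpha>_pos by (simp add: B_def Phi_0)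
qed

text \<open>The subtracted term is less than \<open>\<sigma> / \<alpha>\<close>, and \<sigma> <
  \<alpha> because \<open>r\<close> is positive.\<close>

lemma B_pos: "B c > 0"
proof -
  have "\<sigma> * (2 * (Phi (\<alpha> * sqrt c) - 1 / 2)) < \<sigma> * 1"
    using Phi_less_1[of "\<alpha> * sqrt c"] \<sigma>_pos by (intro mult_strict_left_mono) auto
  then have "2 * \<sigma> * (Phi (\<alpha> * sqrt c) - 1 / 2) < \<alpha>"
    using \<alpha>_gt by linarith
  then show ?thesis using \<alpha>_pos by (simp add: B_def field_simps)
qed

text \<open>Interest on the strike outweighs the dividend on the boundary. With
  \<open>z = \<alpha> * sqrt c\<close>, the left side is \<open>\<alpha>\<^sup>2 / 2 - \<sigma> *
  \<alpha> * (Phi z - 1 / 2 + phi z / z)\<close>; the Mills ratio makes the bracket at least 1/2,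
  and \<alpha> > \<sigma> leaves at most \<open>r\<close>.\<close>

lemma D_le: assumes "c > 0" shows "D c \<le> r"
proof -
  define z where "z = \<alpha> * sqrt c"
  have z: "z > 0" "sqrt c = z / \<alpha>" using assms \<alpha>_pos by (auto simp: z_def)
  have "D c = \<alpha>\<^sup>2 / 2 - \<sigma> * \<alpha> * (Phi z - 1 / 2 + phi z / z)"
    using \<alpha>_pos z(1) by (simp add: D_def B_def dB_def z_def[symmetric] z(2) field_simps power2_eq_square)
  also have "\<dots> \<le> \<alpha>\<^sup>2 / 2 - \<sigma> * \<alpha> * (1 / 2)"
  proof (intro diff_left_mono mult_left_mono)
    show "1 / 2 \<le> Phi z - 1 / 2 + phi z / z" using mills_ratio[OF z(1)] by linarith
  qed (use \<sigma>_pos \<alpha>_pos in auto)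
  also have "\<dots> \<le> \<alpha>\<^sup>2 / 2 - \<sigma> * \<sigma> / 2"
    using \<alpha>_gt \<sigma>_pos by simp
  also have "\<dots> = r" using \<alpha>_sq unfolding power2_eq_square by linarith
  finally show ?thesis .
qed

section \<open>The damped heat kernel and its integral over time\<close>

definition G :: "real \<Rightarrow> real \<Rightarrow> real" where
  "G c y = (exp (- \<alpha> * y) * Phi (\<alpha> * sqrt c - y / sqrt c)
            - exp (\<alpha> * y) * Phi (- \<alpha> * sqrt c - y / sqrt c)) / \<alpha>"

text \<open>The centred Gaussian density of variance \<open>v\<close> at \<open>y\<close>, damped at
  rate \<open>\<alpha>\<^sup>2 / 2\<close>. For \<open>y \<ge> 0\<close>, the formula
  \<open>G c y\<close> is its integral over \<open>v\<close> from 0 to \<open>c\<close>.\<close>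

definition g :: "real \<Rightarrow> real \<Rightarrow> real" where
  "g v y = exp (- \<alpha>\<^sup>2 * v / 2) * phi (y / sqrt v) / sqrt v"

definition h :: "real \<Rightarrow> real \<Rightarrow> real" where
  "h v y = phi (y / sqrt v) * y / (v * sqrt v)"

text \<open>Completing the square. The two signs of \<alpha> for \<open>p\<close> give the terms of
  \<open>G\<close>, and \<sigma> gives the tilt in the European price.\<close>

lemma phi_shift:
  assumes "v > 0"
  shows "phi (p * sqrt v - y / sqrt v) = exp (p * y) * (exp (- p\<^sup>2 * v / 2) * phi (y / sqrt v))"
proof -
  have "(p * sqrt v - y / sqrt v)\<^sup>2 = p\<^sup>2 * v - 2 * p * y + (y / sqrt v)\<^sup>2"
    using assms by (simp add: power2_diff power_mult_distrib)
  then have "- (p * sqrt v - y / sqrt v)\<^sup>2 / 2 = p * y + (- p\<^sup>2 * v / 2 + - (y / sqrt v)\<^sup>2 / 2)"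
    by (simp add: field_simps)
  then show ?thesis by (simp only: std_normal_density_def exp_add) simp
qed

lemma arg_deriv:
  assumes "v > 0"
  shows "((\<lambda>v. p * sqrt v - y / sqrt v) has_real_derivative
           p / (2 * sqrt v) + y / (2 * (v * sqrt v))) (at v)"
  using assms by (auto intro!: derivative_eq_intros simp: field_simps)

lemma G_deriv: assumes "v > 0" shows "((\<lambda>v. G v y) has_real_derivative g v y) (at v)"
proof -
  let ?E = "exp (- \<alpha>\<^sup>2 * v / 2) * phi (y / sqrt v)"
  have 1: "exp (- \<alpha> * y) * phi (\<alpha> * sqrt v - y / sqrt v) = ?E"
    using phi_shift[OF assms, of \<alpha> y] by (simp add: exp_minus)
  have 2: "exp (\<alpha> * y) * phi (- \<alpha> * sqrt v - y / sqrt v) = ?E"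
    using phi_shift[OF assms, of "- \<alpha>" y] by (simp add: exp_minus)
  have "((\<lambda>v. G v y) has_real_derivative
     (exp (- \<alpha> * y) * (phi (\<alpha> * sqrt v - y / sqrt v) * (\<alpha> / (2 * sqrt v) + y / (2 * (v * sqrt v))))
    - exp (\<alpha> * y) * (phi (- \<alpha> * sqrt v - y / sqrt v) * (- \<alpha> / (2 * sqrt v) + y / (2 * (v * sqrt v))))) / \<alpha>) (at v)"
    unfolding G_def
    by (intro DERIV_cdivide DERIV_diff DERIV_cmult Phi_deriv arg_deriv assms)
  also have "(exp (- \<alpha> * y) * (phi (\<alpha> * sqrt v - y / sqrt v) * (\<alpha> / (2 * sqrt v) + y / (2 * (v * sqrt v))))
    - exp (\<alpha> * y) * (phi (- \<alpha> * sqrt v - y / sqrt v) * (- \<alpha> / (2 * sqrt v) + y / (2 * (v * sqrt v))))) / \<alpha>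
    = (?E * (\<alpha> / (2 * sqrt v) + y / (2 * (v * sqrt v))) - ?E * (- \<alpha> / (2 * sqrt v) + y / (2 * (v * sqrt v)))) / \<alpha>"
    unfolding mult.assoc[symmetric] 1 2 by simp
  also have "\<dots> = g v y"
    using \<alpha>_pos assms by (simp add: g_def field_simps)
  finally show ?thesis .
qed

lemma Phi_at_bot_compose: "filterlim f at_bot F \<Longrightarrow> ((\<lambda>x. Phi (f x)) \<longlongrightarrow> 0) F"
  by (rule filterlim_compose[OF Phi_at_bot])

lemma Phi_at_top_compose: "filterlim f at_top F \<Longrightarrow> ((\<lambda>x. Phi (f x)) \<longlongrightarrow> 1) F"
  by (rule filterlim_compose[OF Phi_at_top])

lemma arg_at_bot: "y > 0 \<Longrightarrow> filterlim (\<lambda>v. p * sqrt v - y / sqrt v) at_bot (at_right 0)"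
  by real_asymp

lemma arg_at_top: "y < 0 \<Longrightarrow> filterlim (\<lambda>v. p * sqrt v - y / sqrt v) at_top (at_right 0)"
  by real_asymp

lemma Phi_arg_0: "((\<lambda>v. Phi (p * sqrt v)) \<longlongrightarrow> 1/2) (at_right 0)"
proof -
  have "((\<lambda>v. p * sqrt v) \<longlongrightarrow> 0) (at_right 0)" by real_asymp
  from isCont_tendsto_compose[OF continuous_Phi this] show ?thesis by (simp add: Phi_0)
qed

text \<open>The sign of \<open>y\<close> decides the limit of \<open>G v y\<close> as
  \<open>v\<close> tends to 0 from the right: for \<open>y > 0\<close> both arguments of
  \<open>Phi\<close> tend to minus infinity, for \<open>y = 0\<close> both terms tend to one half
  and cancel, and for \<open>y < 0\<close> the limit would not be 0.\<close>

lemma g_has_integral: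
  assumes "c > 0" "y \<ge> 0"
  shows "((\<lambda>v. g v y) has_integral G c y) {0..c}"
proof -
  have 0: "((\<lambda>v. G v y) \<longlongrightarrow> 0) (at_right 0)"
  proof (cases "y = 0")
    case True
    have "((\<lambda>v. (Phi (\<alpha> * sqrt v) - Phi (- \<alpha> * sqrt v)) / \<alpha>) \<longlongrightarrow> (1/2 - 1/2) / \<alpha>) (at_right 0)"
      using \<alpha>_pos by (intro tendsto_intros Phi_arg_0) auto
    then show ?thesis by (simp add: G_def True)
  next
    case False
    with assms have "y > 0" by simp
    then have "((\<lambda>v. G v y) \<longlongrightarrow> (exp (- \<alpha> * y) * 0 - exp (\<alpha> * y) * 0) / \<alpha>) (at_right 0)"
      unfolding G_def using \<alpha>_pos
      by (intro tendsto_intros Phi_at_bot_compose arg_at_bot) auto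
    then show ?thesis by simp
  qed
  have "((\<lambda>v. G v y) \<longlongrightarrow> G c y) (at_left c)"
    using DERIV_isCont[OF G_deriv[OF assms(1)]] isCont_def tendsto_mono[OF at_le] by blast
  from has_integral_ftc_limits[OF assms(1) _ 0 this, of "\<lambda>v. g v y"] G_deriv
  show ?thesis by simp
qed

text \<open>This is the form in which the formula for the boundary is used: the payoff on the
  boundary is \<sigma> times the damped expected local time at 0 of a Brownian motion started
  there.\<close>

lemma B_eq_G: "1 - B c = \<sigma> * G c 0"
proof -
  have "Phi (- \<alpha> * sqrt c) = 1 - Phi (\<alpha> * sqrt c)"
    using Phi_minus[of "\<alpha> * sqrt c"] by simp
  then have "G c 0 = (2 * Phi (\<alpha> * sqrt c) - 1) / \<alpha>" by (simp add: G_def)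
  then show ?thesis by (simp add: B_def right_diff_distrib diff_divide_distrib)
qed

text \<open>Since \<open>g v y \<le> g v 0\<close>, the difference \<open>G c 0 - G c y\<close>
  increases with \<open>c\<close>; its limit at infinity is
  \<open>(1 - exp (- \<alpha> * y)) / \<alpha>\<close>. The expression
  \<open>(1 - exp (- a * y)) / a\<close> is strictly decreasing in \<open>a\<close>, and \<alpha> >
  \<sigma> gives the strict gap. Rearranged with \<open>B_eq_G\<close>, this says that
  \<open>U\<close> exceeds the payoff above the boundary.\<close>

lemma G_diff_less:
  assumes "c > 0" "y > 0"
  shows "\<sigma> * (G c 0 - G c y) < 1 - exp (- \<sigma> * y)"
proof -
  have "G c 0 - G c y \<le> (1 - exp (- \<alpha> * y)) / \<alpha>"
  proof (rule tendsto_lowerbound)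
    have "((\<lambda>v. G v 0 - G v y) \<longlongrightarrow>
       (exp (- \<alpha> * 0) * 1 - exp (\<alpha> * 0) * 0) / \<alpha> - (exp (- \<alpha> * y) * 1 - exp (\<alpha> * y) * 0) / \<alpha>) at_top"
      unfolding G_def using \<alpha>_pos
      by (intro tendsto_intros Phi_at_bot_compose Phi_at_top_compose) (auto, real_asymp+)
    then show "((\<lambda>v. G v 0 - G v y) \<longlongrightarrow> (1 - exp (- \<alpha> * y)) / \<alpha>) at_top"
      by (simp add: diff_divide_distrib)
    have "G c 0 - G c y \<le> G d 0 - G d y" if "c \<le> d" for d
    proof (rule DERIV_nonneg_imp_nondecreasing[OF that])
      fix x assume x: "c \<le> x" "x \<le> d"
      then have "phi (y / sqrt x) \<le> phi (0 / sqrt x)"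
        unfolding std_normal_density_def by (intro mult_left_mono) simp_all
      then have "g x y \<le> g x 0"
        unfolding g_def using x assms by (intro divide_right_mono mult_left_mono) auto
      then show "\<exists>D. ((\<lambda>v. G v 0 - G v y) has_real_derivative D) (at x) \<and> D \<ge> 0"
        using x assms by (intro exI[of _ "g x 0 - g x y"] conjI DERIV_diff G_deriv) auto
    qed
    then show "\<forall>\<^sub>F d in at_top. G c 0 - G c y \<le> G d 0 - G d y"
      by (auto simp: eventually_at_top_linorder)
  qed simp
  \<comment> \<open>The difference of the two quotients is 0 at \<open>y = 0\<close> and has
    derivative \<open>exp (- \<alpha> * x) - exp (- \<sigma> * x) < 0\<close>.\<close>
  moreover have "(1 - exp (- \<alpha> * 0)) / \<alpha> - (1 - exp (- \<sigma> * 0)) / \<sigma> >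
                 (1 - exp (- \<alpha> * y)) / \<alpha> - (1 - exp (- \<sigma> * y)) / \<sigma>"
  proof (rule DERIV_neg_imp_decreasing_open[OF assms(2)])
    fix x assume "0 < x" "x < y"
    show "\<exists>D. ((\<lambda>y. (1 - exp (- \<alpha> * y)) / \<alpha> - (1 - exp (- \<sigma> * y)) / \<sigma>) has_real_derivative D) (at x)
           \<and> D < 0"
      using \<alpha>_gt \<alpha>_pos \<sigma>_pos \<open>0 < x\<close>
      by (intro exI[of _ "exp (- \<alpha> * x) - exp (- \<sigma> * x)"] conjI)
         (auto intro!: derivative_eq_intros)
  qed (use \<alpha>_pos \<sigma>_pos in \<open>auto intro!: continuous_intros\<close>)
  ultimately have "G c 0 - G c y < (1 - exp (- \<sigma> * y)) / \<sigma>" by simp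
  then show ?thesis using \<sigma>_pos by (simp add: field_simps)
qed

text \<open>The first-passage decomposition of the heat kernel at a level \<open>y\<close>: \<open>h\<close> is the density of
  the hitting time of \<open>y\<close>.\<close>

lemma first_passage:
  assumes "s > 0" "y > 0"
  shows "((\<lambda>v. h v y * (phi 0 / sqrt (s - v))) has_integral phi (y / sqrt s) / sqrt s) {0..s}"
proof -
  \<comment> \<open>The substitution \<open>q = sqrt (1 / v - 1 / s)\<close> yields this
    antiderivative: \<open>(y / sqrt s)\<^sup>2 + (y * q)\<^sup>2 = (y / sqrt v)\<^sup>2\<close>, so
    the integrand becomes a constant multiple of a normal density in \<open>y * q\<close>. As
    \<open>v\<close> runs from 0 to \<open>s\<close>, \<open>q\<close> falls from infinity to 0,
    where \<open>Phi\<close> is one half; this explains the factor 2.\<close>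
  define F where "F v = - 2 * (phi (y / sqrt s) / sqrt s) * Phi (y * sqrt (1 / v - 1 / s))" for v
  have der: "(F has_real_derivative h v y * (phi 0 / sqrt (s - v))) (at v)" if v: "0 < v" "v < s" for v
  proof -
    let ?q = "sqrt (1 / v - 1 / s)"
    have pos: "1 / v - 1 / s > 0" using v by (simp add: field_simps)
    have q: "?q = sqrt (s - v) / (sqrt s * sqrt v)"
      using v by (simp add: real_sqrt_divide[symmetric] real_sqrt_mult[symmetric] field_simps)
    have "((\<lambda>v. 1 / v - 1 / s) has_real_derivative - 1 / v\<^sup>2) (at v)"
      using v by (auto intro!: derivative_eq_intros simp: power2_eq_square)
    from DERIV_chain2[OF DERIV_real_sqrt[OF pos] this]
    have "(F has_real_derivative - 2 * (phi (y / sqrt s) / sqrt s) *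
            (phi (y * ?q) * (y * (inverse ?q / 2 * (- 1 / v\<^sup>2))))) (at v)"
      unfolding F_def by (intro DERIV_cmult Phi_deriv)
    also have "inverse ?q / 2 * (- 1 / v\<^sup>2) = - 1 / v\<^sup>2 / (2 * ?q)"
      by (simp add: divide_simps)
    also have "- 2 * (phi (y / sqrt s) / sqrt s) * (phi (y * ?q) * (y * (- 1 / v\<^sup>2 / (2 * ?q))))
       = (phi (y / sqrt s) * phi (y * ?q)) * (y / (v\<^sup>2 * (sqrt s * ?q)))"
      using pos by (simp add: field_simps)
    also have "phi (y / sqrt s) * phi (y * ?q) = phi 0 * phi (y / sqrt v)"
    proof -
      have "(y / sqrt s)\<^sup>2 + (y * ?q)\<^sup>2 = (y / sqrt v)\<^sup>2"
        using v pos assms by (simp add: power_mult_distrib power_divide field_simps)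
      moreover have "sqrt ((y / sqrt v)\<^sup>2) = y / sqrt v" using v assms by simp
      ultimately show ?thesis by (simp only: phi_mult[of "y / sqrt s" "y * ?q"])
    qed
    also have "sqrt s * ?q = sqrt (s - v) / sqrt v"
      using assms v by (simp add: q)
    also have "phi 0 * phi (y / sqrt v) * (y / (v\<^sup>2 * (sqrt (s - v) / sqrt v)))
        = h v y * (phi 0 / sqrt (s - v))"
    proof -
      have "v\<^sup>2 / sqrt v = v * sqrt v"
        using v by (simp add: power2_eq_square field_simps)
      then have "v\<^sup>2 * (sqrt (s - v) / sqrt v) = v * sqrt v * sqrt (s - v)"
        by (metis times_divide_eq_left times_divide_eq_right mult.commute)
      then show ?thesis by (simp add: h_def)
    qed
    finally show ?thesis .
  qed
  have 0: "(F \<longlongrightarrow> - 2 * (phi (y / sqrt s) / sqrt s) * 1) (at_right 0)"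
    unfolding F_def using assms by (intro tendsto_intros Phi_at_top_compose) real_asymp
  have "((\<lambda>v. y * sqrt (1 / v - 1 / s)) \<longlongrightarrow> y * sqrt (1 / s - 1 / s)) (at_left s)"
    using assms by (intro tendsto_intros) auto
  then have "((\<lambda>v. y * sqrt (1 / v - 1 / s)) \<longlongrightarrow> 0) (at_left s)" by simp
  then have 1: "(F \<longlongrightarrow> - 2 * (phi (y / sqrt s) / sqrt s) * Phi 0) (at_left s)"
    unfolding F_def by (intro tendsto_intros isCont_tendsto_compose[OF continuous_Phi])
  from has_integral_ftc_limits[OF assms(1) der 0 1] show ?thesis by (simp add: Phi_0)
qed

text \<open>Write \<open>1 - B (c - v)\<close> as \<sigma> times the integral of
  \<open>g w 0\<close> over \<open>w\<close> up to \<open>c - v\<close>, put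
  \<open>s = v + w\<close> and exchange the integrals. The damping factors multiply to the one at
  time \<open>s\<close>, and the first-passage decomposition turns the inner integral into the
  kernel at \<open>y\<close>. Nonnegative integrals permit the exchange before integrability is
  known.\<close>

lemma nn_integral_hitting:
  assumes "c > 0" "y > 0"
  shows "(\<integral>\<^sup>+v. ennreal (exp (- \<alpha>\<^sup>2 * v / 2) * h v y * (1 - B (c - v))) * indicator {0..c} v \<partial>lborel)
           = ennreal (\<sigma> * G c y)"
proof -
  define e where "e v = exp (- \<alpha>\<^sup>2 * v / 2)" for v
  define f where "f v s = (if 0 < v \<and> v \<le> s \<and> s \<le> c then \<sigma> * e v * h v y * g (s - v) 0 else 0)" for v s
  have [measurable]: "e \<in> borel_measurable borel" "(\<lambda>v. h v y) \<in> borel_measurable borel"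
    "(\<lambda>v. g v 0) \<in> borel_measurable borel" "(\<lambda>v. g v y) \<in> borel_measurable borel"
    unfolding e_def h_def g_def by measurable
  have h_nonneg: "h v y \<ge> 0" if "v \<ge> 0" for v
    using that assms by (simp add: h_def)
  have g_nonneg: "g v z \<ge> 0" if "v \<ge> 0" for v z
    using that by (simp add: g_def)
  have e_pos: "e v > 0" for v by (simp add: e_def)
  have e_add: "e v * e w = e (v + w)" for v w
    by (simp add: e_def exp_add[symmetric] field_simps)
  have inner: "ennreal (e v * h v y * (1 - B (c - v))) * indicator {0..c} v = (\<integral>\<^sup>+s. ennreal (f v s) \<partial>lborel)"
    if "v \<noteq> 0" "v \<noteq> c" for v
  proof (cases "0 < v \<and> v < c")
    case True
    then have "((\<lambda>w. g w 0) has_integral G (c - v) 0) {0..c - v}"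
      by (intro g_has_integral) auto
    then have "(\<integral>\<^sup>+w. ennreal (g w 0) * indicator {0..c - v} w \<partial>lborel) = ennreal (G (c - v) 0)"
      by (intro nn_integral_has_integral_lebesgue') (auto intro: g_nonneg)
    also have "(\<integral>\<^sup>+w. ennreal (g w 0) * indicator {0..c - v} w \<partial>lborel)
             = (\<integral>\<^sup>+s. ennreal (g (s - v) 0) * indicator {v..c} s \<partial>lborel)"
      by (subst nn_integral_real_affine[where c = 1 and t = "-v"])
         (auto intro!: nn_integral_cong simp: indicator_def)
    finally have *: "(\<integral>\<^sup>+s. ennreal (g (s - v) 0) * indicator {v..c} s \<partial>lborel) = ennreal (G (c - v) 0)" .
    have "(\<integral>\<^sup>+s. ennreal (f v s) \<partial>lborel)
        = (\<integral>\<^sup>+s. ennreal (\<sigma> * e v * h v y) * (ennreal (g (s - v) 0) * indicator {v..c} s) \<partial>lborel)"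
      using True e_pos[of v] h_nonneg[of v] \<sigma>_pos g_nonneg
      by (intro nn_integral_cong) (auto simp: f_def indicator_def ennreal_mult)
    also have "\<dots> = ennreal (\<sigma> * e v * h v y) * ennreal (G (c - v) 0)"
      by (subst nn_integral_cmult) (auto simp: *)
    also have "\<dots> = ennreal (\<sigma> * e v * h v y * G (c - v) 0)"
      using True e_pos[of v] h_nonneg[of v] \<sigma>_pos by (intro ennreal_mult'[symmetric]) simp
    also have "\<sigma> * e v * h v y * G (c - v) 0 = e v * h v y * (1 - B (c - v))"
      by (simp add: B_eq_G)
    finally show ?thesis using True by simp
  next
    case False
    with that have "f v s = 0" for s by (auto simp: f_def)
    then show ?thesis using False that by auto
  qed
  have outer: "(\<integral>\<^sup>+v. ennreal (f v s) \<partial>lborel) = ennreal \<sigma> * (ennreal (g s y) * indicator {0..c} s)"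
    if "s \<noteq> 0" for s
  proof (cases "0 < s \<and> s \<le> c")
    case True
    then have s: "0 < s" "s \<le> c" by auto
    have "(\<integral>\<^sup>+v. ennreal (h v y * (phi 0 / sqrt (s - v))) * indicator {0..s} v \<partial>lborel)
        = ennreal (phi (y / sqrt s) / sqrt s)"
      using first_passage[OF s(1) assms(2)]
      by (intro nn_integral_has_integral_lebesgue' mult_nonneg_nonneg h_nonneg) auto
    note * = this
    have "(\<integral>\<^sup>+v. ennreal (f v s) \<partial>lborel)
        = (\<integral>\<^sup>+v. ennreal (\<sigma> * e s) * (ennreal (h v y * (phi 0 / sqrt (s - v))) * indicator {0..s} v) \<partial>lborel)"
    proof (intro nn_integral_cong)
      fix v
      show "ennreal (f v s) = ennreal (\<sigma> * e s) * (ennreal (h v y * (phi 0 / sqrt (s - v))) * indicator {0..s} v)"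
      proof (cases "0 < v \<and> v \<le> s")
        case True
        have "f v s = \<sigma> * (e v * e (s - v)) * (h v y * (phi 0 / sqrt (s - v)))"
          using True s by (simp add: f_def g_def e_def)
        also have "e v * e (s - v) = e s" unfolding e_add by simp
        finally show ?thesis
          using True s \<sigma>_pos e_pos[of s] by (simp only:) (auto simp: ennreal_mult'[symmetric])
      next
        case False
        then have "f v s = 0" unfolding f_def by (intro if_not_P) blast
        moreover from False have "v = 0 \<or> indicator {0..s} v = (0 :: ennreal)"
          by (auto simp: indicator_def)
        \<comment> \<open>Division by zero makes \<open>h\<close> vanish at 0, which agrees with the
          value of \<open>f\<close> at the closed end of the interval.\<close>
        moreover have "h 0 y = 0" by (simp add: h_def)
        ultimately show ?thesis by (elim disjE) simp_all
      qed
    qed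
    also have "\<dots> = ennreal (\<sigma> * e s) * ennreal (phi (y / sqrt s) / sqrt s)"
      by (rule trans[OF nn_integral_cmult]) (measurable, simp only: *)
    also have "\<dots> = ennreal (\<sigma> * e s * (phi (y / sqrt s) / sqrt s))"
      using \<sigma>_pos e_pos[of s] by (intro ennreal_mult'[symmetric]) simp
    also have "\<sigma> * e s * (phi (y / sqrt s) / sqrt s) = \<sigma> * g s y"
      by (simp add: g_def e_def)
    finally show ?thesis using True \<sigma>_pos by (simp add: ennreal_mult')
  next
    case False
    with that have "f v s = 0" for v by (auto simp: f_def)
    then show ?thesis using False that by auto
  qed
  have "(\<integral>\<^sup>+v. ennreal (e v * h v y * (1 - B (c - v))) * indicator {0..c} v \<partial>lborel)
      = (\<integral>\<^sup>+v. (\<integral>\<^sup>+s. ennreal (f v s) \<partial>lborel) \<partial>lborel)"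
    using AE_lborel_singleton[of 0] AE_lborel_singleton[of c]
    by (intro nn_integral_cong_AE) (auto intro: inner elim!: eventually_elim2)
  also have "\<dots> = (\<integral>\<^sup>+s. (\<integral>\<^sup>+v. ennreal (f v s) \<partial>lborel) \<partial>lborel)"
    unfolding f_def by (intro lborel_pair.Fubini') measurable
  also have "\<dots> = (\<integral>\<^sup>+s. ennreal \<sigma> * (ennreal (g s y) * indicator {0..c} s) \<partial>lborel)"
    using AE_lborel_singleton[of 0]
    by (intro nn_integral_cong_AE) (auto intro: outer elim!: eventually_mono)
  also have "\<dots> = ennreal \<sigma> * ennreal (G c y)"
  proof (rule trans[OF nn_integral_cmult])
    have "(\<integral>\<^sup>+s. ennreal (g s y) * indicator {0..c} s \<partial>lborel) = ennreal (G c y)"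
      using assms by (intro nn_integral_has_integral_lebesgue' g_has_integral) (auto intro: g_nonneg)
    then show "ennreal \<sigma> * (\<integral>\<^sup>+s. ennreal (g s y) * indicator {0..c} s \<partial>lborel)
                = ennreal \<sigma> * ennreal (G c y)" by (simp only:)
  qed measurable
  also have "\<dots> = ennreal (\<sigma> * G c y)"
    using \<sigma>_pos by (simp add: ennreal_mult')
  finally show ?thesis by (simp add: e_def)
qed

lemma G_nonneg: assumes "c > 0" "y \<ge> 0" shows "G c y \<ge> 0"
  using has_integral_nonneg[OF g_has_integral[OF assms]] by (simp add: g_def)

lemma hitting_has_integral:
  assumes "c > 0" "y > 0"
  shows "((\<lambda>v. exp (- \<alpha>\<^sup>2 * v / 2) * h v y * (1 - B (c - v))) has_integral \<sigma> * G c y) {0..c}"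
proof -
  let ?f = "\<lambda>v. exp (- \<alpha>\<^sup>2 * v / 2) * h v y * (1 - B (c - v))"
  have "B \<in> borel_measurable borel"
    by (intro borel_measurable_continuous_onI) (simp add: continuous_on_eq_continuous_at isCont_B)
  then have [measurable]: "?f \<in> borel_measurable borel"
    unfolding h_def by measurable
  have nonneg: "0 \<le> ?f v * indicator {0..c} v" for v
    using assms B_le_1[of "c - v"]
    by (auto simp: indicator_def h_def intro!: mult_nonneg_nonneg divide_nonneg_nonneg)
  have "((\<lambda>v. ?f v * indicator {0..c} v) has_integral \<sigma> * G c y) UNIV"
  proof (rule nn_integral_has_integral)
    show "(\<integral>\<^sup>+v. ennreal (?f v * indicator {0..c} v) \<partial>lborel) = ennreal (\<sigma> * G c y)"
      unfolding nn_integral_hitting[OF assms, symmetric]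
      by (intro nn_integral_cong) (auto simp: indicator_def)
    show "0 \<le> \<sigma> * G c y" using \<sigma>_pos G_nonneg assms by simp
  qed (use nonneg in measurable)
  also have "(\<lambda>v. ?f v * indicator {0..c} v) = (\<lambda>v. if v \<in> {0..c} then ?f v else 0)"
    by (auto simp: indicator_def)
  finally show ?thesis by (simp only: has_integral_restrict_UNIV)
qed

section \<open>The early exercise premium in closed form\<close>

definition L :: "real \<Rightarrow> real \<Rightarrow> real \<Rightarrow> real" where
  "L c v y = r * Phi ((\<sigma> * v - y) / sqrt v)
     - D (c - v) * (exp (\<sigma> * y - \<sigma>\<^sup>2 * v / 2) * Phi (- y / sqrt v))"

text \<open>Both \<open>L\<close> and \<open>Euro\<close> are Gaussian expectations for
  \<open>Y\<close> started at \<open>y\<close> with time \<open>c\<close> to maturity: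
  \<open>L c v y\<close> is the expected loss rate after time \<open>v\<close>, not yet discounted,
  and \<open>Euro c y\<close> the discounted expected payoff at maturity. This is
  \<open>truncated_put_integral\<close>.\<close>

definition Euro :: "real \<Rightarrow> real \<Rightarrow> real" where
  "Euro c y = exp (- r * c) * (Phi ((\<sigma> * c - y) / sqrt c)
     - exp (\<sigma> * y - \<sigma>\<^sup>2 * c / 2) * Phi (- y / sqrt c))"

text \<open>For \<open>y > 0\<close> this is the expected discounted payoff of stopping when
  \<open>Y\<close> first reaches 0: the tilt contributes
  \<open>exp (\<sigma> * y - \<sigma>\<^sup>2 * v / 2)\<close>, and integrating over the hitting
  time \<open>v\<close> gives \<open>hitting_has_integral\<close>. Paths that stay above 0 up to
  maturity pay nothing.\<close>

definition U :: "real \<Rightarrow> real \<Rightarrow> real" where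
  "U c y = (if y \<le> 0 then 1 - B c * exp (\<sigma> * y) else \<sigma> * exp (\<sigma> * y) * G c y)"

text \<open>The discounted expectation after time \<open>v\<close> of the payoff restricted to
  negative \<open>Y\<close> is \<open>\<Psi> v\<close>. It decreases by the loss rate and increases
  by a term \<open>j\<close> created by cutting the payoff off at 0: half of \<sigma> times the
  damped kernel, plus half of the damped hitting density times the jump
  \<open>1 - B (c - v)\<close>. In the integral of \<open>j\<close> the two halves are equal for
  \<open>y > 0\<close>; they cancel for \<open>y < 0\<close>, since \<open>g\<close> is even and
  \<open>h\<close> odd in \<open>y\<close>; for \<open>y = 0\<close> only the kernel
  remains.\<close>

lemma premium_has_integral:
  assumes "c > 0"
  shows "((\<lambda>v. exp (- r * v) * L c v y) has_integral (U c y - Euro c y)) {0..c}"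
proof -
  define \<Psi> where "\<Psi> v = exp (- r * v) * Phi (\<sigma> * sqrt v - y / sqrt v)
      - exp (\<sigma> * y) * (exp (- \<alpha>\<^sup>2 * v / 2) * B (c - v) * Phi (0 * sqrt v - y / sqrt v))" for v
  define j where "j v = g v y * \<sigma> / 2 + exp (- \<alpha>\<^sup>2 * v / 2) * h v y * (1 - B (c - v)) / 2" for v
  have arg: "(\<sigma> * v - y) / sqrt v = \<sigma> * sqrt v - y / sqrt v" if "v > 0" for v
  proof -
    have "\<sigma> * v / sqrt v = \<sigma> * sqrt v" using that
      by (simp add: real_div_sqrt flip: times_divide_eq_right)
    then show ?thesis by (simp add: diff_divide_distrib)
  qed
  have exp_split: "exp (- r * v) * exp (\<sigma> * y - \<sigma>\<^sup>2 * v / 2) = exp (\<sigma> * y) * exp (- \<alpha>\<^sup>2 * v / 2)" for v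
    unfolding exp_add[symmetric] \<alpha>_sq by (rule arg_cong[where f = exp]) (simp add: field_simps)
  have der: "(\<Psi> has_real_derivative (exp (\<sigma> * y) * j v - exp (- r * v) * L c v y)) (at v)"
    if v: "0 < v" "v < c" for v
  proof -
    let ?E = "exp (- \<alpha>\<^sup>2 * v / 2)" and ?P = "Phi (\<sigma> * sqrt v - y / sqrt v)"
      and ?Q = "Phi (0 * sqrt v - y / sqrt v)"
    have 1: "((\<lambda>v. exp (- r * v)) has_real_derivative exp (- r * v) * (- r)) (at v)"
      by (auto intro!: derivative_eq_intros)
    have 2: "((\<lambda>v. exp (- \<alpha>\<^sup>2 * v / 2)) has_real_derivative ?E * (- \<alpha>\<^sup>2 / 2)) (at v)"
      by (auto intro!: derivative_eq_intros)
    have "((\<lambda>v. c - v) has_real_derivative - 1) (at v)"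
      by (auto intro!: derivative_eq_intros)
    from DERIV_chain2[OF B_deriv this] v
    have 3: "((\<lambda>v. B (c - v)) has_real_derivative dB (c - v) * - 1) (at v)" by simp
    have d: "(\<Psi> has_real_derivative
       (exp (- r * v) * (- r) * ?P + phi (\<sigma> * sqrt v - y / sqrt v) * (\<sigma> / (2 * sqrt v) + y / (2 * (v * sqrt v))) * exp (- r * v))
       - exp (\<sigma> * y) * ((?E * (- \<alpha>\<^sup>2 / 2) * B (c - v) + dB (c - v) * - 1 * ?E) * ?Q
           + phi (0 * sqrt v - y / sqrt v) * (0 / (2 * sqrt v) + y / (2 * (v * sqrt v))) * (?E * B (c - v)))) (at v)"
      unfolding \<Psi>_def by (intro DERIV_diff DERIV_mult DERIV_cmult Phi_deriv arg_deriv 1 2 3 v)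
    have p: "phi (\<sigma> * sqrt v - y / sqrt v) * exp (- r * v) = exp (\<sigma> * y) * (?E * phi (y / sqrt v))"
    proof -
      have "exp (- \<sigma>\<^sup>2 * v / 2) * exp (- r * v) = ?E"
        unfolding exp_add[symmetric] \<alpha>_sq by (rule arg_cong[where f = exp]) (simp add: field_simps)
      from this[symmetric] show ?thesis unfolding phi_shift[OF v(1)]
        by (simp only: mult_ac)
    qed
    have p0: "phi (0 * sqrt v - y / sqrt v) = phi (y / sqrt v)"
      using phi_minus[of "y / sqrt v"] by simp
    have "exp (- r * v) * L c v y = r * exp (- r * v) * ?P - D (c - v) * (exp (\<sigma> * y) * ?E) * ?Q"
      unfolding L_def arg[OF v(1)] exp_split[symmetric] by (simp add: algebra_simps)
    moreover have "j v = ?E * phi (y / sqrt v) * (\<sigma> / (2 * sqrt v)) + ?E * phi (y / sqrt v) * (y / (2 * (v * sqrt v))) * (1 - B (c - v))"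
      by (simp add: j_def g_def h_def)
    moreover have "phi (\<sigma> * sqrt v - y / sqrt v) * (\<sigma> / (2 * sqrt v) + y / (2 * (v * sqrt v))) * exp (- r * v)
      = (phi (\<sigma> * sqrt v - y / sqrt v) * exp (- r * v)) * (\<sigma> / (2 * sqrt v) + y / (2 * (v * sqrt v)))"
      by (simp only: mult_ac)
    \<comment> \<open>Naming the two quotients turns the comparison of the derivatives into a
      polynomial identity.\<close>
    moreover obtain w where "y / (2 * (v * sqrt v)) = w" by simp
    moreover obtain u where "\<sigma> / (2 * sqrt v) = u" by simp
    ultimately show ?thesis
      by (intro DERIV_cong[OF d]) (simp only: p p0 D_def, simp add: algebra_simps)
  qed
  \<comment> \<open>The limit as \<open>v\<close> tends to 0: the whole payoff when started below
    the boundary, half of it on the boundary, nothing above.\<close>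
  define \<Psi>0 where "\<Psi>0 = (if y < 0 then 1 - exp (\<sigma> * y) * B c else if y = 0 then (1 - B c) / 2 else 0)"
  have B0: "((\<lambda>v. B (c - v)) \<longlongrightarrow> B (c - 0)) (at_right 0)"
    by (intro isCont_tendsto_compose[OF isCont_B] tendsto_intros)
  have lim0: "(\<Psi> \<longlongrightarrow> \<Psi>0) (at_right 0)"
  proof -
    define l :: real where "l = (if y < 0 then 1 else if y = 0 then 1 / 2 else 0)"
    have P: "((\<lambda>v. Phi (p * sqrt v - y / sqrt v)) \<longlongrightarrow> l) (at_right 0)" for p
      using Phi_at_bot_compose[OF arg_at_bot, of y p] Phi_at_top_compose[OF arg_at_top, of y p]
        Phi_arg_0[of p] by (auto simp: l_def)
    have "(\<Psi> \<longlongrightarrow> exp (- r * 0) * l - exp (\<sigma> * y) * (exp (- \<alpha>\<^sup>2 * 0 / 2) * B (c - 0) * l)) (at_right 0)"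
      unfolding \<Psi>_def by (intro tendsto_intros P B0) auto
    also have "exp (- r * 0) * l - exp (\<sigma> * y) * (exp (- \<alpha>\<^sup>2 * 0 / 2) * B (c - 0) * l) = \<Psi>0"
      by (auto simp: l_def \<Psi>0_def)
    finally show ?thesis .
  qed
  have limc: "(\<Psi> \<longlongrightarrow> Euro c y) (at_left c)"
  proof -
    have "isCont \<Psi> c"
      unfolding \<Psi>_def using assms
      by (intro continuous_intros isCont_o2[OF _ isCont_B] isCont_o2[OF _ continuous_Phi]) auto
    moreover have "\<Psi> c = Euro c y"
      using exp_split[of c] by (simp add: \<Psi>_def Euro_def arg[OF assms] B_0 algebra_simps)
    ultimately show ?thesis
      by (metis isCont_def tendsto_mono at_le subset_UNIV)
  qed
  have Psi: "((\<lambda>v. exp (\<sigma> * y) * j v - exp (- r * v) * L c v y) has_integral (Euro c y - \<Psi>0)) {0..c}"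
    by (rule has_integral_ftc_limits[OF assms der lim0 limc])
  define J where "J = (if y > 0 then \<sigma> * G c y else if y = 0 then (1 - B c) / 2 else 0)"
  have "(j has_integral J) {0..c}"
  proof -
    consider "y > 0" | "y = 0" | "y < 0" by linarith
    then show ?thesis
    proof cases
      case 1
      have "(j has_integral (G c y * \<sigma> / 2 + \<sigma> * G c y / 2)) {0..c}"
        unfolding j_def using assms 1
        by (intro has_integral_add has_integral_divide has_integral_mult_left g_has_integral hitting_has_integral) auto
      then show ?thesis using 1 by (simp add: J_def algebra_simps)
    next
      case 2
      have "(j has_integral (G c y * \<sigma> / 2)) {0..c}"
        using has_integral_divide[OF has_integral_mult_left[OF g_has_integral[OF assms, of y], of \<sigma>], of 2] 2
        by (simp add: j_def[abs_def] h_def)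
      then show ?thesis using 2 by (simp add: J_def B_eq_G mult.commute)
    next
      case 3
      have "((\<lambda>v. g v (- y) * \<sigma> / 2 - exp (- \<alpha>\<^sup>2 * v / 2) * h v (- y) * (1 - B (c - v)) / 2)
              has_integral (G c (- y) * \<sigma> / 2 - \<sigma> * G c (- y) / 2)) {0..c}"
        using assms 3
        by (intro has_integral_diff has_integral_divide has_integral_mult_left g_has_integral hitting_has_integral) auto
      also have "(\<lambda>v. g v (- y) * \<sigma> / 2 - exp (- \<alpha>\<^sup>2 * v / 2) * h v (- y) * (1 - B (c - v)) / 2) = j"
        by (simp add: fun_eq_iff j_def g_def h_def phi_minus)
      finally show ?thesis using 3 by (simp add: J_def)
    qed
  qed
  then have "((\<lambda>v. exp (\<sigma> * y) * j v) has_integral exp (\<sigma> * y) * J) {0..c}"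
    by (rule has_integral_mult_right)
  from has_integral_diff[OF this Psi]
  have "((\<lambda>v. exp (- r * v) * L c v y) has_integral exp (\<sigma> * y) * J - (Euro c y - \<Psi>0)) {0..c}"
    by simp
  also have "exp (\<sigma> * y) * J - (Euro c y - \<Psi>0) = U c y - Euro c y"
    by (simp add: J_def \<Psi>0_def U_def field_simps)
  finally show ?thesis .
qed

lemma U_gt:
  assumes "c > 0" "y > 0"
  shows "U c y > 1 - B c * exp (\<sigma> * y)"
proof -
  have "\<sigma> * G c 0 - (1 - exp (- \<sigma> * y)) < \<sigma> * G c y"
    using G_diff_less[OF assms] by (simp add: algebra_simps)
  then have "exp (\<sigma> * y) * (exp (- \<sigma> * y) - B c) < exp (\<sigma> * y) * (\<sigma> * G c y)"
    using B_eq_G[of c] by (intro mult_strict_left_mono) auto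
  then show ?thesis
    using assms by (simp add: U_def algebra_simps exp_add[symmetric])
qed

lemma U_nonneg: "c > 0 \<Longrightarrow> U c y \<ge> 0"
proof (cases "y \<le> 0")
  case True
  assume c: "c > 0"
  have "B c * exp (\<sigma> * y) \<le> 1 * 1"
    using B_le_1[of c] c True \<sigma>_pos by (intro mult_mono) (auto simp: mult_nonneg_nonpos)
  with True show ?thesis by (simp add: U_def)
next
  case False
  assume "c > 0"
  with False show ?thesis using G_nonneg[of c y] \<sigma>_pos by (simp add: U_def)
qed

lemma U_ge_payoff: "c > 0 \<Longrightarrow> max 0 (1 - B c * exp (\<sigma> * y)) \<le> U c y"
  using U_gt[of c y] U_nonneg[of c y] by (cases "y > 0") (auto simp: U_def)

end

section \<open>Convergence in probability\<close>

lemma integrable_mult_sq: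
  fixes a b :: "'a \<Rightarrow> real"
  assumes [measurable]: "a \<in> borel_measurable M" "b \<in> borel_measurable M"
    and "integrable M (\<lambda>x. (a x)\<^sup>2)" "integrable M (\<lambda>x. (b x)\<^sup>2)"
  shows "integrable M (\<lambda>x. a x * b x)"
proof (rule Bochner_Integration.integrable_bound)
  show "integrable M (\<lambda>x. (a x)\<^sup>2 + (b x)\<^sup>2)" using assms by simp
  have "\<bar>u * v\<bar> \<le> u\<^sup>2 + v\<^sup>2" for u v :: real
  proof -
    have "\<bar>u\<bar> * \<bar>v\<bar> * 2 \<le> u\<^sup>2 + v\<^sup>2"
      using sum_squares_bound[of "\<bar>u\<bar>" "\<bar>v\<bar>"] by simp
    moreover have "0 \<le> \<bar>u\<bar> * \<bar>v\<bar>" by simp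
    ultimately show ?thesis unfolding abs_mult by linarith
  qed
  then show "AE x in M. norm (a x * b x) \<le> norm ((a x)\<^sup>2 + (b x)\<^sup>2)"
    by (intro AE_I2) (smt (verit) real_norm_def abs_of_nonneg zero_le_power2)
qed measurable

text \<open>Measurability is part of the notion, so that the sets whose \<open>measure\<close> is
  taken are events.\<close>

definition conv_prob :: "'a measure \<Rightarrow> (nat \<Rightarrow> 'a \<Rightarrow> real) \<Rightarrow> ('a \<Rightarrow> real) \<Rightarrow> bool" where
  "conv_prob M f g \<longleftrightarrow> (\<forall>n. f n \<in> borel_measurable M) \<and> g \<in> borel_measurable M \<and>
     (\<forall>\<epsilon>>0. (\<lambda>n. measure M {\<omega> \<in> space M. \<epsilon> < \<bar>f n \<omega> - g \<omega>\<bar>}) \<longlonglongrightarrow> 0)"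

context prob_space
begin

lemma Chebyshev_sq:
  assumes [measurable]: "f \<in> borel_measurable M" and "integrable M (\<lambda>x. (f x)\<^sup>2)" and "\<epsilon> > 0"
  shows "prob {x \<in> space M. \<epsilon> < \<bar>f x\<bar>} \<le> expectation (\<lambda>x. (f x)\<^sup>2) / \<epsilon>\<^sup>2"
proof -
  have "prob {x \<in> space M. \<epsilon> < \<bar>f x\<bar>} \<le> prob {x \<in> space M. \<epsilon>\<^sup>2 \<le> (f x)\<^sup>2}"
    using assms(3) by (intro finite_measure_mono) (auto simp: abs_le_square_iff[symmetric])
  also have "\<dots> \<le> expectation (\<lambda>x. (f x)\<^sup>2) / \<epsilon>\<^sup>2"
    using assms by (intro integral_Markov_inequality_measure[where A = "{}"]) auto
  finally show ?thesis .
qed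

lemma conv_prob_add:
  assumes f: "conv_prob M f f'" and g: "conv_prob M g g'"
  shows "conv_prob M (\<lambda>n \<omega>. f n \<omega> + g n \<omega>) (\<lambda>\<omega>. f' \<omega> + g' \<omega>)"
proof -
  have [measurable]: "f n \<in> borel_measurable M" "g n \<in> borel_measurable M"
    "f' \<in> borel_measurable M" "g' \<in> borel_measurable M" for n
    using assms by (auto simp: conv_prob_def)
  have "(\<lambda>n. prob {\<omega> \<in> space M. \<epsilon> < \<bar>f n \<omega> + g n \<omega> - (f' \<omega> + g' \<omega>)\<bar>}) \<longlonglongrightarrow> 0" if "\<epsilon> > 0" for \<epsilon>
  proof (rule tendsto_sandwich[OF _ _ tendsto_const])
    show "(\<lambda>n. prob {\<omega> \<in> space M. \<epsilon>/2 < \<bar>f n \<omega> - f' \<omega>\<bar>}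
              + prob {\<omega> \<in> space M. \<epsilon>/2 < \<bar>g n \<omega> - g' \<omega>\<bar>}) \<longlonglongrightarrow> 0"
      using assms that half_gt_zero[OF that] unfolding conv_prob_def by (intro tendsto_add_zero) blast+
    have "prob {\<omega> \<in> space M. \<epsilon> < \<bar>f n \<omega> + g n \<omega> - (f' \<omega> + g' \<omega>)\<bar>}
      \<le> prob ({\<omega> \<in> space M. \<epsilon>/2 < \<bar>f n \<omega> - f' \<omega>\<bar>} \<union> {\<omega> \<in> space M. \<epsilon>/2 < \<bar>g n \<omega> - g' \<omega>\<bar>})" for n
    proof (intro finite_measure_mono subsetI)
      fix \<omega> assume "\<omega> \<in> {\<omega> \<in> space M. \<epsilon> < \<bar>f n \<omega> + g n \<omega> - (f' \<omega> + g' \<omega>)\<bar>}"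
      then have "\<omega> \<in> space M" "\<epsilon>/2 < \<bar>f n \<omega> - f' \<omega>\<bar> \<or> \<epsilon>/2 < \<bar>g n \<omega> - g' \<omega>\<bar>"
        unfolding mem_Collect_eq by (blast, argo)
      then show "\<omega> \<in> {\<omega> \<in> space M. \<epsilon>/2 < \<bar>f n \<omega> - f' \<omega>\<bar>} \<union> {\<omega> \<in> space M. \<epsilon>/2 < \<bar>g n \<omega> - g' \<omega>\<bar>}"
        by blast
    qed measurable
    also have "prob ({\<omega> \<in> space M. \<epsilon>/2 < \<bar>f n \<omega> - f' \<omega>\<bar>} \<union> {\<omega> \<in> space M. \<epsilon>/2 < \<bar>g n \<omega> - g' \<omega>\<bar>})
      \<le> prob {\<omega> \<in> space M. \<epsilon>/2 < \<bar>f n \<omega> - f' \<omega>\<bar>} + prob {\<omega> \<in> space M. \<epsilon>/2 < \<bar>g n \<omega> - g' \<omega>\<bar>}" for n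
      by (intro measure_Un_le) auto
    finally show "\<forall>\<^sub>F n in sequentially. prob {\<omega> \<in> space M. \<epsilon> < \<bar>f n \<omega> + g n \<omega> - (f' \<omega> + g' \<omega>)\<bar>}
      \<le> prob {\<omega> \<in> space M. \<epsilon>/2 < \<bar>f n \<omega> - f' \<omega>\<bar>} + prob {\<omega> \<in> space M. \<epsilon>/2 < \<bar>g n \<omega> - g' \<omega>\<bar>}"
      by simp
  qed simp
  then show ?thesis by (simp add: conv_prob_def)
qed

lemma conv_prob_cmult:
  assumes f: "conv_prob M f f'"
  shows "conv_prob M (\<lambda>n \<omega>. c * f n \<omega>) (\<lambda>\<omega>. c * f' \<omega>)"
proof (cases "c = 0")
  case False
  have "(\<lambda>n. prob {\<omega> \<in> space M. \<epsilon> < \<bar>c * f n \<omega> - c * f' \<omega>\<bar>}) \<longlonglongrightarrow> 0" if "\<epsilon> > 0" for \<epsilon>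
  proof -
    have "(\<epsilon> < \<bar>c * u - c * v\<bar>) = (\<epsilon> / \<bar>c\<bar> < \<bar>u - v\<bar>)" for u v
      using False by (simp only: right_diff_distrib[symmetric] abs_mult) (simp add: pos_divide_less_eq mult.commute)
    moreover have "\<epsilon> / \<bar>c\<bar> > 0" using that False by simp
    ultimately show ?thesis using f by (simp add: conv_prob_def)
  qed
  then show ?thesis using f by (simp add: conv_prob_def borel_measurable_times)
qed (auto simp: conv_prob_def)

lemma conv_prob_AE:
  assumes [measurable]: "\<And>n. f n \<in> borel_measurable M" "f' \<in> borel_measurable M"
    and ae: "AE \<omega> in M. (\<lambda>n. f n \<omega>) \<longlonglongrightarrow> f' \<omega>"
  shows "conv_prob M f f'"
proof -
  have "(\<lambda>n. prob {\<omega> \<in> space M. \<epsilon> < \<bar>f n \<omega> - f' \<omega>\<bar>}) \<longlonglongrightarrow> 0" if "\<epsilon> > 0" for \<epsilon>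
  proof -
    have "(\<lambda>n. expectation (indicator {\<omega> \<in> space M. \<epsilon> < \<bar>f n \<omega> - f' \<omega>\<bar>})) \<longlonglongrightarrow> expectation (\<lambda>_. 0 :: real)"
    proof (rule integral_dominated_convergence[where w = "\<lambda>_. 1"])
      show "AE \<omega> in M. (\<lambda>n. indicator {\<omega> \<in> space M. \<epsilon> < \<bar>f n \<omega> - f' \<omega>\<bar>} \<omega> :: real) \<longlonglongrightarrow> 0"
        using ae
      proof eventually_elim
        case (elim \<omega>)
        then have "\<forall>\<^sub>F n in sequentially. \<bar>f n \<omega> - f' \<omega>\<bar> < \<epsilon>"
          using that by (auto simp: tendsto_iff dist_real_def)
        then show ?case by (intro tendsto_eventually) (auto elim!: eventually_mono)
      qed
    qed (auto simp: indicator_def)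
    then show ?thesis by simp
  qed
  then show ?thesis by (simp add: conv_prob_def)
qed

lemma conv_prob_L2:
  assumes [measurable]: "\<And>n. f n \<in> borel_measurable M"
    and "\<And>n. integrable M (\<lambda>\<omega>. (f n \<omega>)\<^sup>2)"
    and lim: "(\<lambda>n. expectation (\<lambda>\<omega>. (f n \<omega>)\<^sup>2)) \<longlonglongrightarrow> 0"
  shows "conv_prob M f (\<lambda>_. 0)"
proof -
  have "(\<lambda>n. prob {\<omega> \<in> space M. \<epsilon> < \<bar>f n \<omega>\<bar>}) \<longlonglongrightarrow> 0" if "\<epsilon> > 0" for \<epsilon>
  proof (rule tendsto_sandwich[OF _ _ tendsto_const])
    show "(\<lambda>n. expectation (\<lambda>\<omega>. (f n \<omega>)\<^sup>2) / \<epsilon>\<^sup>2) \<longlonglongrightarrow> 0"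
      using tendsto_divide[OF lim tendsto_const, of "\<epsilon>\<^sup>2"] that by simp
  qed (use assms that in \<open>auto intro!: always_eventually Chebyshev_sq\<close>)
  then show ?thesis by (simp add: conv_prob_def)
qed

text \<open>A Fatou bound obtained without subsequences. Where \<open>f n\<close> is within
  \<epsilon> of \<open>g\<close>, the square of \<open>g\<close> is at most twice that of
  \<open>f n\<close> plus \<open>2 * \<epsilon>\<^sup>2\<close>; elsewhere it is at most
  \<open>C\<^sup>2\<close>, on an event of vanishing probability. The factor 2 reappears in the
  constant of the Gronwall estimate.\<close>

lemma conv_prob_bounded_sq:
  assumes f: "conv_prob M f g" and C: "\<And>\<omega>. \<omega> \<in> space M \<Longrightarrow> \<bar>g \<omega>\<bar> \<le> C"
    and int: "\<And>n. integrable M (\<lambda>\<omega>. (f n \<omega>)\<^sup>2)" and B: "\<And>n. expectation (\<lambda>\<omega>. (f n \<omega>)\<^sup>2) \<le> B"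
  shows "expectation (\<lambda>\<omega>. (g \<omega>)\<^sup>2) \<le> 2 * B"
proof -
  have [measurable]: "f n \<in> borel_measurable M" "g \<in> borel_measurable M" for n
    using f by (auto simp: conv_prob_def)
  have C0: "C \<ge> 0" using C not_empty by (metis abs_ge_zero all_not_in_conv order_trans)
  have sq: "(g \<omega>)\<^sup>2 \<le> C\<^sup>2" if "\<omega> \<in> space M" for \<omega>
    using C[OF that] C0 by (simp add: abs_le_square_iff[symmetric])
  have main: "expectation (\<lambda>\<omega>. (g \<omega>)\<^sup>2) \<le> 2 * B + 2 * \<epsilon>\<^sup>2" if "\<epsilon> > 0" for \<epsilon>
  proof (rule tendsto_lowerbound)
    let ?A = "\<lambda>n. {\<omega> \<in> space M. \<epsilon> < \<bar>f n \<omega> - g \<omega>\<bar>}"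
    have "(\<lambda>n. 2 * B + 2 * \<epsilon>\<^sup>2 + C\<^sup>2 * prob (?A n)) \<longlonglongrightarrow> 2 * B + 2 * \<epsilon>\<^sup>2 + C\<^sup>2 * 0"
      using f that by (intro tendsto_intros) (auto simp: conv_prob_def)
    then show "(\<lambda>n. 2 * B + 2 * \<epsilon>\<^sup>2 + C\<^sup>2 * prob (?A n)) \<longlonglongrightarrow> 2 * B + 2 * \<epsilon>\<^sup>2" by simp
    show "\<forall>\<^sub>F n in sequentially. expectation (\<lambda>\<omega>. (g \<omega>)\<^sup>2) \<le> 2 * B + 2 * \<epsilon>\<^sup>2 + C\<^sup>2 * prob (?A n)"
    proof (rule always_eventually, rule allI)
      fix n
      have ind: "integrable M (indicator (?A n) :: 'a \<Rightarrow> real)"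
        by (intro integrable_real_indicator) (auto simp: emeasure_eq_measure)
      have "expectation (\<lambda>\<omega>. (g \<omega>)\<^sup>2)
          \<le> expectation (\<lambda>\<omega>. 2 * (f n \<omega>)\<^sup>2 + 2 * \<epsilon>\<^sup>2 + C\<^sup>2 * indicator (?A n) \<omega>)"
      proof (rule integral_mono)
        show "integrable M (\<lambda>\<omega>. (g \<omega>)\<^sup>2)"
          using sq by (intro integrable_const_bound[where B = "C\<^sup>2"]) auto
        show "integrable M (\<lambda>\<omega>. 2 * (f n \<omega>)\<^sup>2 + 2 * \<epsilon>\<^sup>2 + C\<^sup>2 * indicator (?A n) \<omega>)"
          using int ind by (intro Bochner_Integration.integrable_add integrable_mult_right) auto
        fix \<omega> assume \<omega>: "\<omega> \<in> space M"
        show "(g \<omega>)\<^sup>2 \<le> 2 * (f n \<omega>)\<^sup>2 + 2 * \<epsilon>\<^sup>2 + C\<^sup>2 * indicator (?A n) \<omega>"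
        proof (cases "\<omega> \<in> ?A n")
          case True
          then show ?thesis using sq[OF \<omega>] by (simp add: add_increasing)
        next
          case False
          then have "\<bar>f n \<omega> - g \<omega>\<bar> \<le> \<bar>\<epsilon>\<bar>" using \<omega> that by simp
          then have 1: "(f n \<omega> - g \<omega>)\<^sup>2 \<le> \<epsilon>\<^sup>2" by (simp only: abs_le_square_iff)
          have "(g \<omega>)\<^sup>2 \<le> 2 * (f n \<omega>)\<^sup>2 + 2 * (f n \<omega> - g \<omega>)\<^sup>2"
            using zero_le_power2[of "2 * f n \<omega> - g \<omega>"] by (simp add: power2_eq_square algebra_simps)
          with 1 False show ?thesis by simp
        qed
      qed
      also have "\<dots> = 2 * expectation (\<lambda>\<omega>. (f n \<omega>)\<^sup>2) + 2 * \<epsilon>\<^sup>2 + C\<^sup>2 * prob (?A n)"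
        using int ind by (simp add: prob_space)
      finally show "expectation (\<lambda>\<omega>. (g \<omega>)\<^sup>2) \<le> 2 * B + 2 * \<epsilon>\<^sup>2 + C\<^sup>2 * prob (?A n)"
        using B[of n] by linarith
    qed
  qed simp
  show ?thesis
  proof (rule field_le_epsilon)
    fix e :: real assume "e > 0"
    then show "expectation (\<lambda>\<omega>. (g \<omega>)\<^sup>2) \<le> 2 * B + e"
      using main[of "sqrt (e / 2)"] by simp
  qed
qed

end

section \<open>Finite partitions of an interval\<close>

lemma ex_strict_enumeration:
  fixes Q :: "real set"
  assumes "finite Q" "Q \<noteq> {}"
  shows "\<exists>K q. (\<forall>m<K. q m < q (Suc m)) \<and> q ` {..K::nat} = Q"
  using assms
proof (induction rule: finite_linorder_max_induct)
  case (insert b A)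
  show ?case
  proof (cases "A = {}")
    case True
    then show ?thesis by (intro exI[of _ 0] exI[of _ "\<lambda>_. b"]) auto
  next
    case False
    then obtain K q where q: "\<forall>m<K. q m < q (Suc m)" "q ` {..K::nat} = A"
      using insert by blast
    have "q m < b" if "m \<le> K" for m using insert.hyps(2) q(2) that by auto
    then have "\<forall>m<Suc K. (q(Suc K := b)) m < (q(Suc K := b)) (Suc m)"
      using q(1) by (auto simp: less_Suc_eq)
    moreover have "(q(Suc K := b)) ` {..Suc K} = insert b A"
      using q(2) by (auto simp: atMost_Suc image_iff)
    ultimately show ?thesis by blast
  qed
qed simp

lemma strict_chain_less:
  fixes q :: "nat \<Rightarrow> real"
  assumes "\<And>m. m < K \<Longrightarrow> q m < q (Suc m)" "i < j" "j \<le> K"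
  shows "q i < q j"
  using assms(2,3)
proof (induction j)
  case (Suc j)
  then show ?case using assms(1)[of j] by (cases "i = j") auto
qed simp

lemma strict_chain_less_iff:
  fixes q :: "nat \<Rightarrow> real"
  assumes "\<And>m. m < K \<Longrightarrow> q m < q (Suc m)" "i \<le> K" "j \<le> K"
  shows "q i < q j \<longleftrightarrow> i < j"
  using strict_chain_less[of K q i j] strict_chain_less[of K q j i] assms
  by (cases i j rule: linorder_cases) auto

text \<open>An increment over a coarse interval becomes a sum over the fine intervals inside it. A
  fine interval is recognised by its right end point, because the coarse ones are open on the
  left.\<close>

lemma chain_telescope:
  fixes q w :: "nat \<Rightarrow> real"
  assumes q: "\<And>m. m < K \<Longrightarrow> q m < q (Suc m)" and "c \<le> d" "d \<le> K"
  shows "(\<Sum>m<K. indicator {q c<..q d} (q (Suc m)) * (w (Suc m) - w m)) = w d - w c"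
proof -
  have "indicator {q c<..q d} (q (Suc m)) = (if m \<in> {c..<d} then 1 else 0 :: real)" if "m < K" for m
    using strict_chain_less_iff[of K q c "Suc m"] strict_chain_less_iff[of K q d "Suc m"] assms that
    by (auto simp: indicator_def)
  then have "(\<Sum>m<K. indicator {q c<..q d} (q (Suc m)) * (w (Suc m) - w m))
    = (\<Sum>m<K. if m \<in> {c..<d} then w (Suc m) - w m else 0)"
    by (intro sum.cong) auto
  also have "\<dots> = (\<Sum>m\<in>{c..<d}. w (Suc m) - w m)"
    using assms by (subst sum.inter_restrict[symmetric]) (auto intro!: sum.cong)
  also have "\<dots> = w d - w c"
    using assms by (intro sum_Suc_diff')
  finally show ?thesis .
qed

lemma chain_indicator:
  fixes q :: "nat \<Rightarrow> real"
  assumes "\<And>m. m < K \<Longrightarrow> q m \<le> q (Suc m)"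
  shows "(\<Sum>m<K. indicator {q m<..q (Suc m)} u) = (indicator {q 0<..q K} u :: real)"
  using assms
proof (induction K)
  case (Suc K)
  have "q 0 \<le> q K"
  proof -
    have "i \<le> K \<Longrightarrow> q 0 \<le> q i" for i
      by (induction i) (use Suc.prems in \<open>auto intro: order_trans\<close>)
    then show ?thesis by simp
  qed
  moreover have "q K \<le> q (Suc K)" using Suc.prems by simp
  moreover have "(\<Sum>m<K. indicator {q m<..q (Suc m)} u) = (indicator {q 0<..q K} u :: real)"
    using Suc by simp
  ultimately show ?case by (simp only: sum.lessThan_Suc) (auto simp: indicator_def)
qed simp

text \<open>Completing the square; this is the change of measure for a single increment.\<close>

lemma normal_density_exp:
  assumes "s > 0"
  shows "normal_density 0 s x * exp (c * x) = exp (c\<^sup>2 * s\<^sup>2 / 2) * normal_density (c * s\<^sup>2) s x"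
proof -
  have "- (x - 0)\<^sup>2 / (2 * s\<^sup>2) + c * x = c\<^sup>2 * s\<^sup>2 / 2 + - (x - c * s\<^sup>2)\<^sup>2 / (2 * s\<^sup>2)"
    using assms by (simp add: field_simps power2_eq_square)
  then have "exp (- (x - 0)\<^sup>2 / (2 * s\<^sup>2)) * exp (c * x)
      = exp (c\<^sup>2 * s\<^sup>2 / 2) * exp (- (x - c * s\<^sup>2)\<^sup>2 / (2 * s\<^sup>2))"
    by (simp only: exp_add[symmetric])
  then show ?thesis by (simp add: normal_density_def)
qed

section \<open>Increments of Brownian motion and their transforms\<close>

locale brownian = prob_space M for M :: "'a measure" +
  fixes F :: "real \<Rightarrow> 'a measure" and W :: "real \<Rightarrow> 'a \<Rightarrow> real"
  assumes bm: "brownian_motion M F W"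
begin

lemma filt: "filtration (space M) F"
  using bm by (simp add: brownian_motion_def)

lemma space_F: "space (F s) = space M"
  using filtration.space_F[OF filt] .

lemma subalg: "0 \<le> s \<Longrightarrow> subalgebra M (F s)"
  using bm by (auto simp: brownian_motion_def subalgebra_def space_F)

lemma subalg_mono: "s \<le> s' \<Longrightarrow> subalgebra (F s') (F s)"
  using filtration.sets_F_mono[OF filt] by (auto simp: subalgebra_def space_F)

lemma measurable_F_M: "f \<in> measurable (F s) N \<Longrightarrow> 0 \<le> s \<Longrightarrow> f \<in> measurable M N"
  using measurable_from_subalg[OF subalg] by blast

lemma measurable_F_mono: "f \<in> measurable (F s) N \<Longrightarrow> s \<le> s' \<Longrightarrow> f \<in> measurable (F s') N"
  using measurable_from_subalg[OF subalg_mono] by blast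

lemma W_adapted: "0 \<le> s \<Longrightarrow> W s \<in> borel_measurable (F s)"
  using bm by (simp add: brownian_motion_def)

lemma W_measurable [measurable]: "0 \<le> s \<Longrightarrow> W s \<in> borel_measurable M"
  using measurable_F_M[OF W_adapted] by blast

lemma W_continuous: "\<omega> \<in> space M \<Longrightarrow> continuous_on {0..} (\<lambda>s. W s \<omega>)"
  using bm by (simp add: brownian_motion_def)

definition inc :: "real \<Rightarrow> real \<Rightarrow> 'a \<Rightarrow> real" where
  "inc u s \<omega> = W s \<omega> - W u \<omega>"

lemma inc_distributed:
  "0 \<le> u \<Longrightarrow> u < s \<Longrightarrow> distributed M lborel (inc u s) (normal_density 0 (sqrt (s - u)))"
  using bm unfolding inc_def[abs_def] brownian_motion_def by blast

lemma inc_adapted: "0 \<le> u \<Longrightarrow> u \<le> s \<Longrightarrow> inc u s \<in> borel_measurable (F s)"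
  unfolding inc_def[abs_def]
  by (intro borel_measurable_diff W_adapted measurable_F_mono[OF W_adapted]) auto

lemma inc_measurable: "0 \<le> u \<Longrightarrow> u \<le> s \<Longrightarrow> inc u s \<in> borel_measurable M"
  using measurable_F_M[OF inc_adapted] by auto

text \<open>The \<sigma>-algebras generated by the two variables lie inside \<open>F u\<close> and
  inside the one generated by the increment, so independence passes to them.\<close>

lemma inc_indep:
  assumes "0 \<le> u" "u < s" and \<theta>: "\<theta> \<in> measurable (F u) N" and k: "k \<in> measurable borel N'"
  shows "indep_var N \<theta> N' (\<lambda>\<omega>. k (inc u s \<omega>))"
  unfolding indep_var_eq
proof (intro conjI)
  show "random_variable N \<theta>" using measurable_F_M[OF \<theta>] assms by simp
  show "random_variable N' (\<lambda>\<omega>. k (inc u s \<omega>))"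
    using measurable_compose[OF inc_measurable k] assms by simp
  have ind: "indep_set (sets (F u)) (sets (vimage_algebra (space M) (inc u s) borel))"
    using bm assms unfolding inc_def[abs_def] brownian_motion_def by blast
  have 1: "sigma_sets (space M) {\<theta> -` A \<inter> space M |A. A \<in> sets N} \<subseteq> sets (F u)"
  proof -
    have "sigma_sets (space (F u)) {\<theta> -` A \<inter> space M |A. A \<in> sets N} \<subseteq> sets (F u)"
      using measurable_sets[OF \<theta>] by (intro sets.sigma_sets_subset) (auto simp: space_F)
    then show ?thesis by (simp add: space_F)
  qed
  have 2: "sigma_sets (space M) {(\<lambda>\<omega>. k (inc u s \<omega>)) -` A \<inter> space M |A. A \<in> sets N'}
             \<subseteq> sets (vimage_algebra (space M) (inc u s) borel)"
  proof -
    let ?V = "vimage_algebra (space M) (inc u s) borel"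
    have "inc u s \<in> measurable ?V borel"
      by (rule measurable_vimage_algebra1) simp
    from measurable_sets[OF measurable_compose[OF this k]]
    have "sigma_sets (space ?V) {(\<lambda>\<omega>. k (inc u s \<omega>)) -` A \<inter> space M |A. A \<in> sets N'} \<subseteq> sets ?V"
      by (intro sets.sigma_sets_subset) auto
    then show ?thesis by simp
  qed
  show "indep_set (sigma_sets (space M) {\<theta> -` A \<inter> space M |A. A \<in> sets N})
     (sigma_sets (space M) {(\<lambda>\<omega>. k (inc u s \<omega>)) -` A \<inter> space M |A. A \<in> sets N'})"
    using ind 1 2 unfolding indep_sets2_eq by blast
qed

lemma inc_expectation:
  assumes "0 \<le> u" "u < s" "k \<in> borel_measurable borel"
  shows "expectation (\<lambda>\<omega>. k (inc u s \<omega>)) = (\<integral>x. normal_density 0 (sqrt (s - u)) x * k x \<partial>lborel)"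
  using distributed_integral[OF inc_distributed[OF assms(1,2)], of k] assms(3) by simp

lemma inc_integrable:
  assumes "0 \<le> u" "u < s" "k \<in> borel_measurable borel"
  shows "integrable M (\<lambda>\<omega>. k (inc u s \<omega>)) \<longleftrightarrow> integrable lborel (\<lambda>x. normal_density 0 (sqrt (s - u)) x * k x)"
  using distributed_integrable[OF inc_distributed[OF assms(1,2)], of k] assms(3) by simp

lemma inc_moments:
  assumes "0 \<le> u" "u < s"
  shows "integrable M (inc u s)" "expectation (inc u s) = 0"
    "integrable M (\<lambda>\<omega>. (inc u s \<omega>)\<^sup>2)" "expectation (\<lambda>\<omega>. (inc u s \<omega>)\<^sup>2) = s - u"
proof -
  have p: "sqrt (s - u) > 0" using assms by simp
  show "integrable M (inc u s)"
    using inc_integrable[OF assms, of "\<lambda>x. x"] integrable_normal_moment[OF p, of 0 1] by simp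
  show "expectation (inc u s) = 0"
    using inc_expectation[OF assms, of "\<lambda>x. x"] integral_normal_moment_odd[OF p, of 0 0] by simp
  show "integrable M (\<lambda>\<omega>. (inc u s \<omega>)\<^sup>2)"
    using inc_integrable[OF assms, of "\<lambda>x. x\<^sup>2"] integrable_normal_moment[OF p, of 0 2] by simp
  show "expectation (\<lambda>\<omega>. (inc u s \<omega>)\<^sup>2) = s - u"
    using inc_expectation[OF assms, of "\<lambda>x. x\<^sup>2"] integral_normal_moment_even[OF p, of 0 1] assms
    by simp
qed

lemma inc_exp_moments:
  assumes "0 \<le> u" "u < s"
  shows "integrable M (\<lambda>\<omega>. exp (c * inc u s \<omega>))"
    "expectation (\<lambda>\<omega>. exp (c * inc u s \<omega>)) = exp (c\<^sup>2 * (s - u) / 2)"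
    "integrable M (\<lambda>\<omega>. exp (c * inc u s \<omega>) * inc u s \<omega>)"
    "expectation (\<lambda>\<omega>. exp (c * inc u s \<omega>) * inc u s \<omega>) = exp (c\<^sup>2 * (s - u) / 2) * (c * (s - u))"
proof -
  let ?h = "sqrt (s - u)"
  have p: "?h > 0" "?h\<^sup>2 = s - u" using assms by auto
  have 1: "normal_density 0 ?h x * exp (c * x) = exp (c\<^sup>2 * (s - u) / 2) * normal_density (c * (s - u)) ?h x" for x
    using normal_density_exp[OF p(1), of x c] unfolding p(2) .
  have 2: "normal_density 0 ?h x * (exp (c * x) * x) = exp (c\<^sup>2 * (s - u) / 2) * (normal_density (c * (s - u)) ?h x * x)" for x
    using 1[of x] by (metis mult.assoc)
  show "integrable M (\<lambda>\<omega>. exp (c * inc u s \<omega>))"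
    using inc_integrable[OF assms, of "\<lambda>x. exp (c * x)"] integrable_normal_density[OF p(1)]
    by (simp add: 1)
  show "expectation (\<lambda>\<omega>. exp (c * inc u s \<omega>)) = exp (c\<^sup>2 * (s - u) / 2)"
    using inc_expectation[OF assms, of "\<lambda>x. exp (c * x)"] integral_normal_density[OF p(1)]
    by (simp add: 1)
  show "integrable M (\<lambda>\<omega>. exp (c * inc u s \<omega>) * inc u s \<omega>)"
    using inc_integrable[OF assms, of "\<lambda>x. exp (c * x) * x"] integrable_normal_moment_nz_1[OF p(1)]
    by (simp add: 2)
  show "expectation (\<lambda>\<omega>. exp (c * inc u s \<omega>) * inc u s \<omega>) = exp (c\<^sup>2 * (s - u) / 2) * (c * (s - u))"
    using inc_expectation[OF assms, of "\<lambda>x. exp (c * x) * x"] integral_normal_moment_nz_1[OF p(1)]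
    by (simp add: 2)
qed

text \<open>The partial sum and the next coefficient are both known at time \<open>q K\<close>,
  hence independent of the next increment, whose transform has mean zero: the cross term vanishes
  and the squares add up. The functions \<open>k m\<close> are the identity for Ito sums and the
  one-step error of the exact solution in \<open>explicit_euler\<close>.\<close>

lemma martingale_transform_L2:
  fixes \<theta> :: "nat \<Rightarrow> 'a \<Rightarrow> real" and k :: "nat \<Rightarrow> real \<Rightarrow> real"
  assumes q: "\<And>m. m < K \<Longrightarrow> 0 \<le> q m \<and> q m < q (Suc m)"
    and \<theta>: "\<And>m. m < K \<Longrightarrow> \<theta> m \<in> borel_measurable (F (q m))"
    and \<theta>_sq: "\<And>m. m < K \<Longrightarrow> integrable M (\<lambda>\<omega>. (\<theta> m \<omega>)\<^sup>2)"
    and k: "\<And>m. m < K \<Longrightarrow> k m \<in> borel_measurable borel"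
    and k_sq: "\<And>m. m < K \<Longrightarrow> integrable M (\<lambda>\<omega>. (k m (inc (q m) (q (Suc m)) \<omega>))\<^sup>2)"
    and k_mean: "\<And>m. m < K \<Longrightarrow> expectation (\<lambda>\<omega>. k m (inc (q m) (q (Suc m)) \<omega>)) = 0"
  shows "integrable M (\<lambda>\<omega>. (\<Sum>m<K. \<theta> m \<omega> * k m (inc (q m) (q (Suc m)) \<omega>))\<^sup>2) \<and>
    expectation (\<lambda>\<omega>. (\<Sum>m<K. \<theta> m \<omega> * k m (inc (q m) (q (Suc m)) \<omega>))\<^sup>2)
      = (\<Sum>m<K. expectation (\<lambda>\<omega>. (\<theta> m \<omega>)\<^sup>2) * expectation (\<lambda>\<omega>. (k m (inc (q m) (q (Suc m)) \<omega>))\<^sup>2))"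
  using assms
proof (induction K)
  case (Suc K)
  define S where "S \<omega> = (\<Sum>m<K. \<theta> m \<omega> * k m (inc (q m) (q (Suc m)) \<omega>))" for \<omega>
  define z where "z \<omega> = k K (inc (q K) (q (Suc K)) \<omega>)" for \<omega>
  have mono: "q m \<le> q K" if "m \<le> K" for m
    using strict_chain_less[of "Suc K" q m K] Suc.prems(1) that by (cases "m = K") auto
  have qK: "0 \<le> q K" "q K < q (Suc K)" using Suc.prems(1)[of K] by auto
  have IH1: "integrable M (\<lambda>\<omega>. (S \<omega>)\<^sup>2)" and
    IH2: "expectation (\<lambda>\<omega>. (S \<omega>)\<^sup>2) = (\<Sum>m<K. expectation (\<lambda>\<omega>. (\<theta> m \<omega>)\<^sup>2) *
        expectation (\<lambda>\<omega>. (k m (inc (q m) (q (Suc m)) \<omega>))\<^sup>2))"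
    using Suc.IH Suc.prems unfolding S_def by auto
  have SF: "S \<in> borel_measurable (F (q K))"
  proof -
    have "\<theta> m \<in> borel_measurable (F (q K))"
      and "(\<lambda>\<omega>. k m (inc (q m) (q (Suc m)) \<omega>)) \<in> borel_measurable (F (q K))" if m: "m < K" for m
    proof -
      show "\<theta> m \<in> borel_measurable (F (q K))"
        by (rule measurable_F_mono[OF Suc.prems(2) mono]) (use m in auto)
      have "0 \<le> q m" "q m \<le> q (Suc m)" using Suc.prems(1)[of m] m by auto
      then have "inc (q m) (q (Suc m)) \<in> borel_measurable (F (q K))"
        by (rule measurable_F_mono[OF inc_adapted mono]) (use m in auto)
      then show "(\<lambda>\<omega>. k m (inc (q m) (q (Suc m)) \<omega>)) \<in> borel_measurable (F (q K))"
        using m by (intro measurable_compose[OF _ Suc.prems(4)[of m]]) simp_all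
    qed
    then show ?thesis
      unfolding S_def[abs_def] by (intro borel_measurable_sum borel_measurable_times) simp_all
  qed
  note \<theta>F = Suc.prems(2)[of K, simplified]
  have [measurable]: "S \<in> borel_measurable M" "\<theta> K \<in> borel_measurable M" "z \<in> borel_measurable M"
    using measurable_F_M[OF SF] measurable_F_M[OF \<theta>F] qK
      measurable_compose[OF inc_measurable[of "q K" "q (Suc K)"] Suc.prems(4)[of K]]
    by (auto simp: z_def[abs_def])
  have z_sq: "integrable M (\<lambda>\<omega>. (z \<omega>)\<^sup>2)" and z_mean: "expectation z = 0"
    using Suc.prems(5)[of K] Suc.prems(6)[of K] by (auto simp: z_def[abs_def])
  have z_int: "integrable M z"
    using integrable_mult_sq[of z M "\<lambda>_. 1"] z_sq by simp
  have \<theta>_sq: "integrable M (\<lambda>\<omega>. (\<theta> K \<omega>)\<^sup>2)" using Suc.prems(3) by simp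
  have S\<theta>_int: "integrable M (\<lambda>\<omega>. S \<omega> * \<theta> K \<omega>)"
    using IH1 \<theta>_sq by (intro integrable_mult_sq) auto
  have i1: "indep_var borel (\<lambda>\<omega>. S \<omega> * \<theta> K \<omega>) borel z"
    unfolding z_def using qK SF \<theta>F Suc.prems(4)[of K] by (intro inc_indep) auto
  have i2: "indep_var borel (\<lambda>\<omega>. (\<theta> K \<omega>)\<^sup>2) borel (\<lambda>\<omega>. (z \<omega>)\<^sup>2)"
    unfolding z_def using qK \<theta>F Suc.prems(4)[of K]
    by (intro inc_indep[where k = "\<lambda>x. (k K x)\<^sup>2"]) auto
  have c1: "integrable M (\<lambda>\<omega>. S \<omega> * \<theta> K \<omega> * z \<omega>)" "expectation (\<lambda>\<omega>. S \<omega> * \<theta> K \<omega> * z \<omega>) = 0"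
    using indep_var_integrable[OF i1 S\<theta>_int z_int] indep_var_lebesgue_integral[OF i1 S\<theta>_int z_int] z_mean
    by auto
  have c2: "integrable M (\<lambda>\<omega>. (\<theta> K \<omega>)\<^sup>2 * (z \<omega>)\<^sup>2)"
    "expectation (\<lambda>\<omega>. (\<theta> K \<omega>)\<^sup>2 * (z \<omega>)\<^sup>2) = expectation (\<lambda>\<omega>. (\<theta> K \<omega>)\<^sup>2) * expectation (\<lambda>\<omega>. (z \<omega>)\<^sup>2)"
    using indep_var_integrable[OF i2 \<theta>_sq z_sq] indep_var_lebesgue_integral[OF i2 \<theta>_sq z_sq] by auto
  have sq: "(\<Sum>m<Suc K. \<theta> m \<omega> * k m (inc (q m) (q (Suc m)) \<omega>))\<^sup>2
      = (S \<omega>)\<^sup>2 + 2 * (S \<omega> * \<theta> K \<omega> * z \<omega>) + (\<theta> K \<omega>)\<^sup>2 * (z \<omega>)\<^sup>2" for \<omega>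
    by (simp add: S_def z_def power2_sum power_mult_distrib)
  show ?case
    unfolding sq using IH1 c1 c2 by (simp add: IH2 z_def)
qed simp

text \<open>Lenglart's domination inequality for sums: the sum is stopped when its quadratic
  variation exceeds \<open>\<delta>\<close>.\<close>

lemma martingale_sum_prob:
  fixes \<theta> :: "nat \<Rightarrow> 'a \<Rightarrow> real"
  assumes q: "\<And>m. m < K \<Longrightarrow> 0 \<le> q m \<and> q m < q (Suc m)"
    and \<theta>: "\<And>m. m < K \<Longrightarrow> \<theta> m \<in> borel_measurable (F (q m))"
    and "\<epsilon> > 0" "\<delta> > 0"
  shows "prob {\<omega> \<in> space M. \<epsilon> < \<bar>\<Sum>m<K. \<theta> m \<omega> * inc (q m) (q (Suc m)) \<omega>\<bar>}
    \<le> \<delta> / \<epsilon>\<^sup>2 + prob {\<omega> \<in> space M. \<delta> < (\<Sum>m<K. (\<theta> m \<omega>)\<^sup>2 * (q (Suc m) - q m))}"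
proof -
  define QV where "QV k \<omega> = (\<Sum>m<k. (\<theta> m \<omega>)\<^sup>2 * (q (Suc m) - q m))" for k \<omega>
  \<comment> \<open>The test involves \<open>QV (Suc m)\<close>, which includes
    \<open>\<theta> m\<close> but is known already at time \<open>q m\<close>. The truncation is
    thus predictable, and the retained quadratic variation never exceeds \<delta>.\<close>
  define \<eta> where "\<eta> m \<omega> = (if QV (Suc m) \<omega> \<le> \<delta> then \<theta> m \<omega> else 0)" for m \<omega>
  define S where "S \<omega> = (\<Sum>m<K. \<eta> m \<omega> * inc (q m) (q (Suc m)) \<omega>)" for \<omega>
  have q0: "0 \<le> q m" "q m < q (Suc m)" if "m < K" for m using q[OF that] by auto
  have mono: "q i \<le> q j" if "i \<le> j" "j \<le> K" for i j
    using strict_chain_less[of K q i j] q0 that by (cases "i = j") auto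
  have \<theta>M[measurable]: "\<theta> m \<in> borel_measurable M" if "m < K" for m
    using measurable_F_M[OF \<theta>] q0 that by blast
  have QV_F: "QV (Suc m) \<in> borel_measurable (F (q m))" if "m < K" for m
    unfolding QV_def[abs_def]
  proof (intro borel_measurable_sum borel_measurable_times borel_measurable_power)
    fix i assume "i \<in> {..<Suc m}"
    then show "\<theta> i \<in> borel_measurable (F (q m))"
      using that mono[of i m] by (intro measurable_F_mono[OF \<theta>]) auto
  qed auto
  have \<eta>_F: "\<eta> m \<in> borel_measurable (F (q m))" if "m < K" for m
    unfolding \<eta>_def[abs_def] using QV_F[OF that] \<theta>[OF that] by measurable
  have \<eta>M[measurable]: "\<eta> m \<in> borel_measurable M" if "m < K" for m
    using measurable_F_M[OF \<eta>_F] q0 that by blast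
  have QV_M[measurable]: "QV K \<in> borel_measurable M"
    unfolding QV_def[abs_def] by measurable
  have QV_mono: "QV i \<omega> \<le> QV j \<omega>" if "i \<le> j" "j \<le> K" for i j \<omega>
    unfolding QV_def using that q0 by (intro sum_mono2) (auto intro!: mult_nonneg_nonneg intro: less_imp_le)
  have \<eta>_bound: "(\<Sum>m<k. (\<eta> m \<omega>)\<^sup>2 * (q (Suc m) - q m)) \<le> \<delta>" if "k \<le> K" for k \<omega>
    using that
  proof (induction k)
    case (Suc k)
    show ?case
    proof (cases "QV (Suc k) \<omega> \<le> \<delta>")
      case True
      have "(\<Sum>m<Suc k. (\<eta> m \<omega>)\<^sup>2 * (q (Suc m) - q m)) \<le> QV (Suc k) \<omega>"
        unfolding QV_def
      proof (intro sum_mono mult_right_mono)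
        fix i assume "i \<in> {..<Suc k}"
        then show "0 \<le> q (Suc i) - q i" using q0(2)[of i] Suc.prems by simp
      qed (simp add: \<eta>_def)
      with True show ?thesis by simp
    next
      case False
      then have "\<eta> k \<omega> = 0" by (simp add: \<eta>_def)
      then show ?thesis using Suc by simp
    qed
  qed (use assms in simp)
  have \<eta>_sq: "integrable M (\<lambda>\<omega>. (\<eta> m \<omega>)\<^sup>2)" if m: "m < K" for m
  proof (rule integrable_const_bound[where B = "\<delta> / (q (Suc m) - q m)"])
    have "(\<eta> m \<omega>)\<^sup>2 * (q (Suc m) - q m) \<le> \<delta>" for \<omega>
    proof -
      have "(\<eta> m \<omega>)\<^sup>2 * (q (Suc m) - q m) \<le> (\<Sum>i<K. (\<eta> i \<omega>)\<^sup>2 * (q (Suc i) - q i))"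
        using m q0 by (intro member_le_sum[where f = "\<lambda>i. (\<eta> i \<omega>)\<^sup>2 * (q (Suc i) - q i)"])
          (auto intro!: mult_nonneg_nonneg intro: less_imp_le)
      with \<eta>_bound[of K \<omega>] show ?thesis by simp
    qed
    then show "AE \<omega> in M. norm ((\<eta> m \<omega>)\<^sup>2) \<le> \<delta> / (q (Suc m) - q m)"
      using q0[OF m] by (simp add: pos_le_divide_eq)
  qed (use m in measurable)
  have L2: "integrable M (\<lambda>\<omega>. (S \<omega>)\<^sup>2)"
    "expectation (\<lambda>\<omega>. (S \<omega>)\<^sup>2) = (\<Sum>m<K. expectation (\<lambda>\<omega>. (\<eta> m \<omega>)\<^sup>2) * (q (Suc m) - q m))"
  proof -
    have "integrable M (\<lambda>\<omega>. (S \<omega>)\<^sup>2) \<and>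
      expectation (\<lambda>\<omega>. (S \<omega>)\<^sup>2) = (\<Sum>m<K. expectation (\<lambda>\<omega>. (\<eta> m \<omega>)\<^sup>2) *
         expectation (\<lambda>\<omega>. (inc (q m) (q (Suc m)) \<omega>)\<^sup>2))"
      unfolding S_def
      by (rule martingale_transform_L2[where k = "\<lambda>_ x. x"])
         (use q \<eta>_F \<eta>_sq inc_moments in auto)
    then show "integrable M (\<lambda>\<omega>. (S \<omega>)\<^sup>2)"
      "expectation (\<lambda>\<omega>. (S \<omega>)\<^sup>2) = (\<Sum>m<K. expectation (\<lambda>\<omega>. (\<eta> m \<omega>)\<^sup>2) * (q (Suc m) - q m))"
      using q0 inc_moments(4) by (auto intro!: sum.cong)
  qed
  note L2(2)
  also have "(\<Sum>m<K. expectation (\<lambda>\<omega>. (\<eta> m \<omega>)\<^sup>2) * (q (Suc m) - q m))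
      = expectation (\<lambda>\<omega>. \<Sum>m<K. (\<eta> m \<omega>)\<^sup>2 * (q (Suc m) - q m))"
    using \<eta>_sq by simp
  also have "\<dots> \<le> expectation (\<lambda>\<omega>. \<delta>)"
    using \<eta>_sq \<eta>_bound by (intro integral_mono) auto
  finally have ES: "expectation (\<lambda>\<omega>. (S \<omega>)\<^sup>2) \<le> \<delta>" by (simp add: prob_space)
  have inc_M: "inc (q m) (q (Suc m)) \<in> borel_measurable M" if "m < K" for m
    using inc_measurable q0[OF that] by simp
  have S_M[measurable]: "S \<in> borel_measurable M"
    unfolding S_def[abs_def] using inc_M \<eta>M by (intro borel_measurable_sum borel_measurable_times) auto
  have T_M[measurable]: "(\<lambda>\<omega>. \<Sum>m<K. \<theta> m \<omega> * inc (q m) (q (Suc m)) \<omega>) \<in> borel_measurable M"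
    using inc_M \<theta>M by (intro borel_measurable_sum borel_measurable_times) auto
  have "prob {\<omega> \<in> space M. \<epsilon> < \<bar>\<Sum>m<K. \<theta> m \<omega> * inc (q m) (q (Suc m)) \<omega>\<bar>}
     \<le> prob ({\<omega> \<in> space M. \<epsilon> < \<bar>S \<omega>\<bar>} \<union> {\<omega> \<in> space M. \<delta> < QV K \<omega>})"
  proof (intro finite_measure_mono subsetI)
    fix \<omega> assume \<omega>: "\<omega> \<in> {\<omega> \<in> space M. \<epsilon> < \<bar>\<Sum>m<K. \<theta> m \<omega> * inc (q m) (q (Suc m)) \<omega>\<bar>}"
    show "\<omega> \<in> {\<omega> \<in> space M. \<epsilon> < \<bar>S \<omega>\<bar>} \<union> {\<omega> \<in> space M. \<delta> < QV K \<omega>}"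
    proof (cases "QV K \<omega> \<le> \<delta>")
      case True
      then have "\<eta> m \<omega> = \<theta> m \<omega>" if "m < K" for m
        using QV_mono[of "Suc m" K \<omega>] that by (simp add: \<eta>_def)
      then have "S \<omega> = (\<Sum>m<K. \<theta> m \<omega> * inc (q m) (q (Suc m)) \<omega>)"
        by (simp add: S_def)
      with \<omega> show ?thesis by simp
    qed (use \<omega> in auto)
  qed measurable
  also have "\<dots> \<le> prob {\<omega> \<in> space M. \<epsilon> < \<bar>S \<omega>\<bar>} + prob {\<omega> \<in> space M. \<delta> < QV K \<omega>}"
    by (intro measure_Un_le) auto
  also have "prob {\<omega> \<in> space M. \<epsilon> < \<bar>S \<omega>\<bar>} \<le> expectation (\<lambda>\<omega>. (S \<omega>)\<^sup>2) / \<epsilon>\<^sup>2"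
    using L2(1) assms by (intro Chebyshev_sq) auto
  also have "\<dots> \<le> \<delta> / \<epsilon>\<^sup>2" using ES by (intro divide_right_mono) auto
  finally show ?thesis by (simp add: QV_def)
qed

end

section \<open>Ito integrals as limits of Riemann sums\<close>

lemma chain_le_iff:
  fixes q :: "nat \<Rightarrow> real"
  assumes q: "\<And>m. m < K \<Longrightarrow> q m < q (Suc m)" and "m < K" "u \<in> {q m<..q (Suc m)}" "c \<le> K"
  shows "q c < u \<longleftrightarrow> c \<le> m" "u \<le> q c \<longleftrightarrow> Suc m \<le> c"
proof -
  have mono: "q i \<le> q j" if "i \<le> j" "j \<le> K" for i j
    using strict_chain_less[of K q i j] q that by (cases "i = j") auto
  have "q c < u" "\<not> u \<le> q c" if "c \<le> m"
    using mono[of c m] that assms by auto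
  moreover have "\<not> q c < u" "u \<le> q c" if "\<not> c \<le> m"
    using mono[of "Suc m" c] that assms by auto
  ultimately show "q c < u \<longleftrightarrow> c \<le> m" "u \<le> q c \<longleftrightarrow> Suc m \<le> c"
    by (cases "c \<le> m"; simp)+
qed

text \<open>All jumps occur at points of the chain and the steps are open on the left, so the right
  end point represents the whole fine interval.\<close>

lemma simple_value_chain:
  fixes q :: "nat \<Rightarrow> real"
  assumes q: "\<And>m. m < K \<Longrightarrow> q m < q (Suc m)" and m: "m < K" "u \<in> {q m<..q (Suc m)}"
    and p: "p ` {..k} \<subseteq> q ` {..K}"
  shows "simple_value k p \<xi> u \<omega> = simple_value k p \<xi> (q (Suc m)) \<omega>"
  unfolding simple_value_def
proof (intro sum.cong refl arg_cong2[where f = "(*)"])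
  fix i assume "i \<in> {..<k}"
  then obtain c d where "c \<le> K" "p i = q c" "d \<le> K" "p (Suc i) = q d"
  proof -
    have "p i \<in> q ` {..K}" "p (Suc i) \<in> q ` {..K}" using p \<open>i \<in> {..<k}\<close> by auto
    then show ?thesis using that by auto
  qed
  moreover have qq: "q (Suc m) \<in> {q m<..q (Suc m)}" using q m by auto
  ultimately show "indicator {p i<..p (Suc i)} u = (indicator {p i<..p (Suc i)} (q (Suc m)) :: real)"
    using chain_le_iff[where q = q and K = K, OF q m] chain_le_iff[where q = q and K = K, OF q m(1) qq]
    by (simp add: indicator_def)
qed

text \<open>A simple process whose steps may be unbounded. The step processes sampled from
  \<open>H\<close> on a grid are adapted but in general not bounded, and they have to be compared
  with the bounded ones from the definition of the integral.\<close>

definition (in brownian) adapted_steps ::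
  "real \<Rightarrow> real \<Rightarrow> nat \<Rightarrow> (nat \<Rightarrow> real) \<Rightarrow> (nat \<Rightarrow> 'a \<Rightarrow> real) \<Rightarrow> bool" where
  "adapted_steps a b k p \<xi> \<longleftrightarrow> p 0 = a \<and> p k = b \<and>
     (\<forall>i<k. p i \<le> p (Suc i) \<and> \<xi> i \<in> borel_measurable (F (p i)))"

context brownian
begin

lemma adapted_steps_bounds:
  assumes "adapted_steps a b k p \<xi>" "i \<le> k"
  shows "a \<le> p i" "p i \<le> b"
proof -
  have "\<forall>i<k. p i \<le> p (Suc i)" using assms by (simp add: adapted_steps_def)
  then have mono: "p i \<le> p j" if "i \<le> j" "j \<le> k" for i j
    using that by (induction j) (auto simp: le_Suc_eq intro: order_trans)
  show "a \<le> p i" "p i \<le> b"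
    using mono[of 0 i] mono[of i k] assms by (auto simp: adapted_steps_def)
qed

text \<open>A step covering the right end point \<open>q (Suc m)\<close> must begin at or before
  \<open>q m\<close>, because it begins at a point of the chain and is open on the left.\<close>

lemma simple_value_adapted:
  assumes q: "\<And>m. m < K \<Longrightarrow> q m < q (Suc m)" and m: "m < K"
    and S: "adapted_steps a b k p \<xi>" and p: "p ` {..k} \<subseteq> q ` {..K}"
  shows "simple_value k p \<xi> (q (Suc m)) \<in> borel_measurable (F (q m))"
proof -
  have "(\<lambda>\<omega>. \<xi> i \<omega> * indicator {p i<..p (Suc i)} (q (Suc m))) \<in> borel_measurable (F (q m))"
    if i: "i < k" for i
  proof (cases "q (Suc m) \<in> {p i<..p (Suc i)}")
    case True
    have "p i \<in> q ` {..K}" using p i by auto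
    then obtain c where c: "c \<le> K" "p i = q c" by auto
    have qq: "q (Suc m) \<in> {q m<..q (Suc m)}" using q m by auto
    have "c \<le> m" using True c chain_le_iff(1)[where q = q and K = K, OF q m qq c(1)] by simp
    then have "p i \<le> q m"
      using c strict_chain_less[of K q c m] q m by (cases "c = m") auto
    moreover have "\<xi> i \<in> borel_measurable (F (p i))"
      using S i by (simp add: adapted_steps_def)
    ultimately have "\<xi> i \<in> borel_measurable (F (q m))"
      using measurable_F_mono by blast
    then show ?thesis by (intro borel_measurable_times) auto
  qed simp
  then show ?thesis unfolding simple_value_def[abs_def] by (intro borel_measurable_sum) simp
qed

lemma simple_integral_refine:
  assumes q: "\<And>m. m < K \<Longrightarrow> q m < q (Suc m)"
    and S: "adapted_steps a b k p \<xi>" and p: "p ` {..k} \<subseteq> q ` {..K}"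
  shows "simple_integral W k p \<xi> \<omega>
    = (\<Sum>m<K. simple_value k p \<xi> (q (Suc m)) \<omega> * inc (q m) (q (Suc m)) \<omega>)"
proof -
  have "W (p (Suc i)) \<omega> - W (p i) \<omega>
     = (\<Sum>m<K. indicator {p i<..p (Suc i)} (q (Suc m)) * inc (q m) (q (Suc m)) \<omega>)" if i: "i < k" for i
  proof -
    obtain c d where cd: "c \<le> K" "p i = q c" "d \<le> K" "p (Suc i) = q d"
    proof -
      have "p i \<in> q ` {..K}" "p (Suc i) \<in> q ` {..K}" using p i by auto
      then show ?thesis using that by auto
    qed
    have "p i \<le> p (Suc i)" using S i by (simp add: adapted_steps_def)
    then have "c \<le> d" using strict_chain_less[of K q d c] q cd by (cases "c \<le> d") auto
    from chain_telescope[where q = q and K = K, OF q this cd(3), of "\<lambda>m. W (q m) \<omega>"] show ?thesis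
      by (simp add: cd inc_def)
  qed
  then have "simple_integral W k p \<xi> \<omega> = (\<Sum>i<k. \<xi> i \<omega> *
     (\<Sum>m<K. indicator {p i<..p (Suc i)} (q (Suc m)) * inc (q m) (q (Suc m)) \<omega>))"
    unfolding simple_integral_def by (intro sum.cong) auto
  also have "\<dots> = (\<Sum>m<K. simple_value k p \<xi> (q (Suc m)) \<omega> * inc (q m) (q (Suc m)) \<omega>)"
    unfolding simple_value_def sum_distrib_left sum_distrib_right
    by (subst sum.swap) (simp add: mult.assoc)
  finally show ?thesis .
qed

text \<open>It identifies the squared distance of two step processes with the quadratic variation
  that bounds the sum in \<open>martingale_sum_prob\<close>.\<close>

lemma simple_sq_integral:
  assumes q: "\<And>m. m < K \<Longrightarrow> q m < q (Suc m)"
    and p: "p ` {..k} \<subseteq> q ` {..K}" and p': "p' ` {..k'} \<subseteq> q ` {..K}"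
  shows "(\<integral>\<^sup>+u\<in>{q 0..q K}. ennreal ((simple_value k p \<xi> u \<omega> - simple_value k' p' \<xi>' u \<omega>)\<^sup>2) \<partial>lborel)
    = ennreal (\<Sum>m<K. (simple_value k p \<xi> (q (Suc m)) \<omega> - simple_value k' p' \<xi>' (q (Suc m)) \<omega>)\<^sup>2
        * (q (Suc m) - q m))"
proof -
  define f where "f u = (simple_value k p \<xi> u \<omega> - simple_value k' p' \<xi>' u \<omega>)\<^sup>2" for u
  have f0: "f u \<ge> 0" for u by (simp add: f_def)
  have const: "f u = f (q (Suc m))" if "m < K" "u \<in> {q m<..q (Suc m)}" for m u
    using simple_value_chain[of K q m u p k \<xi> \<omega>] simple_value_chain[of K q m u p' k' \<xi>' \<omega>] q that p p'
    by (simp add: f_def)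
  have "f u * indicator {q 0<..q K} u = (\<Sum>m<K. f (q (Suc m)) * indicator {q m<..q (Suc m)} u)" for u
  proof -
    have "f u * indicator {q 0<..q K} u = (\<Sum>m<K. f u * indicator {q m<..q (Suc m)} u)"
      using chain_indicator[of K q u] q by (simp add: sum_distrib_left[symmetric] less_imp_le)
    also have "\<dots> = (\<Sum>m<K. f (q (Suc m)) * indicator {q m<..q (Suc m)} u)"
    proof (intro sum.cong refl)
      fix m assume "m \<in> {..<K}"
      then show "f u * indicator {q m<..q (Suc m)} u = f (q (Suc m)) * indicator {q m<..q (Suc m)} u"
        using const[of m u] by (cases "u \<in> {q m<..q (Suc m)}") auto
    qed
    finally show ?thesis .
  qed
  note eq = this
  have "(\<integral>\<^sup>+u\<in>{q 0..q K}. ennreal (f u) \<partial>lborel) = (\<integral>\<^sup>+u. ennreal (f u * indicator {q 0<..q K} u) \<partial>lborel)"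
    using AE_lborel_singleton[of "q 0"]
    by (intro nn_integral_cong_AE) (auto simp: indicator_def elim!: eventually_mono)
  also have "\<dots> = (\<integral>\<^sup>+u. (\<Sum>m<K. ennreal (f (q (Suc m))) * indicator {q m<..q (Suc m)} u) \<partial>lborel)"
    unfolding eq using f0
    by (intro nn_integral_cong) (auto simp: sum_ennreal[symmetric] ennreal_mult' ennreal_indicator simp del: sum_ennreal)
  also have "\<dots> = (\<Sum>m<K. ennreal (f (q (Suc m))) * ennreal (q (Suc m) - q m))"
    using q by (subst nn_integral_sum) (auto simp: nn_integral_cmult_indicator less_imp_le intro!: sum.cong)
  also have "\<dots> = ennreal (\<Sum>m<K. f (q (Suc m)) * (q (Suc m) - q m))"
    using q f0 by (subst sum_ennreal[symmetric]) (auto simp: ennreal_mult' less_imp_le)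
  finally show ?thesis by (simp add: f_def)
qed

text \<open>On a common refinement of the two partitions, the difference of the integrals is a
  single sum of adapted coefficients times increments, to which Lenglart's inequality
  applies.\<close>

lemma simple_integrals_close:
  assumes ab: "0 \<le> a"
    and S: "adapted_steps a b k p \<xi>" and S': "adapted_steps a b k' p' \<xi>'"
    and "\<epsilon> > 0" "\<delta> > 0"
  shows "prob {\<omega> \<in> space M. \<epsilon> < \<bar>simple_integral W k p \<xi> \<omega> - simple_integral W k' p' \<xi>' \<omega>\<bar>}
    \<le> \<delta> / \<epsilon>\<^sup>2 + prob {\<omega> \<in> space M. ennreal \<delta> < (\<integral>\<^sup>+u\<in>{a..b}.
          ennreal ((simple_value k p \<xi> u \<omega> - simple_value k' p' \<xi>' u \<omega>)\<^sup>2) \<partial>lborel)}"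
proof -
  let ?Q = "p ` {..k} \<union> p' ` {..k'}"
  obtain K q where q: "\<And>m. m < K \<Longrightarrow> q m < q (Suc m)" and Q: "q ` {..K} = ?Q"
    using ex_strict_enumeration[of ?Q] by blast
  have mono: "q i \<le> q j" if "i \<le> j" "j \<le> K" for i j
    using strict_chain_less[of K q i j] q that by (cases "i = j") auto
  have bnd: "a \<le> q i" "q i \<le> b" if "i \<le> K" for i
  proof -
    have "q i \<in> ?Q" using Q that by blast
    then show "a \<le> q i" "q i \<le> b"
      using adapted_steps_bounds[OF S] adapted_steps_bounds[OF S'] by auto
  qed
  have "a \<in> q ` {..K}" "b \<in> q ` {..K}"
    unfolding Q using S by (auto simp: adapted_steps_def image_iff)
  then obtain i j where "i \<le> K" "q i = a" "j \<le> K" "q j = b" by auto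
  then have q0: "q 0 = a" and qK: "q K = b"
    using bnd[of 0] bnd[of K] mono[of 0 i] mono[of j K] by auto
  have p: "p ` {..k} \<subseteq> q ` {..K}" "p' ` {..k'} \<subseteq> q ` {..K}" using Q by auto
  define \<theta> where "\<theta> m \<omega> = simple_value k p \<xi> (q (Suc m)) \<omega> - simple_value k' p' \<xi>' (q (Suc m)) \<omega>" for m \<omega>
  have \<theta>: "\<theta> m \<in> borel_measurable (F (q m))" if "m < K" for m
    unfolding \<theta>_def[abs_def]
    by (intro borel_measurable_diff simple_value_adapted[where q = q and K = K, OF q that S p(1)]
        simple_value_adapted[where q = q and K = K, OF q that S' p(2)])
  have "prob {\<omega> \<in> space M. \<epsilon> < \<bar>\<Sum>m<K. \<theta> m \<omega> * inc (q m) (q (Suc m)) \<omega>\<bar>}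
    \<le> \<delta> / \<epsilon>\<^sup>2 + prob {\<omega> \<in> space M. \<delta> < (\<Sum>m<K. (\<theta> m \<omega>)\<^sup>2 * (q (Suc m) - q m))}"
  proof (rule martingale_sum_prob[OF _ \<theta> assms(4,5)])
    show "0 \<le> q m \<and> q m < q (Suc m)" if "m < K" for m
      using q[OF that] bnd[of m] ab that by simp
  qed
  moreover have "(\<Sum>m<K. \<theta> m \<omega> * inc (q m) (q (Suc m)) \<omega>)
      = simple_integral W k p \<xi> \<omega> - simple_integral W k' p' \<xi>' \<omega>" for \<omega>
    using simple_integral_refine[where q = q and K = K, OF q S p(1)] simple_integral_refine[where q = q and K = K, OF q S' p(2)]
    by (simp add: \<theta>_def left_diff_distrib sum_subtractf)
  moreover have "\<delta> < (\<Sum>m<K. (\<theta> m \<omega>)\<^sup>2 * (q (Suc m) - q m)) \<longleftrightarrow>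
     ennreal \<delta> < (\<integral>\<^sup>+u\<in>{a..b}. ennreal ((simple_value k p \<xi> u \<omega> - simple_value k' p' \<xi>' u \<omega>)\<^sup>2) \<partial>lborel)"
    for \<omega>
  proof -
    have "(\<integral>\<^sup>+u\<in>{a..b}. ennreal ((simple_value k p \<xi> u \<omega> - simple_value k' p' \<xi>' u \<omega>)\<^sup>2) \<partial>lborel)
        = ennreal (\<Sum>m<K. (\<theta> m \<omega>)\<^sup>2 * (q (Suc m) - q m))"
      using simple_sq_integral[where q = q and K = K, OF q p, of \<xi> \<omega> \<xi>'] by (simp add: q0 qK \<theta>_def)
    then show ?thesis using assms(5) by (simp add: ennreal_less_iff)
  qed
  ultimately show ?thesis by simp
qed

lemma simple_value_pair_measurable:
  assumes "adapted_steps a b k p \<xi>" "0 \<le> a"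
  shows "(\<lambda>(\<omega>, u). simple_value k p \<xi> u \<omega>) \<in> borel_measurable (M \<Otimes>\<^sub>M lborel)"
proof -
  have [measurable]: "\<xi> i \<in> borel_measurable M" if "i < k" for i
    using assms(1) adapted_steps_bounds[OF assms(1), of i] that assms(2)
    by (intro measurable_F_M[of _ "p i"]) (auto simp: adapted_steps_def)
  show ?thesis unfolding simple_value_def split_beta by measurable
qed

text \<open>Progressive measurability controls \<open>H\<close> only on \<open>[a, b]\<close>.
  Clamping the time variable gives a function measurable on the whole product that agrees with
  \<open>H\<close> there.\<close>

lemma progressive_pair_measurable:
  assumes H: "progressively_measurable F a b H" and ab: "0 \<le> a" "a \<le> b"
  shows "(\<lambda>(\<omega>, u). H (max a (min b u)) \<omega>) \<in> borel_measurable (M \<Otimes>\<^sub>M lborel)"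
proof -
  have H': "(\<lambda>(u, \<omega>). H u \<omega>) \<in> borel_measurable (restrict_space borel {a..b} \<Otimes>\<^sub>M F b)"
    using H ab by (auto simp: progressively_measurable_def)
  have id: "(\<lambda>\<omega>. \<omega>) \<in> measurable M (F b)"
    using ab by (intro measurable_F_M[of _ b]) auto
  have "(\<lambda>(\<omega>, u). (max a (min b u), \<omega>)) \<in> M \<Otimes>\<^sub>M lborel \<rightarrow>\<^sub>M restrict_space borel {a..b} \<Otimes>\<^sub>M F b"
    unfolding split_beta
  proof (intro measurable_Pair measurable_restrict_space2)
    show "(\<lambda>x. fst x) \<in> M \<Otimes>\<^sub>M lborel \<rightarrow>\<^sub>M F b"
      by (rule measurable_compose[OF measurable_fst id])
  qed (use ab in auto)
  from measurable_compose[OF this H'] show ?thesis by (simp add: split_beta')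
qed

lemma sq_dist_measurable:
  assumes "adapted_steps a b k p \<xi>" "0 \<le> a" "a \<le> b" and H: "progressively_measurable F a b H"
  shows "(\<lambda>\<omega>. \<integral>\<^sup>+u\<in>{a..b}. ennreal ((simple_value k p \<xi> u \<omega> - H u \<omega>)\<^sup>2) \<partial>lborel) \<in> borel_measurable M"
proof -
  note [measurable] = simple_value_pair_measurable[OF assms(1,2)] progressive_pair_measurable[OF H assms(2,3)]
  have "(\<lambda>\<omega>. \<integral>\<^sup>+u. ennreal ((simple_value k p \<xi> u \<omega> - H (max a (min b u)) \<omega>)\<^sup>2) * indicator {a..b} u \<partial>lborel)
     \<in> borel_measurable M"
    by measurable
  also have "(\<lambda>\<omega>. \<integral>\<^sup>+u. ennreal ((simple_value k p \<xi> u \<omega> - H (max a (min b u)) \<omega>)\<^sup>2) * indicator {a..b} u \<partial>lborel)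
    = (\<lambda>\<omega>. \<integral>\<^sup>+u\<in>{a..b}. ennreal ((simple_value k p \<xi> u \<omega> - H u \<omega>)\<^sup>2) \<partial>lborel)"
    by (intro ext nn_integral_cong) (auto simp: indicator_def)
  finally show ?thesis .
qed

end

section \<open>Uniform grids and Riemann sums\<close>

definition gp :: "real \<Rightarrow> real \<Rightarrow> nat \<Rightarrow> nat \<Rightarrow> real" where
  "gp a b n j = a + (b - a) * real j / real n"

lemma gp_0 [simp]: "gp a b n 0 = a" by (simp add: gp_def)
lemma gp_end [simp]: "n > 0 \<Longrightarrow> gp a b n n = b" by (simp add: gp_def)
lemma gp_diff: "gp a b n (Suc j) - gp a b n j = (b - a) / real n"
  by (simp add: gp_def diff_divide_distrib[symmetric] distrib_left)
lemma gp_less: "a < b \<Longrightarrow> n > 0 \<Longrightarrow> gp a b n j < gp a b n (Suc j)"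
  using gp_diff[of a b n j] divide_pos_pos[of "b - a" "real n"]
  by (metis diff_gt_0_iff_gt of_nat_0_less_iff)
lemma gp_ge: "a \<le> b \<Longrightarrow> a \<le> gp a b n j"
  by (simp add: gp_def)
lemma gp_le: "a \<le> b \<Longrightarrow> j \<le> n \<Longrightarrow> gp a b n j \<le> b"
proof -
  assume "a \<le> b" "j \<le> n"
  then have "(b - a) * (real j / real n) \<le> (b - a) * 1"
    by (intro mult_left_mono) (auto simp: divide_le_eq_1)
  then show ?thesis by (simp add: gp_def)
qed

lemma grid_uniform:
  fixes f :: "real \<Rightarrow> real"
  assumes "a < b" "continuous_on {a..b} f" "e > 0"
  shows "\<forall>\<^sub>F n in sequentially. \<forall>j<Suc n. \<forall>u\<in>{gp a b (Suc n) j..gp a b (Suc n) (Suc j)}.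
           \<bar>f u - f (gp a b (Suc n) j)\<bar> < e"
proof -
  have "uniformly_continuous_on {a..b} f"
    using assms by (intro compact_uniformly_continuous) auto
  then obtain d where d: "d > 0" "\<And>x y. x \<in> {a..b} \<Longrightarrow> y \<in> {a..b} \<Longrightarrow> dist y x < d \<Longrightarrow> dist (f y) (f x) < e"
    using assms(3) unfolding uniformly_continuous_on_def by blast
  have "(\<lambda>n. (b - a) / real (Suc n)) \<longlonglongrightarrow> 0" by real_asymp
  then have "\<forall>\<^sub>F n in sequentially. (b - a) / real (Suc n) < d"
    using d(1) by (rule order_tendstoD(2))
  then show ?thesis
  proof eventually_elim
    case (elim n)
    show ?case
    proof (intro allI impI ballI)
      fix j u assume j: "j < Suc n" and u: "u \<in> {gp a b (Suc n) j..gp a b (Suc n) (Suc j)}"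
      have "gp a b (Suc n) j \<in> {a..b}" "gp a b (Suc n) (Suc j) \<in> {a..b}"
        using gp_ge[of a b] gp_le[of a b] j assms(1) by auto
      moreover from this have "u \<in> {a..b}" using u by auto
      moreover have "dist u (gp a b (Suc n) j) < d"
        using u elim gp_diff[of a b "Suc n" j] by (auto simp: dist_real_def)
      ultimately show "\<bar>f u - f (gp a b (Suc n) j)\<bar> < e"
        using d(2)[of "gp a b (Suc n) j" u] by (simp add: dist_real_def)
    qed
  qed
qed

lemma integral_chain:
  fixes f :: "real \<Rightarrow> real"
  assumes "\<And>m. m < K \<Longrightarrow> q m \<le> q (Suc m)" "f integrable_on {q 0..q K}"
  shows "integral {q 0..q K} f = (\<Sum>m<K. integral {q m..q (Suc m)} f)"
  using assms
proof (induction K)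
  case (Suc K)
  have "i \<le> K \<Longrightarrow> q 0 \<le> q i" for i
    by (induction i) (use Suc.prems in \<open>auto intro: order_trans\<close>)
  then have *: "q 0 \<le> q K" "q K \<le> q (Suc K)" using Suc.prems by auto
  then have "f integrable_on {q 0..q K}"
    using integrable_subinterval_real[OF Suc.prems(2)] by auto
  with Suc have "integral {q 0..q K} f = (\<Sum>m<K. integral {q m..q (Suc m)} f)" by simp
  then show ?case
    using Henstock_Kurzweil_Integration.integral_combine[OF * Suc.prems(2)] by simp
qed simp

lemma riemann_sums:
  fixes f :: "real \<Rightarrow> real"
  assumes ab: "a < b" and f: "continuous_on {a..b} f"
  shows "(\<lambda>n. \<Sum>j<Suc n. f (gp a b (Suc n) j) * ((b - a) / real (Suc n))) \<longlonglongrightarrow> integral {a..b} f"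
proof (rule tendstoI)
  fix e :: real assume e: "e > 0"
  define e' where "e' = e / (2 * (b - a))"
  have e': "e' > 0" "e' * (b - a) < e" using e ab by (auto simp: e'_def field_simps)
  show "\<forall>\<^sub>F n in sequentially. dist (\<Sum>j<Suc n. f (gp a b (Suc n) j) * ((b - a) / real (Suc n)))
          (integral {a..b} f) < e"
    using grid_uniform[OF ab f e'(1)]
  proof eventually_elim
    case (elim n)
    let ?q = "gp a b (Suc n)" and ?h = "(b - a) / real (Suc n)"
    have q: "?q j \<le> ?q (Suc j)" "?q (Suc j) - ?q j = ?h" for j
      using gp_less[OF ab, of "Suc n" j] gp_diff[of a b "Suc n" j] by auto
    have "integral {a..b} f = (\<Sum>j<Suc n. integral {?q j..?q (Suc j)} f)"
      using integral_chain[of "Suc n" ?q f] q integrable_continuous_real[OF f] by simp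
    then have "dist (\<Sum>j<Suc n. f (?q j) * ?h) (integral {a..b} f)
        = \<bar>\<Sum>j<Suc n. (integral {?q j..?q (Suc j)} f - f (?q j) * ?h)\<bar>"
      by (simp add: dist_real_def sum_subtractf abs_minus_commute del: sum.lessThan_Suc)
    also have "\<dots> \<le> (\<Sum>j<Suc n. e' * ?h)"
    proof (rule order_trans[OF sum_abs], rule sum_mono)
      fix j assume j: "j \<in> {..<Suc n}"
      have cont: "continuous_on {?q j..?q (Suc j)} f"
        using gp_ge[of a b "Suc n" j] gp_le[of a b "Suc j" "Suc n"] ab j
        by (intro continuous_on_subset[OF f]) auto
      have "integral {?q j..?q (Suc j)} (\<lambda>u. f u - f (?q j)) = integral {?q j..?q (Suc j)} f - f (?q j) * ?h"
        using q[of j] cont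
        by (subst Henstock_Kurzweil_Integration.integral_diff)
           (auto intro: integrable_continuous_real simp: mult.commute)
      moreover have "norm (integral {?q j..?q (Suc j)} (\<lambda>u. f u - f (?q j))) \<le> e' * (?q (Suc j) - ?q j)"
        using elim j q[of j] cont
        by (intro integral_bound) (auto intro!: continuous_intros simp: less_imp_le)
      ultimately show "\<bar>integral {?q j..?q (Suc j)} f - f (?q j) * ?h\<bar> \<le> e' * ?h"
        using q(2)[of j] by simp
    qed
    also have "\<dots> = e' * (b - a)" by simp
    finally show ?case using e' by linarith
  qed
qed

lemma simple_value_at:
  assumes p: "\<And>i. i < k \<Longrightarrow> p i < p (Suc i)" and j: "j < k" "u \<in> {p j<..p (Suc j)}"
  shows "simple_value k p \<xi> u \<omega> = \<xi> j \<omega>"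
proof -
  have "indicator {p i<..p (Suc i)} u = (if i = j then 1 else 0 :: real)" if "i < k" for i
    using chain_le_iff[where q = p and K = k and c = i, OF p j]
      chain_le_iff[where q = p and K = k and c = "Suc i", OF p j] that by (auto simp: indicator_def)
  then have "simple_value k p \<xi> u \<omega> = (\<Sum>i<k. \<xi> i \<omega> * (if i = j then 1 else 0))"
    unfolding simple_value_def by (intro sum.cong) auto
  also have "\<dots> = \<xi> j \<omega>" using j by (simp add: if_distrib[where f = "(*) _"] sum.delta' cong: if_cong)
  finally show ?thesis .
qed

lemma chain_cover:
  fixes p :: "nat \<Rightarrow> real"
  assumes p: "\<And>i. i < k \<Longrightarrow> p i < p (Suc i)" and u: "u \<in> {p 0<..p k}"
  obtains j where "j < k" "u \<in> {p j<..p (Suc j)}"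
proof -
  have "(\<Sum>m<k. indicator {p m<..p (Suc m)} u) \<noteq> (0 :: real)"
    using chain_indicator[of k p u] p u by (simp add: less_imp_le)
  then obtain m where "m < k" "indicator {p m<..p (Suc m)} u \<noteq> (0 :: real)"
    by (metis (no_types, lifting) lessThan_iff sum.not_neutral_contains_not_neutral)
  then show ?thesis using that by (auto simp: indicator_def split: if_splits)
qed

context brownian
begin

lemma simple_integral_measurable:
  assumes "adapted_steps a b k p \<xi>" "0 \<le> a"
  shows "simple_integral W k p \<xi> \<in> borel_measurable M"
  unfolding simple_integral_def[abs_def]
proof (intro borel_measurable_sum borel_measurable_times borel_measurable_diff W_measurable)
  fix i assume "i \<in> {..<k}"
  then show "0 \<le> p i" "0 \<le> p (Suc i)" "\<xi> i \<in> borel_measurable M"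
    using adapted_steps_bounds[OF assms(1), of i] adapted_steps_bounds[OF assms(1), of "Suc i"] assms
    by (auto simp: adapted_steps_def intro!: measurable_F_M[of _ "p i"])
qed

text \<open>By \<open>simple_integrals_close\<close> it does not matter which simple approximation of \<open>H\<close>
  is used, so the Riemann sums along uniform grids will do.\<close>

lemma ito_riemann:
  assumes ab: "0 \<le> a" "a < b" and ito: "has_ito_integral M F W H a b I"
    and H_F: "\<And>u. u \<in> {a..b} \<Longrightarrow> H u \<in> borel_measurable (F u)"
    and H_cont: "\<And>\<omega>. \<omega> \<in> space M \<Longrightarrow> continuous_on {a..b} (\<lambda>u. H u \<omega>)"
  shows "conv_prob M (\<lambda>n \<omega>. \<Sum>j<Suc n. H (gp a b (Suc n) j) \<omega> *
            inc (gp a b (Suc n) j) (gp a b (Suc n) (Suc j)) \<omega>) I"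
proof -
  have I[measurable]: "I \<in> borel_measurable M" and prog: "progressively_measurable F a b H"
    using ito by (auto simp: has_ito_integral_def)
  obtain k p \<xi> where simple: "\<And>n. simple_process M F a b (k n) (p n) (\<xi> n)"
    and n1: "null_in_probability M
          (\<lambda>n \<omega>. \<integral>\<^sup>+u\<in>{a..b}. ennreal ((simple_value (k n) (p n) (\<xi> n) u \<omega> - H u \<omega>)\<^sup>2) \<partial>lborel)"
    and n2: "null_in_probability M
          (\<lambda>n \<omega>. ennreal \<bar>simple_integral W (k n) (p n) (\<xi> n) \<omega> - I \<omega>\<bar>)"
    using ito by (auto simp: has_ito_integral_def)
  have S: "adapted_steps a b (k n) (p n) (\<xi> n)" for n
    using simple[of n] by (auto simp: simple_process_def adapted_steps_def)
  define g where "g n = gp a b (Suc n)" for n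
  have g: "g n 0 = a" "g n (Suc n) = b" "g n j < g n (Suc j)" for n j
    unfolding g_def using gp_less[OF ab(2)] by auto
  have R: "adapted_steps a b (Suc n) (g n) (\<lambda>j. H (g n j))" for n
    unfolding adapted_steps_def using g gp_ge[of a b] gp_le[of a b] ab
    by (auto simp: g_def less_imp_le intro!: H_F)
  define D1 where "D1 n \<omega> = (\<integral>\<^sup>+u\<in>{a..b}. ennreal ((simple_value (k n) (p n) (\<xi> n) u \<omega> - H u \<omega>)\<^sup>2) \<partial>lborel)" for n \<omega>
  define D2 where "D2 n \<omega> = (\<integral>\<^sup>+u\<in>{a..b}. ennreal ((simple_value (Suc n) (g n) (\<lambda>j. H (g n j)) u \<omega> - H u \<omega>)\<^sup>2) \<partial>lborel)" for n \<omega>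
  have [measurable]: "D1 n \<in> borel_measurable M" "D2 n \<in> borel_measurable M" for n
    unfolding D1_def D2_def using ab by (intro sq_dist_measurable S R prog; simp)+
  have D2_lim: "(\<lambda>n. D2 n \<omega>) \<longlonglongrightarrow> 0" if \<omega>: "\<omega> \<in> space M" for \<omega>
  proof (rule order_tendstoI)
    fix e :: ennreal assume "0 < e"
    then obtain c :: real where c: "0 < c" "ennreal c < e"
    proof (cases e)
      case (real x)
      then have "0 < x / 2" "ennreal (x / 2) < e"
        using \<open>0 < e\<close> by (auto simp: ennreal_less_iff)
      then show ?thesis by (rule that)
    next
      case top
      then show ?thesis by (intro that[of 1]) auto
    qed
    \<comment> \<open>A uniform error \<open>d\<close> contributes at most
      \<open>d\<^sup>2 * (b - a)\<close> to the squared distance, which is \<open>c\<close> with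
      this choice.\<close>
    define d where "d = sqrt (c / (b - a))"
    have d: "d > 0" "d\<^sup>2 * (b - a) = c" using c ab by (auto simp: d_def)
    show "\<forall>\<^sub>F n in sequentially. D2 n \<omega> < e"
      using grid_uniform[OF ab(2) H_cont[OF \<omega>] d(1)]
    proof eventually_elim
      case (elim n)
      have le: "(simple_value (Suc n) (g n) (\<lambda>j. H (g n j)) u \<omega> - H u \<omega>)\<^sup>2 \<le> d\<^sup>2" if u: "u \<in> {a<..b}" for u
      proof -
        obtain j where j: "j < Suc n" "u \<in> {g n j<..g n (Suc j)}"
          using chain_cover[of "Suc n" "g n" u] g u by auto
        then have "simple_value (Suc n) (g n) (\<lambda>j. H (g n j)) u \<omega> = H (g n j) \<omega>"
          using g by (intro simple_value_at) auto
        moreover have "\<bar>H u \<omega> - H (g n j) \<omega>\<bar> < d"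
          using elim j by (auto simp: g_def)
        ultimately show ?thesis using d(1) by (simp add: abs_le_square_iff[symmetric])
      qed
      have "D2 n \<omega> \<le> (\<integral>\<^sup>+u. ennreal (d\<^sup>2) * indicator {a<..b} u \<partial>lborel)"
        unfolding D2_def
        using AE_lborel_singleton[of a]
        by (intro nn_integral_mono_AE)
           (auto simp: indicator_def le intro!: ennreal_leI elim!: eventually_mono)
      also have "\<dots> = ennreal (d\<^sup>2 * (b - a))"
        using ab by (simp add: nn_integral_cmult_indicator ennreal_mult')
      finally show ?case using c d by simp
    qed
  qed simp
  have P2: "(\<lambda>n. prob {\<omega> \<in> space M. ennreal \<delta> < D2 n \<omega>}) \<longlonglongrightarrow> 0" if "\<delta> > 0" for \<delta>
  proof -
    have "(\<lambda>n. expectation (indicator {\<omega> \<in> space M. ennreal \<delta> < D2 n \<omega>})) \<longlonglongrightarrow> expectation (\<lambda>_. 0 :: real)"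
    proof (rule integral_dominated_convergence[where w = "\<lambda>_. 1"])
      show "AE \<omega> in M. (\<lambda>n. indicator {\<omega> \<in> space M. ennreal \<delta> < D2 n \<omega>} \<omega> :: real) \<longlonglongrightarrow> 0"
      proof (rule AE_I2)
        fix \<omega> assume "\<omega> \<in> space M"
        then have "\<forall>\<^sub>F n in sequentially. D2 n \<omega> < ennreal \<delta>"
          using order_tendstoD(2)[OF D2_lim] that by simp
        then show "(\<lambda>n. indicator {\<omega> \<in> space M. ennreal \<delta> < D2 n \<omega>} \<omega> :: real) \<longlonglongrightarrow> 0"
          by (intro tendsto_eventually) (auto elim!: eventually_mono simp: indicator_def)
      qed
    qed (auto simp: indicator_def)
    then show ?thesis by simp
  qed
  have P1: "(\<lambda>n. prob {\<omega> \<in> space M. ennreal \<delta> < D1 n \<omega>}) \<longlonglongrightarrow> 0" if "\<delta> > 0" for \<delta>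
    using n1 that by (simp add: null_in_probability_def D1_def)
  define D where "D n \<omega> = (\<integral>\<^sup>+u\<in>{a..b}. ennreal ((simple_value (Suc n) (g n) (\<lambda>j. H (g n j)) u \<omega> - simple_value (k n) (p n) (\<xi> n) u \<omega>)\<^sup>2) \<partial>lborel)" for n \<omega>
  have D_le: "D n \<omega> \<le> 2 * D2 n \<omega> + 2 * D1 n \<omega>" if \<omega>: "\<omega> \<in> space M" for n \<omega>
  proof -
    note pm = simple_value_pair_measurable[OF S ab(1), of n] simple_value_pair_measurable[OF R ab(1), of n]
      progressive_pair_measurable[OF prog ab(1) less_imp_le[OF ab(2)]]
    note [measurable] = pm[THEN measurable_compose_Pair1[OF \<omega>], simplified]
    let ?H = "\<lambda>u. H (max a (min b u)) \<omega>" and ?R = "\<lambda>u. simple_value (Suc n) (g n) (\<lambda>j. H (g n j)) u \<omega>"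
      and ?S = "\<lambda>u. simple_value (k n) (p n) (\<xi> n) u \<omega>"
    have e1: "D1 n \<omega> = (\<integral>\<^sup>+u. ennreal ((?S u - ?H u)\<^sup>2) * indicator {a..b} u \<partial>lborel)"
      unfolding D1_def by (intro nn_integral_cong) (auto simp: indicator_def)
    have e2: "D2 n \<omega> = (\<integral>\<^sup>+u. ennreal ((?R u - ?H u)\<^sup>2) * indicator {a..b} u \<partial>lborel)"
      unfolding D2_def by (intro nn_integral_cong) (auto simp: indicator_def)
    have "(?R u - ?S u)\<^sup>2 \<le> 2 * (?R u - H u \<omega>)\<^sup>2 + 2 * (?S u - H u \<omega>)\<^sup>2" for u
      using zero_le_power2[of "(?R u - H u \<omega>) + (?S u - H u \<omega>)"]
      by (simp add: power2_eq_square algebra_simps)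
    then have "D n \<omega> \<le> (\<integral>\<^sup>+u. 2 * (ennreal ((?R u - ?H u)\<^sup>2) * indicator {a..b} u)
          + 2 * (ennreal ((?S u - ?H u)\<^sup>2) * indicator {a..b} u) \<partial>lborel)"
      unfolding D_def
      by (intro nn_integral_mono)
         (auto simp: indicator_def ennreal_mult'[symmetric] ennreal_plus[symmetric]
            simp flip: ennreal_numeral simp del: ennreal_plus intro!: ennreal_leI)
    also have "\<dots> = 2 * D2 n \<omega> + 2 * D1 n \<omega>"
      unfolding e1 e2 by (simp add: nn_integral_add nn_integral_cmult)
    finally show ?thesis .
  qed
  have PD: "(\<lambda>n. prob {\<omega> \<in> space M. ennreal \<delta> < D n \<omega>}) \<longlonglongrightarrow> 0" if "\<delta> > 0" for \<delta>
  proof (rule tendsto_sandwich[OF _ _ tendsto_const])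
    show "(\<lambda>n. prob {\<omega> \<in> space M. ennreal (\<delta>/4) < D2 n \<omega>} + prob {\<omega> \<in> space M. ennreal (\<delta>/4) < D1 n \<omega>}) \<longlonglongrightarrow> 0"
      using that by (intro tendsto_add_zero P1 P2) auto
    have "prob {\<omega> \<in> space M. ennreal \<delta> < D n \<omega>}
      \<le> prob ({\<omega> \<in> space M. ennreal (\<delta>/4) < D2 n \<omega>} \<union> {\<omega> \<in> space M. ennreal (\<delta>/4) < D1 n \<omega>})" for n
    proof (intro finite_measure_mono subsetI)
      fix \<omega> assume \<omega>: "\<omega> \<in> {\<omega> \<in> space M. ennreal \<delta> < D n \<omega>}"
      show "\<omega> \<in> {\<omega> \<in> space M. ennreal (\<delta>/4) < D2 n \<omega>} \<union> {\<omega> \<in> space M. ennreal (\<delta>/4) < D1 n \<omega>}"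
      proof (rule ccontr)
        assume "\<not> ?thesis"
        then have "D2 n \<omega> \<le> ennreal (\<delta>/4)" "D1 n \<omega> \<le> ennreal (\<delta>/4)" using \<omega> by auto
        then have "2 * D2 n \<omega> + 2 * D1 n \<omega> \<le> 2 * ennreal (\<delta>/4) + 2 * ennreal (\<delta>/4)"
          by (intro add_mono mult_left_mono) auto
        also have "\<dots> = ennreal \<delta>"
          using that by (simp add: ennreal_mult'[symmetric] ennreal_plus[symmetric] flip: ennreal_numeral del: ennreal_plus)
        finally show False using D_le[of \<omega> n] \<omega> by auto
      qed
    qed measurable
    also have "\<dots> n \<le> prob {\<omega> \<in> space M. ennreal (\<delta>/4) < D2 n \<omega>} + prob {\<omega> \<in> space M. ennreal (\<delta>/4) < D1 n \<omega>}" for n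
      by (intro measure_Un_le) auto
    finally show "\<forall>\<^sub>F n in sequentially. prob {\<omega> \<in> space M. ennreal \<delta> < D n \<omega>}
      \<le> prob {\<omega> \<in> space M. ennreal (\<delta>/4) < D2 n \<omega>} + prob {\<omega> \<in> space M. ennreal (\<delta>/4) < D1 n \<omega>}"
      by simp
  qed simp
  let ?SR = "\<lambda>n. simple_integral W (Suc n) (g n) (\<lambda>j. H (g n j))"
  let ?SS = "\<lambda>n. simple_integral W (k n) (p n) (\<xi> n)"
  have [measurable]: "?SR n \<in> borel_measurable M" "?SS n \<in> borel_measurable M" for n
    using simple_integral_measurable[OF S ab(1)] simple_integral_measurable[OF R ab(1)] by auto
  have "(\<lambda>n. prob {\<omega> \<in> space M. \<epsilon> < \<bar>?SR n \<omega> - ?SS n \<omega>\<bar>}) \<longlonglongrightarrow> 0" if "\<epsilon> > 0" for \<epsilon>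
  proof (rule order_tendstoI)
    fix e :: real assume "0 < e"
    \<comment> \<open>One half of the tolerance \<open>e\<close> is spent on the term
      \<open>\<delta> / \<epsilon>\<^sup>2\<close> of Lenglart's inequality, the other half on the
      probability that the squared distance exceeds \<delta>.\<close>
    define \<delta> where "\<delta> = e / 2 * \<epsilon>\<^sup>2"
    have \<delta>: "\<delta> > 0" "\<delta> / \<epsilon>\<^sup>2 = e / 2" using \<open>0 < e\<close> that by (auto simp: \<delta>_def)
    have "\<forall>\<^sub>F n in sequentially. prob {\<omega> \<in> space M. ennreal \<delta> < D n \<omega>} < e / 2"
      using \<open>0 < e\<close> by (intro order_tendstoD(2)[OF PD[OF \<delta>(1)]]) simp
    then show "\<forall>\<^sub>F n in sequentially. prob {\<omega> \<in> space M. \<epsilon> < \<bar>?SR n \<omega> - ?SS n \<omega>\<bar>} < e"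
    proof eventually_elim
      case (elim n)
      have "prob {\<omega> \<in> space M. \<epsilon> < \<bar>?SR n \<omega> - ?SS n \<omega>\<bar>} \<le> \<delta> / \<epsilon>\<^sup>2 + prob {\<omega> \<in> space M. ennreal \<delta> < D n \<omega>}"
        unfolding D_def by (intro simple_integrals_close R S ab that \<delta>)
      with elim \<delta>(2) show ?case by simp
    qed
  next
    fix e :: real assume "e < 0"
    then show "\<forall>\<^sub>F n in sequentially. e < prob {\<omega> \<in> space M. \<epsilon> < \<bar>?SR n \<omega> - ?SS n \<omega>\<bar>}"
      by (intro always_eventually allI) (meson less_le_trans measure_nonneg)
  qed
  then have "conv_prob M (\<lambda>n \<omega>. ?SR n \<omega> - ?SS n \<omega>) (\<lambda>_. 0)"
    by (simp add: conv_prob_def)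
  moreover have "conv_prob M ?SS I"
    using n2 by (auto simp: conv_prob_def null_in_probability_def ennreal_less_iff)
  ultimately have "conv_prob M (\<lambda>n \<omega>. ?SR n \<omega> - ?SS n \<omega> + ?SS n \<omega>) (\<lambda>\<omega>. 0 + I \<omega>)"
    by (rule conv_prob_add)
  then show ?thesis by (simp add: simple_integral_def inc_def g_def del: sum.lessThan_Suc)
qed

section \<open>Uniqueness of limits of Euler sums\<close>

text \<open>An encoding of the equation with drift \<open>\<mu> s * Z s\<close>, volatility
  \<open>\<sigma> * Z s\<close> and initial value \<open>x\<close> in which no stochastic integral
  occurs. The grid depends on the terminal time \<open>s\<close>. The condition is linear in
  \<open>Z\<close>, so the difference of two such processes satisfies it with initial value
  0.\<close>

definition euler_limit ::
  "real \<Rightarrow> real \<Rightarrow> (real \<Rightarrow> real) \<Rightarrow> real \<Rightarrow> real \<Rightarrow> (real \<Rightarrow> 'a \<Rightarrow> real) \<Rightarrow> bool" where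
  "euler_limit t S \<mu> \<sigma> x Z \<longleftrightarrow> (\<forall>s\<in>{t<..S}. conv_prob M
     (\<lambda>n \<omega>. \<Sum>j<Suc n. Z (gp t s (Suc n) j) \<omega> *
        (\<mu> (gp t s (Suc n) j) * ((s - t) / real (Suc n))
         + \<sigma> * inc (gp t s (Suc n) j) (gp t s (Suc n) (Suc j)) \<omega>))
     (\<lambda>\<omega>. Z s \<omega> - x))"

lemma euler_limit_diff:
  assumes "euler_limit t S \<mu> \<sigma> x Z" "euler_limit t S \<mu> \<sigma> x Z'"
  shows "euler_limit t S \<mu> \<sigma> 0 (\<lambda>s \<omega>. Z s \<omega> - Z' s \<omega>)"
  unfolding euler_limit_def
proof
  fix s assume "s \<in> {t<..S}"
  from conv_prob_add[OF assms(1)[unfolded euler_limit_def, rule_format, OF this]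
      conv_prob_cmult[OF assms(2)[unfolded euler_limit_def, rule_format, OF this], of "-1"]]
  show "conv_prob M
     (\<lambda>n \<omega>. \<Sum>j<Suc n. (Z (gp t s (Suc n) j) \<omega> - Z' (gp t s (Suc n) j) \<omega>) *
        (\<mu> (gp t s (Suc n) j) * ((s - t) / real (Suc n))
         + \<sigma> * inc (gp t s (Suc n) j) (gp t s (Suc n) (Suc j)) \<omega>))
     (\<lambda>\<omega>. Z s \<omega> - Z' s \<omega> - 0)"
    by (simp add: left_diff_distrib sum_subtractf del: sum.lessThan_Suc)
qed

text \<open>The stochastic part converges by \<open>ito_riemann\<close>, the drift part pathwise as
  a Riemann sum of a continuous function. The horizon \<open>S\<close> is separate from
  \<open>T\<close> so that \<mu> may be singular at \<open>T\<close>, as it is in the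
  application.\<close>

lemma sde_euler:
  assumes t: "0 \<le> t" "S \<le> T"
    and sde: "sde_solution M F W (\<lambda>s y. \<mu> s * y) (\<lambda>s y. \<sigma> * y) t T x X"
    and \<mu>: "continuous_on {t..S} \<mu>"
  shows "euler_limit t S \<mu> \<sigma> x X"
  unfolding euler_limit_def
proof
  fix s assume s: "s \<in> {t<..S}"
  then have sT: "s \<in> {t..T}" "t < s" using t by auto
  have XF: "X u \<in> borel_measurable (F u)" if "u \<in> {t..T}" for u
    using sde that by (simp add: sde_solution_def)
  have [measurable]: "X u \<in> borel_measurable M" if "u \<in> {t..T}" for u
    using measurable_F_M[OF XF] that t by auto
  have Xc: "continuous_on {t..T} (\<lambda>u. X u \<omega>)" if "\<omega> \<in> space M" for \<omega>
    using sde that by (simp add: sde_solution_def)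
  obtain I where ito: "has_ito_integral M F W (\<lambda>u \<omega>. \<sigma> * X u \<omega>) t s I"
    and ae: "AE \<omega> in M. set_integrable lborel {t..s} (\<lambda>u. \<mu> u * X u \<omega>) \<and>
           X s \<omega> = x + (LINT u:{t..s}|lborel. \<mu> u * X u \<omega>) + I \<omega>"
    using sde sT unfolding sde_solution_def by blast
  have [measurable]: "I \<in> borel_measurable M" using ito by (simp add: has_ito_integral_def)
  have grid: "gp t s (Suc n) j \<in> {t..T}" "gp t s (Suc n) j \<in> {t..s}" if "j < Suc n" for n j
    using gp_ge[of t s "Suc n" j] gp_le[of t s j "Suc n"] sT that by auto
  have 1: "conv_prob M (\<lambda>n \<omega>. \<Sum>j<Suc n. \<sigma> * X (gp t s (Suc n) j) \<omega> *
            inc (gp t s (Suc n) j) (gp t s (Suc n) (Suc j)) \<omega>) I"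
    using XF sT by (intro ito_riemann t ito) (auto intro!: continuous_intros continuous_on_subset[OF Xc])
  have 2: "conv_prob M (\<lambda>n \<omega>. \<Sum>j<Suc n. \<mu> (gp t s (Suc n) j) * X (gp t s (Suc n) j) \<omega> * ((s - t) / real (Suc n)))
      (\<lambda>\<omega>. X s \<omega> - x - I \<omega>)"
  proof (rule conv_prob_AE)
    show "(\<lambda>\<omega>. \<Sum>j<Suc n. \<mu> (gp t s (Suc n) j) * X (gp t s (Suc n) j) \<omega> * ((s - t) / real (Suc n)))
        \<in> borel_measurable M" for n
      using grid by (intro borel_measurable_sum borel_measurable_times) auto
    show "AE \<omega> in M. (\<lambda>n. \<Sum>j<Suc n. \<mu> (gp t s (Suc n) j) * X (gp t s (Suc n) j) \<omega> * ((s - t) / real (Suc n)))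
        \<longlonglongrightarrow> X s \<omega> - x - I \<omega>"
      using ae AE_space
    proof eventually_elim
      case (elim \<omega>)
      have "continuous_on {t..s} (\<lambda>u. \<mu> u * X u \<omega>)"
        using elim sT s by (intro continuous_on_mult continuous_on_subset[OF \<mu>] continuous_on_subset[OF Xc]) auto
      from riemann_sums[OF sT(2) this]
      have "(\<lambda>n. \<Sum>j<Suc n. \<mu> (gp t s (Suc n) j) * X (gp t s (Suc n) j) \<omega> * ((s - t) / real (Suc n)))
        \<longlonglongrightarrow> integral {t..s} (\<lambda>u. \<mu> u * X u \<omega>)" .
      moreover have "(LINT u:{t..s}|lborel. \<mu> u * X u \<omega>) = integral {t..s} (\<lambda>u. \<mu> u * X u \<omega>)"
        using elim by (intro set_borel_integral_eq_integral) auto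
      ultimately show ?case using elim by simp
    qed
  qed (use sT in measurable)
  show "conv_prob M
     (\<lambda>n \<omega>. \<Sum>j<Suc n. X (gp t s (Suc n) j) \<omega> *
        (\<mu> (gp t s (Suc n) j) * ((s - t) / real (Suc n))
         + \<sigma> * inc (gp t s (Suc n) j) (gp t s (Suc n) (Suc j)) \<omega>))
     (\<lambda>\<omega>. X s \<omega> - x)"
    using conv_prob_add[OF 1 2] by (simp add: sum.distrib[symmetric] algebra_simps del: sum.lessThan_Suc)
qed

lemma conv_prob_mult_indicator:
  assumes f: "conv_prob M f f'" and A[measurable]: "A \<in> events"
  shows "conv_prob M (\<lambda>n \<omega>. indicator A \<omega> * f n \<omega>) (\<lambda>\<omega>. indicator A \<omega> * f' \<omega>)"
proof -
  have [measurable]: "f n \<in> borel_measurable M" "f' \<in> borel_measurable M" for n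
    using f by (auto simp: conv_prob_def)
  have "(\<lambda>n. prob {\<omega> \<in> space M. \<epsilon> < \<bar>indicator A \<omega> * f n \<omega> - indicator A \<omega> * f' \<omega>\<bar>}) \<longlonglongrightarrow> 0" if "\<epsilon> > 0" for \<epsilon>
  proof (rule tendsto_sandwich[OF _ _ tendsto_const])
    show "(\<lambda>n. prob {\<omega> \<in> space M. \<epsilon> < \<bar>f n \<omega> - f' \<omega>\<bar>}) \<longlonglongrightarrow> 0"
      using f that by (simp add: conv_prob_def)
    show "\<forall>\<^sub>F n in sequentially. prob {\<omega> \<in> space M. \<epsilon> < \<bar>indicator A \<omega> * f n \<omega> - indicator A \<omega> * f' \<omega>\<bar>}
        \<le> prob {\<omega> \<in> space M. \<epsilon> < \<bar>f n \<omega> - f' \<omega>\<bar>}"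
      using that by (intro always_eventually allI finite_measure_mono) (auto simp: indicator_def)
  qed simp
  then show ?thesis by (simp add: conv_prob_def)
qed

end

section \<open>Gronwall's inequality and uniqueness\<close>

lemma power_Suc_add_one_ge:
  fixes x :: real
  assumes "x \<ge> 0"
  shows "x ^ Suc k + real (Suc k) * x ^ k \<le> (x + 1) ^ Suc k"
proof (induction k)
  case (Suc k)
  have "x ^ Suc (Suc k) + real (Suc (Suc k)) * x ^ Suc k
      \<le> (x + 1) * (x ^ Suc k + real (Suc k) * x ^ k)"
    using assms by (simp add: algebra_simps)
  also have "\<dots> \<le> (x + 1) * (x + 1) ^ Suc k"
    using Suc assms by (intro mult_left_mono) auto
  finally show ?case by simp
qed simp

text \<open>The discrete form of integrating a power. It supplies the factor
  \<open>1 / (k + 1)\<close> by which the iterated estimate acquires its factorial.\<close>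

lemma sum_power_le: "real (Suc k) * (\<Sum>j<N. real j ^ k) \<le> real N ^ Suc k"
proof (induction N)
  case (Suc N)
  then show ?case using power_Suc_add_one_ge[of "real N" k]
    by (simp add: distrib_left add.commute)
qed simp

lemma sum_sq_le:
  fixes a :: "nat \<Rightarrow> real"
  shows "(\<Sum>j<N. a j)\<^sup>2 \<le> real N * (\<Sum>j<N. (a j)\<^sup>2)"
  using Cauchy_Schwarz_ineq_sum[of a "\<lambda>_. 1" "{..<N}"] by (simp add: mult.commute)

context brownian
begin

text \<open>By path continuity the bound may be tested at countably many grid points, so the event
  lies in \<open>F s\<close> itself, without augmenting the filtration. The index
  \<open>min j n\<close> keeps the tested times inside the grid.\<close>

lemma bounded_path_event:
  fixes Z :: "real \<Rightarrow> 'a \<Rightarrow> real"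
  assumes t: "t \<le> s" and Z: "\<And>u. u \<in> {t..s} \<Longrightarrow> Z u \<in> borel_measurable (F s)"
    and c: "\<And>\<omega>. \<omega> \<in> space M \<Longrightarrow> continuous_on {t..s} (\<lambda>u. Z u \<omega>)"
  shows "{\<omega> \<in> space M. \<forall>v\<in>{t..s}. \<bar>Z v \<omega>\<bar> \<le> R} \<in> sets (F s)"
proof -
  have gr: "gp t s (Suc n) j \<in> {t..s}" if "j \<in> {..n}" for n j
    using gp_ge[of t s "Suc n" j] gp_le[of t s j "Suc n"] t that by auto
  have "{\<omega> \<in> space M. \<forall>v\<in>{t..s}. \<bar>Z v \<omega>\<bar> \<le> R}
      = {\<omega> \<in> space (F s). \<bar>Z t \<omega>\<bar> \<le> R \<and> (\<forall>n j. \<bar>Z (gp t s (Suc n) (min j n)) \<omega>\<bar> \<le> R)}" (is "?L = ?R")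
  proof
    show "?L \<subseteq> ?R" using gr t by (auto simp: space_F)
    show "?R \<subseteq> ?L"
    proof safe
      fix \<omega> v assume \<omega>: "\<omega> \<in> space (F s)" and v: "v \<in> {t..s}"
        and b: "\<bar>Z t \<omega>\<bar> \<le> R" "\<forall>n j. \<bar>Z (gp t s (Suc n) (min j n)) \<omega>\<bar> \<le> R"
      show "\<bar>Z v \<omega>\<bar> \<le> R"
      proof (cases "v = t")
        case False
        then have ts: "t < s" "v \<in> {t<..s}" using v by auto
        show ?thesis
        proof (rule field_le_epsilon)
          fix e :: real assume "e > 0"
          from grid_uniform[OF ts(1) c this, of \<omega>] \<omega>
          have "\<forall>\<^sub>F n in sequentially. \<forall>j<Suc n. \<forall>u\<in>{gp t s (Suc n) j..gp t s (Suc n) (Suc j)}.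
             \<bar>Z u \<omega> - Z (gp t s (Suc n) j) \<omega>\<bar> < e" by (simp add: space_F)
          from eventually_happens'[OF sequentially_bot this]
          obtain n where n: "\<forall>j<Suc n. \<forall>u\<in>{gp t s (Suc n) j..gp t s (Suc n) (Suc j)}.
             \<bar>Z u \<omega> - Z (gp t s (Suc n) j) \<omega>\<bar> < e" by blast
          obtain j where j: "j < Suc n" "v \<in> {gp t s (Suc n) j<..gp t s (Suc n) (Suc j)}"
            using chain_cover[of "Suc n" "gp t s (Suc n)" v] gp_less[OF ts(1)] ts(2) by auto
          then have "\<bar>Z v \<omega> - Z (gp t s (Suc n) j) \<omega>\<bar> < e" using n by auto
          moreover have "\<bar>Z (gp t s (Suc n) j) \<omega>\<bar> \<le> R"
            using b(2)[rule_format, of n j] j by (simp add: min_absorb1)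
          ultimately show "\<bar>Z v \<omega>\<bar> \<le> R + e" by linarith
        qed
      qed (use b in simp)
    qed (simp add: space_F)
  qed
  moreover have "?R \<in> sets (F s)"
  proof -
    have [measurable]: "Z t \<in> borel_measurable (F s)"
      "Z (gp t s (Suc n) (min j n)) \<in> borel_measurable (F s)" for n j
      using Z gr t by auto
    show ?thesis by measurable
  qed
  ultimately show ?thesis by simp
qed

text \<open>Gronwall's argument for the second moments, truncated at the paths bounded by \<open>R\<close>.\<close>

lemma euler_limit_unique:
  assumes t: "0 \<le> t"
    and Z_F: "\<And>s. s \<in> {t..S} \<Longrightarrow> Z s \<in> borel_measurable (F s)"
    and Z_cont: "\<And>\<omega>. \<omega> \<in> space M \<Longrightarrow> continuous_on {t..S} (\<lambda>s. Z s \<omega>)"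
    and \<mu>: "\<And>s. s \<in> {t..S} \<Longrightarrow> \<bar>\<mu> s\<bar> \<le> C"
    and euler: "euler_limit t S \<mu> \<sigma> 0 Z"
    and Z0: "AE \<omega> in M. Z t \<omega> = 0"
    and s: "s \<in> {t..S}"
  shows "AE \<omega> in M. Z s \<omega> = 0"
proof -
  \<comment> \<open>One factor 2 comes from separating drift and noise in a square, the other from
    \<open>conv_prob_bounded_sq\<close>.\<close>
  define c where "c = 4 * (C\<^sup>2 * (S - t) + \<sigma>\<^sup>2)"
  define A where "A R s = {\<omega> \<in> space M. \<forall>v\<in>{t..s}. \<bar>Z v \<omega>\<bar> \<le> R}" for R s
  define \<iota> where "\<iota> R s = (indicator (A R s) :: 'a \<Rightarrow> real)" for R s
  define f where "f R s = expectation (\<lambda>\<omega>. (\<iota> R s \<omega> * Z s \<omega>)\<^sup>2)" for R s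
  have tS: "t \<le> S" using s by simp
  have C0: "C \<ge> 0" using \<mu>[of t] tS by (simp add: order_trans[OF abs_ge_zero])
  have c0: "c \<ge> 0" using tS by (simp add: c_def)
  have A_F: "A R u \<in> sets (F u)" if u: "u \<in> {t..S}" for R u
    unfolding A_def
  proof (rule bounded_path_event)
    show "Z v \<in> borel_measurable (F u)" if "v \<in> {t..u}" for v
      using measurable_F_mono[OF Z_F] that u by auto
    show "continuous_on {t..u} (\<lambda>v. Z v \<omega>)" if "\<omega> \<in> space M" for \<omega>
      using continuous_on_subset[OF Z_cont[OF that]] u by auto
  qed (use u in auto)
  have A_M: "A R u \<in> events" if "u \<in> {t..S}" for R u
    using A_F[OF that] subalg[of u] that t by (auto simp: subalgebra_def)
  have \<iota>Z_F: "(\<lambda>\<omega>. \<iota> R u \<omega> * Z u \<omega>) \<in> borel_measurable (F u)" if "u \<in> {t..S}" for R u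
    unfolding \<iota>_def using A_F[OF that] Z_F[OF that] by measurable
  have \<iota>Z_M: "(\<lambda>\<omega>. \<iota> R u \<omega> * Z u \<omega>) \<in> borel_measurable M" if "u \<in> {t..S}" for R u
    using measurable_F_M[OF \<iota>Z_F] that t by auto
  have bound: "\<bar>\<iota> R u \<omega> * Z u \<omega>\<bar> \<le> R" if "R \<ge> 0" "u \<in> {t..S}" for R u \<omega>
    using that by (auto simp: \<iota>_def indicator_def A_def)
  have bound_sq: "(\<iota> R u \<omega> * Z u \<omega>)\<^sup>2 \<le> R\<^sup>2" if "R \<ge> 0" "u \<in> {t..S}" for R u \<omega>
    using bound[OF that, of \<omega>] that by (simp add: abs_le_square_iff[symmetric])
  have int_sq: "integrable M (\<lambda>\<omega>. (\<iota> R u \<omega> * Z u \<omega>)\<^sup>2)" if "R \<ge> 0" "u \<in> {t..S}" for R u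
    using bound_sq[OF that] \<iota>Z_M[OF that(2)]
    by (intro integrable_const_bound[where B = "R\<^sup>2"]) auto
  \<comment> \<open>Inserting the bound for \<open>k\<close> into the Euler sums yields the bound
    for \<open>Suc k\<close>. The truncation gives the start of the induction; as \<open>k\<close>
    grows, the bound is a vanishing term of an exponential series.\<close>
  have main: "f R u \<le> R\<^sup>2 * ((c * (u - t)) ^ k / fact k)" if R: "R \<ge> 0" and "u \<in> {t..S}" for R u k
    using that(2)
  proof (induction k arbitrary: u)
    case 0
    have "f R u \<le> expectation (\<lambda>_. R\<^sup>2)"
      unfolding f_def using int_sq bound_sq R 0 by (intro integral_mono) auto
    then show ?case by (simp add: prob_space)
  next
    case (Suc k)
    show ?case
    proof (cases "u = t")
      case True
      have "f R u = expectation (\<lambda>_. 0)"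
        unfolding f_def using Z0 True \<iota>Z_M[OF Suc.prems]
        by (intro integral_cong_AE) (auto elim!: eventually_mono)
      then show ?thesis using True by simp
    next
      case False
      then have u: "t < u" "u \<le> S" "u \<in> {t<..S}" using Suc.prems by auto
      let ?h = "\<lambda>n. (u - t) / real (Suc n)"
      let ?g = "\<lambda>n. gp t u (Suc n)"
      let ?Y = "\<lambda>n j \<omega>. \<iota> R (?g n j) \<omega> * Z (?g n j) \<omega>"
      let ?E = "\<lambda>n \<omega>. \<Sum>j<Suc n. Z (?g n j) \<omega> * (\<mu> (?g n j) * ?h n + \<sigma> * inc (?g n j) (?g n (Suc j)) \<omega>)"
      have gr: "?g n j \<in> {t..S}" "?g n j \<le> u" "0 \<le> ?g n j" if "j < Suc n" for n j
        using gp_ge[of t u "Suc n" j] gp_le[of t u j "Suc n"] u t that by auto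
      have gl: "?g n j < ?g n (Suc j)" for n j using gp_less[OF u(1)] by simp
      have conv: "conv_prob M (\<lambda>n \<omega>. \<iota> R u \<omega> * ?E n \<omega>) (\<lambda>\<omega>. \<iota> R u \<omega> * (Z u \<omega> - 0))"
        unfolding \<iota>_def using euler u(3) A_M[OF Suc.prems]
        by (intro conv_prob_mult_indicator) (auto simp: euler_limit_def)
      define B where "B = c / 2 * (R\<^sup>2 * (c ^ k * ((u - t) ^ Suc k / real (Suc k)) / fact k))"
      have est: "integrable M (\<lambda>\<omega>. (\<iota> R u \<omega> * ?E n \<omega>)\<^sup>2)"
        "expectation (\<lambda>\<omega>. (\<iota> R u \<omega> * ?E n \<omega>)\<^sup>2) \<le> B" for n
      proof -
        define P where "P \<omega> = (\<Sum>j<Suc n. ?Y n j \<omega> * (\<mu> (?g n j) * ?h n))" for \<omega>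
        define Q where "Q \<omega> = (\<Sum>j<Suc n. ?Y n j \<omega> * inc (?g n j) (?g n (Suc j)) \<omega>)" for \<omega>
        have QL2: "integrable M (\<lambda>\<omega>. (Q \<omega>)\<^sup>2) \<and> expectation (\<lambda>\<omega>. (Q \<omega>)\<^sup>2)
          = (\<Sum>j<Suc n. expectation (\<lambda>\<omega>. (?Y n j \<omega>)\<^sup>2) * expectation (\<lambda>\<omega>. (inc (?g n j) (?g n (Suc j)) \<omega>)\<^sup>2))"
          unfolding Q_def
          by (rule martingale_transform_L2[where k = "\<lambda>_ x. x"])
             (use gr gl \<iota>Z_F int_sq[OF R] inc_moments in auto)
        have EQ: "expectation (\<lambda>\<omega>. (Q \<omega>)\<^sup>2) = (\<Sum>j<Suc n. f R (?g n j)) * ?h n"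
          unfolding QL2[THEN conjunct2] sum_distrib_right f_def
          using gr gl by (intro sum.cong refl) (simp add: inc_moments gp_diff)
        have YM: "?Y n j \<in> borel_measurable M" if "j < Suc n" for j
          using \<iota>Z_M gr(1)[OF that] by auto
        have PM: "P \<in> borel_measurable M"
          unfolding P_def[abs_def] by (intro borel_measurable_sum borel_measurable_times[OF YM]) auto
        have QM: "Q \<in> borel_measurable M"
          unfolding Q_def[abs_def] using gr(3) less_imp_le[OF gl]
          by (intro borel_measurable_sum borel_measurable_times[OF YM] inc_measurable) auto
        have P_le: "(P \<omega>)\<^sup>2 \<le> C\<^sup>2 * (u - t) * ?h n * (\<Sum>j<Suc n. (?Y n j \<omega>)\<^sup>2)" for \<omega>
        proof -
          have "(P \<omega>)\<^sup>2 \<le> real (Suc n) * (\<Sum>j<Suc n. (?Y n j \<omega> * (\<mu> (?g n j) * ?h n))\<^sup>2)"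
            unfolding P_def by (rule sum_sq_le)
          also have "\<dots> \<le> real (Suc n) * (\<Sum>j<Suc n. (?Y n j \<omega>)\<^sup>2 * (C\<^sup>2 * (?h n)\<^sup>2))"
          proof (intro mult_left_mono sum_mono)
            fix j assume "j \<in> {..<Suc n}"
            then have "\<bar>\<mu> (?g n j)\<bar> \<le> \<bar>C\<bar>" using \<mu> gr(1)[of j n] C0 by auto
            then have "(\<mu> (?g n j))\<^sup>2 \<le> C\<^sup>2" by (simp only: abs_le_square_iff)
            then show "(?Y n j \<omega> * (\<mu> (?g n j) * ?h n))\<^sup>2 \<le> (?Y n j \<omega>)\<^sup>2 * (C\<^sup>2 * (?h n)\<^sup>2)"
              unfolding power_mult_distrib by (intro mult_left_mono mult_right_mono) auto
          qed simp
          also have "\<dots> = C\<^sup>2 * (real (Suc n) * ?h n) * ?h n * (\<Sum>j<Suc n. (?Y n j \<omega>)\<^sup>2)"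
            unfolding sum_distrib_right[symmetric] by (simp only: power2_eq_square mult_ac)
          also have "real (Suc n) * ?h n = u - t" by simp
          finally show ?thesis .
        qed
        have sumint: "integrable M (\<lambda>\<omega>. \<Sum>j<Suc n. (?Y n j \<omega>)\<^sup>2)"
          "expectation (\<lambda>\<omega>. \<Sum>j<Suc n. (?Y n j \<omega>)\<^sup>2) = (\<Sum>j<Suc n. f R (?g n j))"
          unfolding f_def using int_sq[OF R] gr(1)
          by (auto intro!: Bochner_Integration.integrable_sum Bochner_Integration.integral_sum
              simp del: sum.lessThan_Suc)
        have P_sq: "integrable M (\<lambda>\<omega>. (P \<omega>)\<^sup>2)"
        proof (rule Bochner_Integration.integrable_bound)
          show "integrable M (\<lambda>\<omega>. C\<^sup>2 * (u - t) * ?h n * (\<Sum>j<Suc n. (?Y n j \<omega>)\<^sup>2))"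
            by (rule integrable_mult_right[OF sumint(1)])
          show "AE \<omega> in M. norm ((P \<omega>)\<^sup>2) \<le> norm (C\<^sup>2 * (u - t) * ?h n * (\<Sum>j<Suc n. (?Y n j \<omega>)\<^sup>2))"
          proof (rule AE_I2)
            fix \<omega>
            have "norm ((P \<omega>)\<^sup>2) = (P \<omega>)\<^sup>2" by simp
            also note P_le[of \<omega>]
            finally show "norm ((P \<omega>)\<^sup>2) \<le> norm (C\<^sup>2 * (u - t) * ?h n * (\<Sum>j<Suc n. (?Y n j \<omega>)\<^sup>2))"
              unfolding real_norm_def using abs_ge_self by (rule order_trans)
          qed
        qed (use PM in measurable)
        have EP: "expectation (\<lambda>\<omega>. (P \<omega>)\<^sup>2) \<le> C\<^sup>2 * (u - t) * ?h n * (\<Sum>j<Suc n. f R (?g n j))"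
          unfolding sumint(2)[symmetric] using P_le P_sq sumint(1)
          by (subst integral_mult_right_zero[symmetric])
             (intro integral_mono integrable_mult_right; simp del: sum.lessThan_Suc)
        \<comment> \<open>On \<open>A R u\<close> the path is bounded by \<open>R\<close> up to time
          \<open>u\<close>, hence also up to every earlier grid point, and all the truncating
          indicators in \<open>P\<close> and \<open>Q\<close> equal 1. Off \<open>A R u\<close> the
          left side is 0.\<close>
        have le: "(\<iota> R u \<omega> * ?E n \<omega>)\<^sup>2 \<le> 2 * (P \<omega>)\<^sup>2 + 2 * (\<sigma>\<^sup>2 * (Q \<omega>)\<^sup>2)" for \<omega>
        proof (cases "\<omega> \<in> A R u")
          case True
          then have "\<omega> \<in> A R (?g n j)" if "j < Suc n" for j
            using gr(2)[OF that] by (auto simp: A_def)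
          then have "?E n \<omega> = P \<omega> + \<sigma> * Q \<omega>"
            unfolding P_def Q_def sum_distrib_left sum.distrib[symmetric]
            by (intro sum.cong refl) (simp add: \<iota>_def algebra_simps)
          moreover have "(P \<omega> + \<sigma> * Q \<omega>)\<^sup>2 \<le> 2 * (P \<omega>)\<^sup>2 + 2 * (\<sigma> * Q \<omega>)\<^sup>2"
            using zero_le_power2[of "P \<omega> - \<sigma> * Q \<omega>"] by (simp add: power2_eq_square algebra_simps)
          ultimately show ?thesis using True by (simp add: \<iota>_def power_mult_distrib del: sum.lessThan_Suc)
        qed (simp add: \<iota>_def)
        have EM: "?E n \<in> borel_measurable M"
          using euler u(3) by (auto simp: euler_limit_def conv_prob_def simp del: sum.lessThan_Suc)
        have big: "integrable M (\<lambda>\<omega>. 2 * (P \<omega>)\<^sup>2 + 2 * (\<sigma>\<^sup>2 * (Q \<omega>)\<^sup>2))"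
          using P_sq QL2 by (intro Bochner_Integration.integrable_add integrable_mult_right) auto
        show int: "integrable M (\<lambda>\<omega>. (\<iota> R u \<omega> * ?E n \<omega>)\<^sup>2)"
          using le EM A_M[OF Suc.prems]
          by (intro Bochner_Integration.integrable_bound[OF big])
             (auto intro!: AE_I2 order_trans[OF _ abs_ge_self] borel_measurable_power borel_measurable_times
                simp: \<iota>_def simp del: sum.lessThan_Suc)
        have "expectation (\<lambda>\<omega>. (\<iota> R u \<omega> * ?E n \<omega>)\<^sup>2) \<le> expectation (\<lambda>\<omega>. 2 * (P \<omega>)\<^sup>2 + 2 * (\<sigma>\<^sup>2 * (Q \<omega>)\<^sup>2))"
          using int big le by (intro integral_mono) auto
        also have "\<dots> = 2 * expectation (\<lambda>\<omega>. (P \<omega>)\<^sup>2) + 2 * (\<sigma>\<^sup>2 * expectation (\<lambda>\<omega>. (Q \<omega>)\<^sup>2))"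
          using P_sq QL2 by simp
        also have "\<dots> \<le> 2 * (C\<^sup>2 * (u - t) * ?h n * (\<Sum>j<Suc n. f R (?g n j)))
             + 2 * (\<sigma>\<^sup>2 * ((\<Sum>j<Suc n. f R (?g n j)) * ?h n))"
          unfolding EQ by (rule add_mono[OF mult_left_mono[OF EP] order_refl]) simp
        also have "\<dots> = 2 * (C\<^sup>2 * (u - t) + \<sigma>\<^sup>2) * ((\<Sum>j<Suc n. f R (?g n j)) * ?h n)"
          by (simp only: distrib_left distrib_right mult_ac)
        also have "\<dots> \<le> c / 2 * ((\<Sum>j<Suc n. f R (?g n j)) * ?h n)"
        proof (intro mult_right_mono mult_nonneg_nonneg sum_nonneg)
          show "2 * (C\<^sup>2 * (u - t) + \<sigma>\<^sup>2) \<le> c / 2"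
            unfolding c_def using u by (simp add: mult_left_mono)
        qed (use u in \<open>auto simp: f_def\<close>)
        also have "\<dots> \<le> c / 2 * (R\<^sup>2 * (c ^ k * ((u - t) ^ Suc k / real (Suc k)) / fact k))"
        proof (intro mult_left_mono)
          have "(\<Sum>j<Suc n. f R (?g n j)) * ?h n
             \<le> (\<Sum>j<Suc n. R\<^sup>2 * ((c * (?g n j - t)) ^ k / fact k)) * ?h n"
            using Suc.IH gr(1) u by (intro mult_right_mono sum_mono) auto
          also have "\<dots> = (R\<^sup>2 * c ^ k / fact k) * ((\<Sum>j<Suc n. ((u - t) * real j / real (Suc n)) ^ k) * ?h n)"
            by (simp add: sum_distrib_left sum_distrib_right gp_def power_mult_distrib power_divide mult_ac
                del: sum.lessThan_Suc of_nat_Suc)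
          also have "(\<Sum>j<Suc n. ((u - t) * real j / real (Suc n)) ^ k) * ?h n
              = (u - t) ^ Suc k / real (Suc n) ^ Suc k * (\<Sum>j<Suc n. real j ^ k)"
            by (simp add: sum_distrib_left sum_distrib_right sum_divide_distrib power_mult_distrib power_divide mult_ac
                del: sum.lessThan_Suc of_nat_Suc)
          also have "(R\<^sup>2 * c ^ k / fact k) * \<dots> \<le> (R\<^sup>2 * c ^ k / fact k) *
             ((u - t) ^ Suc k / real (Suc n) ^ Suc k * (real (Suc n) ^ Suc k / real (Suc k)))"
            using sum_power_le[of k "Suc n"] c0 u
            by (intro mult_left_mono) (auto simp: field_simps simp del: sum.lessThan_Suc of_nat_Suc power_Suc)
          also have "\<dots> = R\<^sup>2 * (c ^ k * ((u - t) ^ Suc k / real (Suc k)) / fact k)"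
            by (simp add: mult_ac del: of_nat_Suc power_Suc)
          finally show "(\<Sum>j<Suc n. f R (?g n j)) * ?h n
             \<le> R\<^sup>2 * (c ^ k * ((u - t) ^ Suc k / real (Suc k)) / fact k)" .
        qed (use c0 in simp)
        finally show "expectation (\<lambda>\<omega>. (\<iota> R u \<omega> * ?E n \<omega>)\<^sup>2) \<le> B" by (simp only: B_def)
      qed
      have "f R u \<le> 2 * B"
        unfolding f_def using bound[OF R Suc.prems]
        by (intro conv_prob_bounded_sq[OF conv[simplified] _ est[simplified]]) auto
      also have "2 * B = R\<^sup>2 * ((c * (u - t)) ^ Suc k / fact (Suc k))"
        by (simp add: B_def power_mult_distrib fact_Suc mult_ac del: of_nat_Suc)
      finally show ?thesis .
    qed
  qed
  have f0: "f R s = 0" if "R \<ge> 0" for R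
  proof (rule antisym)
    have "(\<lambda>k. R\<^sup>2 * ((c * (s - t)) ^ k / fact k)) \<longlonglongrightarrow> R\<^sup>2 * 0"
      using summable_LIMSEQ_zero[OF summable_exp[of "c * (s - t)"]]
      by (intro tendsto_mult_left) (simp add: field_simps)
    then show "f R s \<le> 0"
      using main[OF that s] by (intro LIMSEQ_le_const[where X = "\<lambda>k. R\<^sup>2 * ((c * (s - t)) ^ k / fact k)"]) auto
    show "0 \<le> f R s" by (simp add: f_def)
  qed
  have "AE \<omega> in M. (\<iota> R s \<omega> * Z s \<omega>)\<^sup>2 = 0" if "R \<ge> 0" for R
    using f0[OF that] integral_nonneg_eq_0_iff_AE[OF int_sq[OF that s]] by (simp add: f_def)
  \<comment> \<open>Integer levels suffice, because every continuous path is bounded on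
    \<open>[t, s]\<close>; countably many null sets can be united.\<close>
  then have "AE \<omega> in M. \<forall>n::nat. \<iota> (real n) s \<omega> * Z s \<omega> = 0"
    unfolding AE_all_countable by auto
  with AE_space show ?thesis
  proof eventually_elim
    case (elim \<omega>)
    have "compact ((\<lambda>v. Z v \<omega>) ` {t..s})"
      using continuous_on_subset[OF Z_cont[OF elim(1)], of "{t..s}"] s
      by (intro compact_continuous_image) auto
    from compact_imp_bounded[OF this] obtain b where "\<forall>v\<in>{t..s}. \<bar>Z v \<omega>\<bar> \<le> b"
      unfolding bounded_iff by auto
    moreover obtain n :: nat where "b \<le> real n" using real_arch_simple by blast
    ultimately have "\<omega> \<in> A (real n) s" using elim(1) by (auto simp: A_def intro: order_trans)
    then show ?case using elim(2) by (auto simp: \<iota>_def dest!: spec[of _ n])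
  qed
qed

section \<open>The explicit solution\<close>

definition gbm :: "real \<Rightarrow> real \<Rightarrow> real \<Rightarrow> 'a \<Rightarrow> real" where
  "gbm \<sigma> t s \<omega> = exp (\<sigma> * inc t s \<omega> - \<sigma>\<^sup>2 * (s - t) / 2)"

lemma gbm_refl [simp]: "gbm \<sigma> t t \<omega> = 1"
  by (simp add: gbm_def inc_def)

lemma gbm_mult: "gbm \<sigma> t u \<omega> * gbm \<sigma> u s \<omega> = gbm \<sigma> t s \<omega>"
  unfolding gbm_def exp_add[symmetric] inc_def
  by (rule arg_cong[where f = exp]) (simp add: field_simps)

lemma gbm_adapted: "0 \<le> t \<Longrightarrow> t \<le> s \<Longrightarrow> gbm \<sigma> t s \<in> borel_measurable (F s)"
  unfolding gbm_def[abs_def] using inc_adapted[of t s] by measurable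

lemma gbm_continuous: "0 \<le> t \<Longrightarrow> \<omega> \<in> space M \<Longrightarrow> continuous_on {t..} (\<lambda>s. gbm \<sigma> t s \<omega>)"
  unfolding gbm_def inc_def
  by (intro continuous_intros continuous_on_subset[OF W_continuous]) auto

lemma gbm_sq:
  assumes "0 \<le> t" "t \<le> s"
  shows "integrable M (\<lambda>\<omega>. (gbm \<sigma> t s \<omega>)\<^sup>2)" "expectation (\<lambda>\<omega>. (gbm \<sigma> t s \<omega>)\<^sup>2) = exp (\<sigma>\<^sup>2 * (s - t))"
proof -
  have sq: "(gbm \<sigma> t s \<omega>)\<^sup>2 = exp (- \<sigma>\<^sup>2 * (s - t)) * exp (2 * \<sigma> * inc t s \<omega>)" for \<omega>
    unfolding gbm_def power2_eq_square exp_add[symmetric]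
    by (rule arg_cong[where f = exp]) (simp add: field_simps)
  have "integrable M (\<lambda>\<omega>. (gbm \<sigma> t s \<omega>)\<^sup>2) \<and> expectation (\<lambda>\<omega>. (gbm \<sigma> t s \<omega>)\<^sup>2) = exp (\<sigma>\<^sup>2 * (s - t))"
  proof (cases "t = s")
    case False
    then have ts: "t < s" using assms by simp
    note em = inc_exp_moments(1,2)[OF assms(1) ts, of "2 * \<sigma>"]
    have c: "exp (- \<sigma>\<^sup>2 * (s - t)) * exp ((2 * \<sigma>)\<^sup>2 * (s - t) / 2) = exp (\<sigma>\<^sup>2 * (s - t))"
      unfolding exp_add[symmetric] by (rule arg_cong[where f = exp]) (simp add: field_simps)
    show ?thesis
      unfolding sq
      by (intro conjI integrable_mult_right em(1)) (simp only: integral_mult_right_zero em(2) c)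
  qed (simp add: prob_space)
  then show "integrable M (\<lambda>\<omega>. (gbm \<sigma> t s \<omega>)\<^sup>2)" "expectation (\<lambda>\<omega>. (gbm \<sigma> t s \<omega>)\<^sup>2) = exp (\<sigma>\<^sup>2 * (s - t))"
    by auto
qed

text \<open>The random error of one Euler step: \<open>\<rho>\<close> is the ratio of the
  deterministic factors at its two ends, the exponential is the exact growth and
  \<open>\<sigma> * z\<close> the Euler increment. With \<open>\<rho> - 1\<close> of the order of
  the step \<open>h = s - u\<close>, the second moment is of order \<open>h\<^sup>2\<close>, small
  enough to be summed over the grid.\<close>

lemma gbm_residual:
  fixes \<rho> \<sigma> u s :: real
  defines "k \<equiv> \<lambda>z. \<rho> * (exp (\<sigma> * z - \<sigma>\<^sup>2 * (s - u) / 2) - 1) - \<sigma> * z"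
  assumes "0 \<le> u" "u < s"
  shows "expectation (\<lambda>\<omega>. k (inc u s \<omega>)) = 0" "integrable M (\<lambda>\<omega>. (k (inc u s \<omega>))\<^sup>2)"
    "expectation (\<lambda>\<omega>. (k (inc u s \<omega>))\<^sup>2)
       = \<rho>\<^sup>2 * (exp (\<sigma>\<^sup>2 * (s - u)) - 1 - \<sigma>\<^sup>2 * (s - u)) + \<sigma>\<^sup>2 * (s - u) * (\<rho> - 1)\<^sup>2"
proof -
  let ?i = "inc u s" and ?c = "exp (- \<sigma>\<^sup>2 * (s - u) / 2)"
  have e: "gbm \<sigma> u s \<omega> = ?c * exp (\<sigma> * ?i \<omega>)" for \<omega>
    unfolding gbm_def exp_add[symmetric] by (rule arg_cong[where f = exp]) simp
  have c: "?c * exp (\<sigma>\<^sup>2 * (s - u) / 2) = 1" by (simp add: exp_add[symmetric])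
  note m = inc_moments[OF assms(2,3)] and em = inc_exp_moments[OF assms(2,3), of \<sigma>]
    and sq = gbm_sq[OF assms(2) less_imp_le[OF assms(3)], of \<sigma>]
  have g1: "integrable M (gbm \<sigma> u s)" "expectation (gbm \<sigma> u s) = 1"
    unfolding e[abs_def]
    by (intro integrable_mult_right em) (simp only: integral_mult_right_zero em c)
  have g2: "integrable M (\<lambda>\<omega>. gbm \<sigma> u s \<omega> * ?i \<omega>)" "expectation (\<lambda>\<omega>. gbm \<sigma> u s \<omega> * ?i \<omega>) = \<sigma> * (s - u)"
    unfolding e mult.assoc
    by (intro integrable_mult_right em)
      (simp only: integral_mult_right_zero em, simp only: mult.assoc[symmetric] c mult_1)
  have k1: "k (?i \<omega>) = \<rho> * (gbm \<sigma> u s \<omega> - 1) - \<sigma> * ?i \<omega>" for \<omega>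
    by (simp add: k_def gbm_def)
  have k2: "(k (?i \<omega>))\<^sup>2 = \<rho>\<^sup>2 * ((gbm \<sigma> u s \<omega>)\<^sup>2 - 2 * gbm \<sigma> u s \<omega> + 1)
       - 2 * \<rho> * \<sigma> * (gbm \<sigma> u s \<omega> * ?i \<omega> - ?i \<omega>) + \<sigma>\<^sup>2 * (?i \<omega>)\<^sup>2" for \<omega>
    unfolding k1 by (simp add: power2_eq_square algebra_simps)
  show "expectation (\<lambda>\<omega>. k (?i \<omega>)) = 0"
    unfolding k1 using g1 m by (simp add: prob_space)
  show "integrable M (\<lambda>\<omega>. (k (?i \<omega>))\<^sup>2)"
    unfolding k2 using g1 g2 m sq by simp
  show "expectation (\<lambda>\<omega>. (k (?i \<omega>))\<^sup>2)
       = \<rho>\<^sup>2 * (exp (\<sigma>\<^sup>2 * (s - u)) - 1 - \<sigma>\<^sup>2 * (s - u)) + \<sigma>\<^sup>2 * (s - u) * (\<rho> - 1)\<^sup>2"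
    unfolding k2 using g1 g2 m sq by (simp add: prob_space) (simp add: power2_eq_square algebra_simps)
qed

lemma euler_limit_cong:
  assumes "\<And>u. u \<in> {t..S} \<Longrightarrow> \<mu> u = \<mu>' u" "euler_limit t S \<mu> \<sigma> x Z"
  shows "euler_limit t S \<mu>' \<sigma> x Z"
  unfolding euler_limit_def
proof
  fix s assume s: "s \<in> {t<..S}"
  have "\<mu> (gp t s (Suc n) j) = \<mu>' (gp t s (Suc n) j)" if "j < Suc n" for n j
    using gp_ge[of t s "Suc n" j] gp_le[of t s j "Suc n"] s that by (intro assms(1)) auto
  then have eq: "(\<Sum>j<Suc n. Z (gp t s (Suc n) j) \<omega> * (\<mu>' (gp t s (Suc n) j) * ((s - t) / real (Suc n))
         + \<sigma> * inc (gp t s (Suc n) j) (gp t s (Suc n) (Suc j)) \<omega>))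
      = (\<Sum>j<Suc n. Z (gp t s (Suc n) j) \<omega> * (\<mu> (gp t s (Suc n) j) * ((s - t) / real (Suc n))
         + \<sigma> * inc (gp t s (Suc n) j) (gp t s (Suc n) (Suc j)) \<omega>))" for n \<omega>
    by (intro sum.cong) auto
  show "conv_prob M (\<lambda>n \<omega>. \<Sum>j<Suc n. Z (gp t s (Suc n) j) \<omega> *
        (\<mu>' (gp t s (Suc n) j) * ((s - t) / real (Suc n))
         + \<sigma> * inc (gp t s (Suc n) j) (gp t s (Suc n) (Suc j)) \<omega>)) (\<lambda>\<omega>. Z s \<omega> - x)"
    unfolding eq using assms(2) s unfolding euler_limit_def by blast
qed

lemma conv_prob_const: "f \<in> borel_measurable M \<Longrightarrow> conv_prob M (\<lambda>_. f) f"
  by (intro conv_prob_AE) auto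

text \<open>Each exact increment is the Euler increment plus a centred error \<open>k\<close> and a
  deterministic error \<open>\<epsilon>\<close>, both multiplied by the current value. The centred
  errors are orthogonal and vanish in the mean square by \<open>gbm_residual\<close>. The
  deterministic ones vanish pathwise, by the mean value theorem and uniform continuity of
  \<open>G'\<close>. The exact increments telescope.\<close>

lemma explicit_euler:
  assumes t: "0 \<le> t" and \<sigma>: "\<sigma> > 0"
    and G: "\<And>s. s \<in> {t..S} \<Longrightarrow> G s > 0"
    and G': "\<And>s. s \<in> {t..S} \<Longrightarrow> (G has_real_derivative G' s) (at s)"
    and G'_cont: "continuous_on {t..S} G'"
  shows "euler_limit t S (\<lambda>s. G' s / G s) \<sigma> (x * G t) (\<lambda>s \<omega>. x * G s * gbm \<sigma> t s \<omega>)"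
  unfolding euler_limit_def
proof
  fix s assume "s \<in> {t<..S}"
  then have s: "t < s" "s \<le> S" by auto
  have G_cont: "continuous_on {t..S} G"
    using DERIV_continuous_on[of "{t..S}" G G'] G' has_field_derivative_at_within by blast
  obtain m where m: "m > 0" "\<And>u. u \<in> {t..S} \<Longrightarrow> m \<le> G u"
  proof -
    obtain z where "z \<in> {t..S}" "\<forall>u\<in>{t..S}. G z \<le> G u"
      using continuous_attains_inf[OF _ _ G_cont] s by auto
    then show ?thesis using that[of "G z"] G by blast
  qed
  obtain P where P: "\<And>u. u \<in> {t..S} \<Longrightarrow> G u \<le> P"
    using continuous_attains_sup[OF _ _ G_cont] s by (auto simp: Ball_def)
  obtain L where L: "\<And>u. u \<in> {t..S} \<Longrightarrow> \<bar>G' u\<bar> \<le> L"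
    using continuous_attains_sup[OF _ _ continuous_on_rabs[OF G'_cont]] s by (auto simp: Ball_def)
  have P0: "P > 0" using P[of t] G[of t] s by auto
  have L0: "L \<ge> 0" using L[of t] s by auto
  define Y where "Y u \<omega> = x * G u * gbm \<sigma> t u \<omega>" for u \<omega>
  define h where "h n = (s - t) / real (Suc n)" for n
  define g where "g n = gp t s (Suc n)" for n
  have h: "h n > 0" "real (Suc n) * h n = s - t" for n using s by (auto simp: h_def)
  have g: "g n 0 = t" "g n (Suc n) = s" "g n j < g n (Suc j)" "g n (Suc j) - g n j = h n" for n j
    unfolding g_def h_def using gp_less[OF s(1)] by (auto simp: gp_diff)
  have g_in: "g n j \<in> {t..S}" if "j \<le> Suc n" for n j
    using gp_ge[of t s "Suc n" j] gp_le[of t s j "Suc n"] s that by (auto simp: g_def)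
  have g_nn: "0 \<le> g n j" for n j
    using gp_ge[of t s "Suc n" j] s t by (simp add: g_def)
  have sub: "{g n j..g n (Suc j)} \<subseteq> {t..S}" if "j < Suc n" for n j
    using g_in[of j n] g_in[of "Suc j" n] that by auto
  have mv: "\<exists>\<xi>\<in>{g n j..g n (Suc j)}. G (g n (Suc j)) - G (g n j) = h n * G' \<xi>" if j: "j < Suc n" for n j
  proof -
    obtain z where "g n j < z" "z < g n (Suc j)" "G (g n (Suc j)) - G (g n j) = (g n (Suc j) - g n j) * G' z"
      using MVT2[OF g(3)[of n j], of G G'] G' sub[OF j] by auto
    then show ?thesis using g(4) by (intro bexI[of _ z]) auto
  qed
  define \<rho> where "\<rho> n j = G (g n (Suc j)) / G (g n j)" for n j
  define \<epsilon> where "\<epsilon> n j = \<rho> n j - 1 - G' (g n j) / G (g n j) * h n" for n j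
  define k where "k n j z = \<rho> n j * (exp (\<sigma> * z - \<sigma>\<^sup>2 * (g n (Suc j) - g n j) / 2) - 1) - \<sigma> * z" for n j z
  define T1 where "T1 n \<omega> = (\<Sum>j<Suc n. Y (g n j) \<omega> * k n j (inc (g n j) (g n (Suc j)) \<omega>))" for n \<omega>
  define T2 where "T2 n \<omega> = (\<Sum>j<Suc n. Y (g n j) \<omega> * \<epsilon> n j)" for n \<omega>
  have Y_F: "Y u \<in> borel_measurable (F u)" if "u \<in> {t..S}" for u
    unfolding Y_def[abs_def] using gbm_adapted[of t u \<sigma>] that t by simp
  have [measurable]: "Y u \<in> borel_measurable M" if "u \<in> {t..S}" for u
    using measurable_F_M[OF Y_F[OF that]] that t by simp
  have Y_sq: "integrable M (\<lambda>\<omega>. (Y u \<omega>)\<^sup>2)"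
    "expectation (\<lambda>\<omega>. (Y u \<omega>)\<^sup>2) \<le> x\<^sup>2 * P\<^sup>2 * exp (\<sigma>\<^sup>2 * (S - t))" if u: "u \<in> {t..S}" for u
  proof -
    have sq: "(Y u \<omega>)\<^sup>2 = x\<^sup>2 * (G u)\<^sup>2 * (gbm \<sigma> t u \<omega>)\<^sup>2" for \<omega>
      by (simp add: Y_def power_mult_distrib)
    show "integrable M (\<lambda>\<omega>. (Y u \<omega>)\<^sup>2)" unfolding sq using gbm_sq[of t u \<sigma>] u t by simp
    have "expectation (\<lambda>\<omega>. (Y u \<omega>)\<^sup>2) = x\<^sup>2 * (G u)\<^sup>2 * exp (\<sigma>\<^sup>2 * (u - t))"
      unfolding sq using gbm_sq[of t u \<sigma>] u t by simp
    also have "\<dots> \<le> x\<^sup>2 * P\<^sup>2 * exp (\<sigma>\<^sup>2 * (S - t))"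
    proof (intro mult_mono)
      show "(G u)\<^sup>2 \<le> P\<^sup>2" using P[OF u] G[OF u] by (intro power_mono) auto
      show "exp (\<sigma>\<^sup>2 * (u - t)) \<le> exp (\<sigma>\<^sup>2 * (S - t))" using u by (simp add: mult_left_mono)
    qed auto
    finally show "expectation (\<lambda>\<omega>. (Y u \<omega>)\<^sup>2) \<le> x\<^sup>2 * P\<^sup>2 * exp (\<sigma>\<^sup>2 * (S - t))" .
  qed
  have k_meas: "k n j \<in> borel_measurable borel" for n j
    unfolding k_def[abs_def] by measurable
  have k_mom: "expectation (\<lambda>\<omega>. k n j (inc (g n j) (g n (Suc j)) \<omega>)) = 0"
    "integrable M (\<lambda>\<omega>. (k n j (inc (g n j) (g n (Suc j)) \<omega>))\<^sup>2)"
    "expectation (\<lambda>\<omega>. (k n j (inc (g n j) (g n (Suc j)) \<omega>))\<^sup>2)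
       = (\<rho> n j)\<^sup>2 * (exp (\<sigma>\<^sup>2 * h n) - 1 - \<sigma>\<^sup>2 * h n) + \<sigma>\<^sup>2 * h n * (\<rho> n j - 1)\<^sup>2"
    if "j < Suc n" for n j
    using gbm_residual[of "g n j" "g n (Suc j)" "\<rho> n j" \<sigma>] g_in[of j n] g(3)[of n j] that t
    unfolding k_def by (auto simp: g(4))
  have \<rho>_bd: "(\<rho> n j)\<^sup>2 \<le> (P / m)\<^sup>2" "(\<rho> n j - 1)\<^sup>2 \<le> (L / m * h n)\<^sup>2" if j: "j < Suc n" for n j
  proof -
    have in2: "g n j \<in> {t..S}" "g n (Suc j) \<in> {t..S}" using g_in j by auto
    have "\<rho> n j \<le> P / m" "\<rho> n j \<ge> 0"
      unfolding \<rho>_def using P[OF in2(2)] m(2)[OF in2(1)] m(1) G[OF in2(1)] G[OF in2(2)] P0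
      by (auto intro!: frac_le divide_nonneg_nonneg)
    then show "(\<rho> n j)\<^sup>2 \<le> (P / m)\<^sup>2" by (intro power_mono) auto
    obtain \<xi> where \<xi>: "\<xi> \<in> {g n j..g n (Suc j)}" "G (g n (Suc j)) - G (g n j) = h n * G' \<xi>"
      using mv[OF j] by blast
    have "\<rho> n j - 1 = h n * G' \<xi> / G (g n j)"
      using \<xi>(2) G[OF in2(1)] by (simp add: \<rho>_def field_simps)
    then have "\<bar>\<rho> n j - 1\<bar> = h n * \<bar>G' \<xi>\<bar> / G (g n j)"
      using h(1)[of n] G[OF in2(1)] by (simp add: abs_mult)
    also have "\<dots> \<le> h n * L / m"
      using L[of \<xi>] sub[OF j] \<xi>(1) h(1)[of n] m L0 in2 by (intro frac_le mult_mono) auto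
    finally have "\<bar>\<rho> n j - 1\<bar> \<le> \<bar>L / m * h n\<bar>"
      using h(1)[of n] L0 m(1) by (simp add: mult.commute)
    then show "(\<rho> n j - 1)\<^sup>2 \<le> (L / m * h n)\<^sup>2" by (simp only: abs_le_square_iff)
  qed
  have T1: "conv_prob M T1 (\<lambda>_. 0)"
  proof (rule conv_prob_L2)
    have mt: "integrable M (\<lambda>\<omega>. (T1 n \<omega>)\<^sup>2) \<and> expectation (\<lambda>\<omega>. (T1 n \<omega>)\<^sup>2)
       = (\<Sum>j<Suc n. expectation (\<lambda>\<omega>. (Y (g n j) \<omega>)\<^sup>2) * expectation (\<lambda>\<omega>. (k n j (inc (g n j) (g n (Suc j)) \<omega>))\<^sup>2))" for n
      unfolding T1_def
      by (rule martingale_transform_L2) (use g(3) g_nn g_in Y_F Y_sq(1) k_meas k_mom(1,2) in auto)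
    then show "integrable M (\<lambda>\<omega>. (T1 n \<omega>)\<^sup>2)" for n by blast
    show "T1 n \<in> borel_measurable M" for n
      unfolding T1_def[abs_def] using g_in g_nn less_imp_le[OF g(3)]
      by (intro borel_measurable_sum borel_measurable_times measurable_compose[OF inc_measurable k_meas]) auto
    let ?V = "\<lambda>n. (P / m)\<^sup>2 * (exp (\<sigma>\<^sup>2 * h n) - 1 - \<sigma>\<^sup>2 * h n) + \<sigma>\<^sup>2 * h n * (L / m * h n)\<^sup>2"
    let ?C = "x\<^sup>2 * P\<^sup>2 * exp (\<sigma>\<^sup>2 * (S - t))"
    have V0: "?V n \<ge> 0" for n
      using exp_ge_add_one_self[of "\<sigma>\<^sup>2 * h n"] h(1)[of n]
      by (intro add_nonneg_nonneg mult_nonneg_nonneg) (auto simp: algebra_simps)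
    have "expectation (\<lambda>\<omega>. (T1 n \<omega>)\<^sup>2) \<le> (\<Sum>j<Suc n. ?C * ?V n)" for n
      unfolding mt[THEN conjunct2]
    proof (rule sum_mono, rule mult_mono)
      fix j assume "j \<in> {..<Suc n}"
      then have j: "j < Suc n" by simp
      show "expectation (\<lambda>\<omega>. (Y (g n j) \<omega>)\<^sup>2) \<le> ?C" using Y_sq(2) g_in j by simp
      show "expectation (\<lambda>\<omega>. (k n j (inc (g n j) (g n (Suc j)) \<omega>))\<^sup>2) \<le> ?V n"
        unfolding k_mom(3)[OF j]
        using \<rho>_bd[OF j] exp_ge_add_one_self[of "\<sigma>\<^sup>2 * h n"] h(1)[of n]
        by (intro add_mono mult_right_mono mult_left_mono) (auto simp: algebra_simps)
    qed auto
    then have le: "expectation (\<lambda>\<omega>. (T1 n \<omega>)\<^sup>2) \<le> ?C * (real (Suc n) * ?V n)" for n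
      unfolding sum_constant card_lessThan mult.left_commute[of ?C "real (Suc n)"] .
    define d where "d = s - t"
    have "d > 0" using s by (simp add: d_def)
    define a where "a = \<sigma>\<^sup>2 * d"
    have "a > 0" using \<open>d > 0\<close> \<sigma> by (simp add: a_def)
    have "(\<lambda>n. real (Suc n) * (exp (a / real (Suc n)) - 1 - a / real (Suc n))) \<longlonglongrightarrow> 0"
      using \<open>a > 0\<close> by real_asymp
    moreover have "(\<lambda>n. real (Suc n) * (d / real (Suc n)) ^ 3) \<longlonglongrightarrow> 0"
      using \<open>d > 0\<close> by real_asymp
    ultimately have "(\<lambda>n. (P / m)\<^sup>2 * (real (Suc n) * (exp (a / real (Suc n)) - 1 - a / real (Suc n)))
        + \<sigma>\<^sup>2 * (L / m)\<^sup>2 * (real (Suc n) * (d / real (Suc n)) ^ 3)) \<longlonglongrightarrow> (P / m)\<^sup>2 * 0 + \<sigma>\<^sup>2 * (L / m)\<^sup>2 * 0"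
      by (intro tendsto_intros)
    then have "(\<lambda>n. real (Suc n) * ((P / m)\<^sup>2 * (exp (\<sigma>\<^sup>2 * (d / real (Suc n))) - 1 - \<sigma>\<^sup>2 * (d / real (Suc n)))
        + \<sigma>\<^sup>2 * (d / real (Suc n)) * (L / m * (d / real (Suc n)))\<^sup>2)) \<longlonglongrightarrow> 0"
      by (simp add: a_def power2_eq_square power3_eq_cube algebra_simps del: of_nat_Suc)
    then have "(\<lambda>n. ?C * (real (Suc n) * ?V n)) \<longlonglongrightarrow> ?C * 0"
      unfolding d_def h_def by (intro tendsto_intros)
    then have lim: "(\<lambda>n. ?C * (real (Suc n) * ?V n)) \<longlonglongrightarrow> 0"
      by (simp only: mult_zero_right)
    show "(\<lambda>n. expectation (\<lambda>\<omega>. (T1 n \<omega>)\<^sup>2)) \<longlonglongrightarrow> 0"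
    proof (rule tendsto_sandwich[OF _ _ tendsto_const lim])
      show "\<forall>\<^sub>F n in sequentially. expectation (\<lambda>\<omega>. (T1 n \<omega>)\<^sup>2) \<le> ?C * (real (Suc n) * ?V n)"
        by (rule always_eventually, rule allI, rule le)
    qed simp
  qed
  have T2: "conv_prob M T2 (\<lambda>_. 0)"
  proof (rule conv_prob_AE)
    show "T2 n \<in> borel_measurable M" for n
      unfolding T2_def[abs_def] using g_in by (intro borel_measurable_sum borel_measurable_times) auto
    show "AE \<omega> in M. (\<lambda>n. T2 n \<omega>) \<longlonglongrightarrow> 0"
    proof (rule AE_I2)
      fix \<omega> assume \<omega>: "\<omega> \<in> space M"
      have "continuous_on {t..S} (\<lambda>u. \<bar>Y u \<omega>\<bar>)"
        unfolding Y_def using G_cont continuous_on_subset[OF gbm_continuous[OF t \<omega>]]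
        by (intro continuous_intros) auto
      then obtain b where b: "\<And>u. u \<in> {t..S} \<Longrightarrow> \<bar>Y u \<omega>\<bar> \<le> b"
        using continuous_attains_sup[of "{t..S}" "\<lambda>u. \<bar>Y u \<omega>\<bar>"] s by (auto simp: Ball_def)
      have b0: "b \<ge> 0" using b[of t] s by auto
      show "(\<lambda>n. T2 n \<omega>) \<longlonglongrightarrow> 0"
      proof (rule tendstoI)
        fix e :: real assume e: "e > 0"
        \<comment> \<open>The denominator contains \<open>b + 1\<close> because the bound
          \<open>b\<close> of the path may be 0.\<close>
        define e' where "e' = e * m / ((b + 1) * (s - t))"
        have e': "e' > 0" using e m b0 s by (simp add: e'_def)
        have "b + 1 \<noteq> 0" "s - t \<noteq> 0" "m \<noteq> 0" using b0 s m by auto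
        then have "(b + 1) * (e' / m * (s - t)) = e" by (simp add: e'_def)
        then have e'': "b * (e' / m * (s - t)) < e"
        proof -
          assume *: "(b + 1) * (e' / m * (s - t)) = e"
          have "e' / m * (s - t) > 0" using e' m s by simp
          then have "b * (e' / m * (s - t)) < (b + 1) * (e' / m * (s - t))"
            by (intro mult_strict_right_mono) auto
          with * show ?thesis by simp
        qed
        have "continuous_on {t..s} G'" using continuous_on_subset[OF G'_cont] s by auto
        from grid_uniform[OF s(1) this e']
        show "\<forall>\<^sub>F n in sequentially. dist (T2 n \<omega>) 0 < e"
        proof eventually_elim
          case (elim n)
          have "\<bar>\<epsilon> n j\<bar> \<le> e' / m * h n" if j: "j < Suc n" for j
          proof -
            have in2: "g n j \<in> {t..S}" using g_in j by auto
            obtain \<xi> where \<xi>: "\<xi> \<in> {g n j..g n (Suc j)}" "G (g n (Suc j)) - G (g n j) = h n * G' \<xi>"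
              using mv[OF j] by blast
            have "\<epsilon> n j = h n * (G' \<xi> - G' (g n j)) / G (g n j)"
              using \<xi>(2) G[OF in2] by (simp add: \<epsilon>_def \<rho>_def field_simps)
            then have "\<bar>\<epsilon> n j\<bar> = h n * \<bar>G' \<xi> - G' (g n j)\<bar> / G (g n j)"
              using h(1)[of n] G[OF in2] by (simp add: abs_mult)
            also have "\<dots> \<le> h n * e' / m"
              using elim j \<xi>(1) h(1)[of n] m(1) m(2)[OF in2] e'
              by (intro frac_le mult_mono) (auto simp: g_def less_imp_le)
            finally show ?thesis by (simp add: mult.commute)
          qed
          then have "\<bar>T2 n \<omega>\<bar> \<le> (\<Sum>j<Suc n. b * (e' / m * h n))"
            unfolding T2_def using b g_in b0
            by (intro order_trans[OF sum_abs] sum_mono) (unfold abs_mult, intro mult_mono, auto)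
          also have "\<dots> = b * (e' / m * (real (Suc n) * h n))"
            by (simp add: mult_ac del: of_nat_Suc)
          finally show ?case using e'' h(2)[of n] by simp
        qed
      qed
    qed
  qed auto
  have id: "(\<Sum>j<Suc n. Y (g n j) \<omega> * (G' (g n j) / G (g n j) * h n + \<sigma> * inc (g n j) (g n (Suc j)) \<omega>))
      = (Y s \<omega> - x * G t) + (- 1 * T1 n \<omega> + - 1 * T2 n \<omega>)" for n \<omega>
  proof -
    have "Y (g n j) \<omega> * (G' (g n j) / G (g n j) * h n + \<sigma> * inc (g n j) (g n (Suc j)) \<omega>)
      = (Y (g n (Suc j)) \<omega> - Y (g n j) \<omega>) - Y (g n j) \<omega> * k n j (inc (g n j) (g n (Suc j)) \<omega>) - Y (g n j) \<omega> * \<epsilon> n j"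
      if j: "j < Suc n" for j
    proof -
      have "Y (g n (Suc j)) \<omega> = Y (g n j) \<omega> * \<rho> n j * gbm \<sigma> (g n j) (g n (Suc j)) \<omega>"
        using G[OF g_in, of j n] j gbm_mult[of \<sigma> t "g n j" \<omega> "g n (Suc j)"]
        by (simp add: Y_def \<rho>_def)
      then show ?thesis
        unfolding k_def \<epsilon>_def gbm_def by (simp add: algebra_simps)
    qed
    then have "(\<Sum>j<Suc n. Y (g n j) \<omega> * (G' (g n j) / G (g n j) * h n + \<sigma> * inc (g n j) (g n (Suc j)) \<omega>))
      = (\<Sum>j<Suc n. Y (g n (Suc j)) \<omega> - Y (g n j) \<omega>) - T1 n \<omega> - T2 n \<omega>"
      unfolding T1_def T2_def sum_subtractf[symmetric] by (intro sum.cong) auto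
    also have "(\<Sum>j<Suc n. Y (g n (Suc j)) \<omega> - Y (g n j) \<omega>) = Y s \<omega> - Y t \<omega>"
      using sum_lessThan_telescope[of "\<lambda>j. Y (g n j) \<omega>" "Suc n"] g(1,2)[of n] by simp
    finally show ?thesis by (simp add: Y_def)
  qed
  have "conv_prob M (\<lambda>n \<omega>. (Y s \<omega> - x * G t) + (- 1 * T1 n \<omega> + - 1 * T2 n \<omega>))
     (\<lambda>\<omega>. (Y s \<omega> - x * G t) + (- 1 * 0 + - 1 * 0))"
    using s by (intro conv_prob_add conv_prob_cmult T1 T2 conv_prob_const) auto
  then show "conv_prob M (\<lambda>n \<omega>. \<Sum>j<Suc n. x * G (gp t s (Suc n) j) * gbm \<sigma> t (gp t s (Suc n) j) \<omega> *
       (G' (gp t s (Suc n) j) / G (gp t s (Suc n) j) * ((s - t) / real (Suc n)) +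
        \<sigma> * inc (gp t s (Suc n) j) (gp t s (Suc n) (Suc j)) \<omega>))
     (\<lambda>\<omega>. x * G s * gbm \<sigma> t s \<omega> - x * G t)"
    unfolding id[symmetric] by (simp add: Y_def g_def h_def del: sum.lessThan_Suc)
qed

text \<open>The given solution and the exponential satisfy the same linear Euler condition, so their
  difference is an Euler limit started at 0 and vanishes by
  \<open>euler_limit_unique\<close>.\<close>

lemma sde_explicit:
  assumes t: "0 \<le> t" "S \<le> T" and \<sigma>: "\<sigma> > 0"
    and G: "\<And>s. s \<in> {t..S} \<Longrightarrow> G s > 0"
    and G': "\<And>s. s \<in> {t..S} \<Longrightarrow> (G has_real_derivative G' s) (at s)"
    and G'_cont: "continuous_on {t..S} G'"
    and \<mu>: "\<And>s. s \<in> {t..S} \<Longrightarrow> \<mu> s = G' s / G s"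
    and sde: "sde_solution M F W (\<lambda>s y. \<mu> s * y) (\<lambda>s y. \<sigma> * y) t T x X"
    and s: "s \<in> {t..S}"
  shows "AE \<omega> in M. X s \<omega> = x / G t * G s * gbm \<sigma> t s \<omega>"
proof -
  let ?Y = "\<lambda>s \<omega>. x / G t * G s * gbm \<sigma> t s \<omega>"
  have tS: "t \<in> {t..S}" using s by simp
  have G_cont: "continuous_on {t..S} G"
    using DERIV_continuous_on[of "{t..S}" G G'] G' has_field_derivative_at_within by blast
  have q_cont: "continuous_on {t..S} (\<lambda>s. G' s / G s)"
    using G by (intro continuous_on_divide G'_cont G_cont) force
  have \<mu>_cont: "continuous_on {t..S} \<mu>"
    using q_cont by (subst continuous_on_cong[OF refl \<mu>]) auto
  obtain C where C: "\<And>u. u \<in> {t..S} \<Longrightarrow> \<bar>\<mu> u\<bar> \<le> C"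
    using continuous_attains_sup[OF _ _ continuous_on_rabs[OF \<mu>_cont]] s by (auto simp: Ball_def)
  have "euler_limit t S (\<lambda>s. G' s / G s) \<sigma> (x / G t * G t) ?Y"
    by (rule explicit_euler[OF t(1) \<sigma> G G' G'_cont])
  then have "euler_limit t S \<mu> \<sigma> x ?Y"
    using euler_limit_cong[of t S "\<lambda>s. G' s / G s" \<mu>] \<mu> G[OF tS] by simp
  with sde_euler[OF t sde \<mu>_cont]
  have e: "euler_limit t S \<mu> \<sigma> 0 (\<lambda>s \<omega>. X s \<omega> - ?Y s \<omega>)"
    by (rule euler_limit_diff)
  have "AE \<omega> in M. X s \<omega> - ?Y s \<omega> = 0"
  proof (rule euler_limit_unique[OF t(1) _ _ C e _ s])
    show "(\<lambda>\<omega>. X s \<omega> - ?Y s \<omega>) \<in> borel_measurable (F s)" if "s \<in> {t..S}" for s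
      using sde that t gbm_adapted[of t s \<sigma>]
      by (intro borel_measurable_diff borel_measurable_times) (auto simp: sde_solution_def)
    show "continuous_on {t..S} (\<lambda>s. X s \<omega> - ?Y s \<omega>)" if "\<omega> \<in> space M" for \<omega>
    proof -
      have "continuous_on {t..T} (\<lambda>s. X s \<omega>)" using sde that by (simp add: sde_solution_def)
      then show ?thesis
        using t continuous_on_subset[OF gbm_continuous[OF t(1) that, of \<sigma>], of "{t..S}"]
        by (intro continuous_intros G_cont) (auto elim: continuous_on_subset)
    qed
    show "AE \<omega> in M. X t \<omega> - ?Y t \<omega> = 0"
      using sde G[OF tS] by (auto simp: sde_solution_def)
  qed
  then show ?thesis by simp
qed

end

section \<open>The early exercise premium\<close>

lemma normal_tail_integral:
  assumes "s > 0"
  shows "integrable lborel (\<lambda>z. normal_density \<mu> s z * indicator {..<c} z)"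
    "(\<integral>z. normal_density \<mu> s z * indicator {..<c} z \<partial>lborel) = Phi ((c - \<mu>) / s)"
proof -
  show "integrable lborel (\<lambda>z. normal_density \<mu> s z * indicator {..<c} z)"
    using integrable_normal_density[OF assms, of \<mu>] by (intro integrable_real_mult_indicator) auto
  have "(\<integral>z. normal_density \<mu> s z * indicator {..<c} z \<partial>lborel)
      = \<bar>s\<bar> *\<^sub>R (\<integral>z. normal_density \<mu> s (\<mu> + s * z) * indicator {..<c} (\<mu> + s * z) \<partial>lborel)"
    by (rule lborel_integral_real_affine) (use assms in simp)
  also have "\<dots> = (\<integral>z. s * (normal_density \<mu> s (\<mu> + s * z) * indicator {..<c} (\<mu> + s * z)) \<partial>lborel)"
    using assms by simp
  also have "\<dots> = (\<integral>z. indicator {..(c - \<mu>) / s} z *\<^sub>R phi z \<partial>lborel)"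
  proof (rule integral_cong_AE)
    show "AE z in lborel. s * (normal_density \<mu> s (\<mu> + s * z) * indicator {..<c} (\<mu> + s * z))
        = indicator {..(c - \<mu>) / s} z *\<^sub>R phi z"
      using AE_lborel_singleton[of "(c - \<mu>) / s"]
    proof eventually_elim
      case (elim z)
      have "s * normal_density \<mu> s (\<mu> + s * z) = phi z"
        using assms by (simp add: normal_density_def power_mult_distrib real_sqrt_mult)
      moreover have "\<mu> + s * z < c \<longleftrightarrow> z < (c - \<mu>) / s"
        using assms by (simp add: field_simps)
      ultimately show ?case using elim by (auto simp: indicator_def)
    qed
  qed simp_all
  also have "\<dots> = Phi ((c - \<mu>) / s)"
    by (simp add: Phi_eq_integral set_lebesgue_integral_def)
  finally show "(\<integral>z. normal_density \<mu> s z * indicator {..<c} z \<partial>lborel) = Phi ((c - \<mu>) / s)" .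
qed

text \<open>The integrand lives on \<open>z < \<sigma> * h - y\<close>. In its exponential part the
  tilt moves the mean of the increment to \<open>\<sigma> * h\<close>, which cancels the drift in
  the argument of \<open>Phi\<close>. The case \<open>p = r\<close>, \<open>q = D (T - u)\<close>
  gives the loss rate, the case \<open>p = q = 1\<close> the payoff at maturity; the sign of
  \<open>L\<close> and \<open>Euro\<close> follows from that of the integrand.\<close>

lemma truncated_put_integral:
  assumes "h > 0" and pos: "\<And>y. y < 0 \<Longrightarrow> q * exp (\<sigma> * y) \<le> p"
  defines "\<psi> \<equiv> \<lambda>y. if y < 0 then p - q * exp (\<sigma> * y) else (0::real)"
    and "I \<equiv> \<lambda>y. p * Phi ((\<sigma> * h - y) / sqrt h) - q * (exp (\<sigma> * y - \<sigma>\<^sup>2 * h / 2) * Phi (- y / sqrt h))"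
  shows "(\<integral>\<^sup>+z. ennreal (\<psi> (y + z - \<sigma> * h)) * ennreal (normal_density 0 (sqrt h) z) \<partial>lborel) = ennreal (I y)"
    "I y \<ge> 0"
proof -
  let ?n = "normal_density 0 (sqrt h)"
  let ?c = "\<sigma> * h - y"
  have sh: "sqrt h > 0" "(sqrt h)\<^sup>2 = h" using assms(1) by auto
  note i1 = normal_tail_integral[OF sh(1), of 0 ?c] and i2 = normal_tail_integral[OF sh(1), of "\<sigma> * h" ?c]
  have eq: "\<psi> (y + z - \<sigma> * h) * ?n z = p * (?n z * indicator {..<?c} z)
      - q * exp (\<sigma> * y - \<sigma>\<^sup>2 * h / 2) * (normal_density (\<sigma> * h) (sqrt h) z * indicator {..<?c} z)" for z
  proof -
    have "exp (\<sigma> * (y + z - \<sigma> * h)) * ?n z = exp (\<sigma> * (y - \<sigma> * h)) * (?n z * exp (\<sigma> * z))"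
    proof -
      have "exp (\<sigma> * (y + z - \<sigma> * h)) = exp (\<sigma> * (y - \<sigma> * h)) * exp (\<sigma> * z)"
        unfolding exp_add[symmetric] by (rule arg_cong[where f = exp]) (simp add: algebra_simps)
      then show ?thesis by (simp only: mult_ac)
    qed
    also have "\<dots> = exp (\<sigma> * (y - \<sigma> * h)) * (exp (\<sigma>\<^sup>2 * h / 2) * normal_density (\<sigma> * h) (sqrt h) z)"
      using normal_density_exp[OF sh(1), of z \<sigma>] unfolding sh(2) by simp
    also have "\<dots> = exp (\<sigma> * y - \<sigma>\<^sup>2 * h / 2) * normal_density (\<sigma> * h) (sqrt h) z"
      unfolding mult.assoc[symmetric] exp_add[symmetric]
      by (intro arg_cong2[where f = "(*)"] arg_cong[where f = exp]) (auto simp: power2_eq_square field_simps)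
    finally have e: "exp (\<sigma> * (y + z - \<sigma> * h)) * ?n z = exp (\<sigma> * y - \<sigma>\<^sup>2 * h / 2) * normal_density (\<sigma> * h) (sqrt h) z" .
    show ?thesis
    proof (cases "z < ?c")
      case True
      then have "\<psi> (y + z - \<sigma> * h) * ?n z = p * ?n z - q * (exp (\<sigma> * (y + z - \<sigma> * h)) * ?n z)"
        by (simp add: \<psi>_def algebra_simps)
      then show ?thesis unfolding e using True by simp
    qed (auto simp: \<psi>_def)
  qed
  have int: "integrable lborel (\<lambda>z. \<psi> (y + z - \<sigma> * h) * ?n z)"
    unfolding eq using i1 i2 by (intro Bochner_Integration.integrable_diff integrable_mult_right)
  have val: "(\<integral>z. \<psi> (y + z - \<sigma> * h) * ?n z \<partial>lborel) = I y"
    unfolding eq using i1 i2 by (simp add: I_def)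
  have nn: "\<psi> (y + z - \<sigma> * h) * ?n z \<ge> 0" for z
    using pos[of "y + z - \<sigma> * h"] by (auto simp: \<psi>_def intro!: mult_nonneg_nonneg)
  show "I y \<ge> 0" unfolding val[symmetric] using nn by (intro integral_nonneg_AE) auto
  have "(\<integral>\<^sup>+z. ennreal (\<psi> (y + z - \<sigma> * h)) * ennreal (?n z) \<partial>lborel)
      = (\<integral>\<^sup>+z. ennreal (\<psi> (y + z - \<sigma> * h) * ?n z) \<partial>lborel)"
    by (intro nn_integral_cong) (simp add: ennreal_mult'')
  also have "\<dots> = ennreal (I y)"
    unfolding val[symmetric] using int nn by (intro nn_integral_eq_integral) auto
  finally show "(\<integral>\<^sup>+z. ennreal (\<psi> (y + z - \<sigma> * h)) * ennreal (?n z) \<partial>lborel) = ennreal (I y)" .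
qed

context brownian
begin

text \<open>Rounding the time down to a multiple of \<open>1 / (n + 1)\<close> leaves countably many
  values, and continuity of the paths passes to the limit. Negative times are clamped, since the
  Brownian motion is specified only for nonnegative ones.\<close>

lemma W_pair_measurable: "(\<lambda>(\<omega>, u). W (max 0 u) \<omega>) \<in> borel_measurable (M \<Otimes>\<^sub>M (lborel :: real measure))"
proof -
  let ?k = "\<lambda>n x. nat \<lfloor>real (Suc n) * max 0 (snd x)\<rfloor>"
  have "(\<lambda>x. W (max 0 (snd x)) (fst x)) \<in> borel_measurable (M \<Otimes>\<^sub>M (lborel :: real measure))"
  proof (rule borel_measurable_LIMSEQ_real)
    show "(\<lambda>x. W (real (?k n x) / real (Suc n)) (fst x)) \<in> borel_measurable (M \<Otimes>\<^sub>M (lborel :: real measure))" for n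
      by (rule measurable_compose_countable[where g = "?k n" and f = "\<lambda>k x. W (real k / real (Suc n)) (fst x)"]) measurable
    fix x assume "x \<in> space (M \<Otimes>\<^sub>M (lborel :: real measure))"
    then have \<omega>: "fst x \<in> space M" by (simp add: space_pair_measure mem_Times_iff)
    define u where "u = max 0 (snd x)"
    have u: "u \<ge> 0" by (simp add: u_def)
    have "(\<lambda>n. real (?k n x) / real (Suc n)) \<longlonglongrightarrow> u"
    proof (rule tendsto_sandwich)
      show "(\<lambda>n. u - 1 / real (Suc n)) \<longlonglongrightarrow> u" by real_asymp
      show "\<forall>\<^sub>F n in sequentially. u - 1 / real (Suc n) \<le> real (?k n x) / real (Suc n)"
      proof (intro always_eventually allI)
        fix n
        have "real (Suc n) * u - 1 \<le> real (?k n x)"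
          using u by (simp add: u_def[symmetric] of_nat_nat)
        then have "(real (Suc n) * u - 1) / real (Suc n) \<le> real (?k n x) / real (Suc n)"
          by (intro divide_right_mono) auto
        then show "u - 1 / real (Suc n) \<le> real (?k n x) / real (Suc n)"
          by (simp add: diff_divide_distrib del: of_nat_Suc)
      qed
      show "\<forall>\<^sub>F n in sequentially. real (?k n x) / real (Suc n) \<le> u"
      proof (intro always_eventually allI)
        fix n
        have "real (?k n x) \<le> real (Suc n) * u"
          using u by (simp add: u_def[symmetric] of_nat_nat del: of_nat_Suc)
        then show "real (?k n x) / real (Suc n) \<le> u"
          by (simp add: pos_divide_le_eq mult.commute del: of_nat_Suc)
      qed
    qed simp
    then show "(\<lambda>n. W (real (?k n x) / real (Suc n)) (fst x)) \<longlonglongrightarrow> W (max 0 (snd x)) (fst x)"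
      using W_continuous[OF \<omega>] u unfolding u_def[symmetric] continuous_on_sequentially
      by (auto simp: comp_def)
  qed
  then show ?thesis by (simp add: split_beta')
qed

text \<open>The past value may be frozen while the increment is integrated out: by independence
  their joint law is a product, and Tonelli's theorem applies. The event \<open>A\<close> makes this
  a statement about conditional expectations given \<open>F s\<close>.\<close>

lemma conditional_nn_integral:
  assumes s: "0 \<le> s" "s < u" and A: "A \<in> sets (F s)" and Y: "Y \<in> borel_measurable (F s)"
    and \<psi>[measurable]: "\<psi> \<in> borel_measurable borel"
  shows "(\<integral>\<^sup>+\<omega>\<in>A. \<psi> (Y \<omega> + inc s u \<omega>) \<partial>M)
    = (\<integral>\<^sup>+\<omega>\<in>A. (\<integral>\<^sup>+z. \<psi> (Y \<omega> + z) * ennreal (normal_density 0 (sqrt (u - s)) z) \<partial>lborel) \<partial>M)"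
proof -
  let ?B = "borel \<Otimes>\<^sub>M borel :: (real \<times> real) measure"
  \<comment> \<open>The event and the past value are carried together. Since
    \<open>indep_var\<close> relates variables of one common type, the increment is padded with 0 to
    become a pair as well.\<close>
  let ?\<theta> = "\<lambda>\<omega>. (indicator A \<omega> :: real, Y \<omega>)" and ?k = "\<lambda>z::real. (z, 0::real)"
  let ?f = "\<lambda>p. ennreal (fst (fst p)) * \<psi> (snd (fst p) + fst (snd p)) :: ennreal"
  have \<theta>: "?\<theta> \<in> measurable (F s) ?B" using A Y by measurable
  have k: "?k \<in> measurable borel ?B" by measurable
  have \<theta>M[measurable]: "?\<theta> \<in> measurable M ?B" by (rule measurable_F_M[OF \<theta> s(1)])
  have incM[measurable]: "inc s u \<in> borel_measurable M" using s by (intro inc_measurable) auto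
  have kM[measurable]: "(\<lambda>\<omega>. ?k (inc s u \<omega>)) \<in> measurable M ?B"
    by (rule measurable_compose[OF incM k])
  have fM[measurable]: "?f \<in> borel_measurable (?B \<Otimes>\<^sub>M ?B)" by measurable
  have ind: "indep_var ?B ?\<theta> ?B (\<lambda>\<omega>. ?k (inc s u \<omega>))"
    by (rule inc_indep[OF s \<theta> k])
  interpret D: prob_space "distr M ?B (\<lambda>\<omega>. ?k (inc s u \<omega>))" by (rule prob_space_distr) measurable
  have "(\<integral>\<^sup>+\<omega>\<in>A. \<psi> (Y \<omega> + inc s u \<omega>) \<partial>M) = (\<integral>\<^sup>+\<omega>. ?f (?\<theta> \<omega>, ?k (inc s u \<omega>)) \<partial>M)"
    by (intro nn_integral_cong) (auto simp: indicator_def)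
  also have "\<dots> = (\<integral>\<^sup>+x. ?f x \<partial>distr M (?B \<Otimes>\<^sub>M ?B) (\<lambda>\<omega>. (?\<theta> \<omega>, ?k (inc s u \<omega>))))"
    by (subst nn_integral_distr) (auto intro: fM)
  also have "distr M (?B \<Otimes>\<^sub>M ?B) (\<lambda>\<omega>. (?\<theta> \<omega>, ?k (inc s u \<omega>)))
      = distr M ?B ?\<theta> \<Otimes>\<^sub>M distr M ?B (\<lambda>\<omega>. ?k (inc s u \<omega>))"
    using ind unfolding indep_var_distribution_eq by simp
  also have "(\<integral>\<^sup>+x. ?f x \<partial>(distr M ?B ?\<theta> \<Otimes>\<^sub>M distr M ?B (\<lambda>\<omega>. ?k (inc s u \<omega>))))
      = (\<integral>\<^sup>+x. (\<integral>\<^sup>+y. ?f (x, y) \<partial>distr M ?B (\<lambda>\<omega>. ?k (inc s u \<omega>))) \<partial>distr M ?B ?\<theta>)"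
  proof (rule D.nn_integral_fst[symmetric])
    have "sets (distr M ?B ?\<theta> \<Otimes>\<^sub>M distr M ?B (\<lambda>\<omega>. ?k (inc s u \<omega>))) = sets (?B \<Otimes>\<^sub>M ?B)"
      by (intro sets_pair_measure_cong sets_distr)
    then show "?f \<in> borel_measurable (distr M ?B ?\<theta> \<Otimes>\<^sub>M distr M ?B (\<lambda>\<omega>. ?k (inc s u \<omega>)))"
      unfolding measurable_cong_sets[OF _ refl] by (subst measurable_cong_sets[OF _ refl]) (assumption, rule fM)
  qed
  also have "\<dots> = (\<integral>\<^sup>+\<omega>. (\<integral>\<^sup>+y. ?f (?\<theta> \<omega>, y) \<partial>distr M ?B (\<lambda>\<omega>. ?k (inc s u \<omega>))) \<partial>M)"
    by (rule nn_integral_distr[OF \<theta>M]) measurable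
  also have "\<dots> = (\<integral>\<^sup>+\<omega>. (\<integral>\<^sup>+\<omega>'. ?f (?\<theta> \<omega>, ?k (inc s u \<omega>')) \<partial>M) \<partial>M)"
    by (intro nn_integral_cong nn_integral_distr kM) measurable
  also have "\<dots> = (\<integral>\<^sup>+\<omega>\<in>A. (\<integral>\<^sup>+\<omega>'. \<psi> (Y \<omega> + inc s u \<omega>') \<partial>M) \<partial>M)"
    by (intro nn_integral_cong) (auto simp: indicator_def)
  also have "\<dots> = (\<integral>\<^sup>+\<omega>\<in>A. (\<integral>\<^sup>+z. \<psi> (Y \<omega> + z) * ennreal (normal_density 0 (sqrt (u - s)) z) \<partial>lborel) \<partial>M)"
  proof (intro nn_integral_cong arg_cong2[where f = "(*)"] refl)
    fix \<omega>
    show "(\<integral>\<^sup>+\<omega>'. \<psi> (Y \<omega> + inc s u \<omega>') \<partial>M)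
       = (\<integral>\<^sup>+z. \<psi> (Y \<omega> + z) * ennreal (normal_density 0 (sqrt (u - s)) z) \<partial>lborel)"
      using distributed_nn_integral[OF inc_distributed[OF s], of "\<lambda>z. \<psi> (Y \<omega> + z)"]
      by (simp add: mult.commute)
  qed
  finally show ?thesis .
qed

end

lemma ennreal_exp_mult: "ennreal (exp a) * ennreal b = ennreal (exp a * b)"
  by (simp add: ennreal_mult')

context put_boundary
begin

text \<open>The dividend yield may be negative, and so may \<open>D\<close>. In that case the left
  side is nonpositive; otherwise the exponential is at most 1 and \<open>D_le\<close>
  applies.\<close>

lemma D_exp_le: "c > 0 \<Longrightarrow> y < 0 \<Longrightarrow> D c * exp (\<sigma> * y) \<le> r"
proof -
  assume c: "c > 0" and y: "y < 0"
  have e: "0 < exp (\<sigma> * y)" "exp (\<sigma> * y) \<le> 1" using y \<sigma>_pos by (auto simp: mult_pos_neg less_imp_le)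
  show ?thesis
  proof (cases "D c \<ge> 0")
    case True
    then have "D c * exp (\<sigma> * y) \<le> D c * 1" using e by (intro mult_left_mono) auto
    with D_le[OF c] show ?thesis by simp
  next
    case False
    then have "D c * exp (\<sigma> * y) \<le> 0" using e by (simp add: mult_nonpos_nonneg)
    with r_pos show ?thesis by simp
  qed
qed

lemma Phi_measurable [measurable]: "Phi \<in> borel_measurable borel"
  by (intro borel_measurable_continuous_onI) (simp add: continuous_on_eq_continuous_at continuous_Phi)

lemma B_measurable [measurable]: "B \<in> borel_measurable borel"
  unfolding B_def[abs_def] by measurable

lemma D_measurable [measurable]: "D \<in> borel_measurable borel"
  unfolding D_def[abs_def] dB_def by measurable

lemma U_measurable [measurable]: "U c \<in> borel_measurable borel"
  unfolding U_def[abs_def] G_def by measurable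

lemma Euro_measurable [measurable]: "Euro c \<in> borel_measurable borel"
  unfolding Euro_def[abs_def] by measurable

lemma L_nonneg: assumes "0 < v" "v < c" shows "L c v y \<ge> 0"
  unfolding L_def using assms D_exp_le
  by (intro truncated_put_integral(2)) auto

lemma Euro_nonneg: assumes "0 < c" shows "Euro c y \<ge> 0"
  unfolding Euro_def
  using truncated_put_integral(2)[OF assms, of 1 \<sigma> 1 y] \<sigma>_pos
  by (simp add: mult_pos_neg less_imp_le)

text \<open>\<open>premium_has_integral\<close> moved to calendar time and to nonnegative integrals.
  The interval is open because the sign of \<open>L\<close> is known only in its interior.\<close>

lemma U_decomposition:
  assumes "s < T"
  shows "ennreal (U (T - s) y) = ennreal (Euro (T - s) y)
     + (\<integral>\<^sup>+u\<in>{s<..<T}. ennreal (exp (- r * (u - s)) * L (T - s) (u - s) y) \<partial>lborel)"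
proof -
  define c where "c = T - s"
  have c: "c > 0" using assms by (simp add: c_def)
  have hi: "((\<lambda>v. exp (- r * v) * L c v y) has_integral (U c y - Euro c y)) {0<..<c}"
    using premium_has_integral[OF c] by (simp add: has_integral_Icc_iff_Ioo)
  have nn: "0 \<le> exp (- r * v) * L c v y" if "v \<in> {0<..<c}" for v
    using L_nonneg[of v c y] that by simp
  have I: "(\<integral>\<^sup>+v\<in>{0<..<c}. ennreal (exp (- r * v) * L c v y) \<partial>lborel) = ennreal (U c y - Euro c y)"
    "U c y - Euro c y \<ge> 0"
    by (rule nn_integral_has_integral_lebesgue'[OF nn hi] has_integral_nonneg[OF hi nn]; assumption)+
  have "(\<lambda>v. L c v y) \<in> borel_measurable borel"
    unfolding L_def by measurable
  note [measurable] = this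
  have "(\<integral>\<^sup>+v\<in>{0<..<c}. ennreal (exp (- r * v) * L c v y) \<partial>lborel)
      = (\<integral>\<^sup>+u\<in>{s<..<T}. ennreal (exp (- r * (u - s)) * L c (u - s) y) \<partial>lborel)"
  proof (subst nn_integral_real_affine[where c = 1 and t = "-s"])
    show "(\<lambda>v. ennreal (exp (- r * v) * L c v y) * indicator {0<..<c} v) \<in> borel_measurable borel"
      by measurable
  qed (auto intro!: nn_integral_cong simp: indicator_def c_def)
  moreover have "ennreal (U c y) = ennreal (Euro c y) + ennreal (U c y - Euro c y)"
    using I(2) Euro_nonneg[OF c, of y] by (simp flip: ennreal_plus)
  ultimately show ?thesis using I(1) by (simp add: c_def)
qed

end

section \<open>The loss accumulated along \<open>Y\<close>\<close>

locale put_model = put_boundary r \<sigma> + brownian M F W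
  for r \<sigma> :: real and M :: "'a measure" and F W +
  fixes t T y0 :: real
  assumes t_nonneg: "0 \<le> t" and t_less: "t < T"
begin

text \<open>The clamped time makes \<open>Y\<close> jointly measurable on the whole real line, as
  integration over \<open>lborel\<close> requires.\<close>

definition Y :: "real \<Rightarrow> 'a \<Rightarrow> real" where
  "Y s \<omega> = y0 + inc t (max 0 s) \<omega> - \<sigma> * (s - t)"

definition lam :: "real \<Rightarrow> 'a \<Rightarrow> real" where
  "lam u \<omega> = exp (- r * (u - t)) * (if Y u \<omega> < 0 then r - D (T - u) * exp (\<sigma> * Y u \<omega>) else 0)"

definition final :: "'a \<Rightarrow> real" where
  "final \<omega> = exp (- r * (T - t)) * max 0 (1 - exp (\<sigma> * Y T \<omega>))"

lemma Y_start: "Y t \<omega> = y0"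
  using t_nonneg by (simp add: Y_def inc_def)

lemma Y_step: "t \<le> s \<Longrightarrow> s \<le> u \<Longrightarrow> Y u \<omega> = Y s \<omega> + inc s u \<omega> - \<sigma> * (u - s)"
  using t_nonneg by (simp add: Y_def inc_def algebra_simps)

lemma Y_adapted: "t \<le> s \<Longrightarrow> Y s \<in> borel_measurable (F s)"
  unfolding Y_def[abs_def] using t_nonneg inc_adapted[of t s] by (simp add: max_def)

lemma Y_pair_measurable [measurable]: "(\<lambda>(\<omega>, u). Y u \<omega>) \<in> borel_measurable (M \<Otimes>\<^sub>M lborel)"
proof -
  note [measurable] = W_pair_measurable W_measurable[OF t_nonneg]
  have "(\<lambda>x. y0 + ((\<lambda>(\<omega>, u). W (max 0 u) \<omega>) x - W t (fst x)) - \<sigma> * (snd x - t)) \<in> borel_measurable (M \<Otimes>\<^sub>M lborel)"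
    by measurable
  then show ?thesis by (simp add: Y_def inc_def split_beta')
qed

lemma lam_pair_measurable [measurable]: "(\<lambda>(\<omega>, u). lam u \<omega>) \<in> borel_measurable (M \<Otimes>\<^sub>M lborel)"
proof -
  have [measurable]: "(\<lambda>x. Y (snd x) (fst x)) \<in> borel_measurable (M \<Otimes>\<^sub>M lborel)"
    using Y_pair_measurable by (simp add: split_beta')
  show ?thesis unfolding lam_def split_beta' by measurable
qed

lemma lam_measurable: "\<omega> \<in> space M \<Longrightarrow> (\<lambda>u. lam u \<omega>) \<in> borel_measurable lborel"
  using measurable_compose_Pair1[OF _ lam_pair_measurable] by simp

lemma final_measurable [measurable]: "final \<in> borel_measurable M"
  unfolding final_def[abs_def] by measurable

lemma lam_conditional:
  assumes s: "t \<le> s" "s < u" "u < T" and A: "A \<in> sets (F s)"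
  shows "(\<integral>\<^sup>+\<omega>\<in>A. ennreal (lam u \<omega>) \<partial>M)
    = (\<integral>\<^sup>+\<omega>\<in>A. ennreal (exp (- r * (u - t)) * L (T - s) (u - s) (Y s \<omega>)) \<partial>M)"
proof -
  let ?\<psi> = "\<lambda>y. if y < 0 then r - D (T - u) * exp (\<sigma> * y) else 0"
  have h: "u - s > 0" using s by simp
  have pos: "D (T - u) * exp (\<sigma> * y) \<le> r" if "y < 0" for y
    using D_exp_le[OF _ that] s by simp
  have "(\<integral>\<^sup>+\<omega>\<in>A. ennreal (lam u \<omega>) \<partial>M)
      = (\<integral>\<^sup>+\<omega>\<in>A. ennreal (exp (- r * (u - t)) * ?\<psi> (Y s \<omega> + inc s u \<omega> - \<sigma> * (u - s))) \<partial>M)"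
    using s by (intro nn_integral_cong) (simp add: lam_def Y_step[of s u])
  also have "\<dots> = (\<integral>\<^sup>+\<omega>\<in>A. (\<integral>\<^sup>+z. ennreal (exp (- r * (u - t)) * ?\<psi> (Y s \<omega> + z - \<sigma> * (u - s)))
       * ennreal (normal_density 0 (sqrt (u - s)) z) \<partial>lborel) \<partial>M)"
    using s t_nonneg
    by (intro conditional_nn_integral[where \<psi> = "\<lambda>x. ennreal (exp (- r * (u - t)) * ?\<psi> (x - \<sigma> * (u - s)))"]
        A Y_adapted) auto
  also have "\<dots> = (\<integral>\<^sup>+\<omega>\<in>A. ennreal (exp (- r * (u - t)) * L (T - s) (u - s) (Y s \<omega>)) \<partial>M)"
  proof (intro nn_integral_cong arg_cong2[where f = "(*)"] refl)
    fix \<omega>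
    have "(\<integral>\<^sup>+z. ennreal (exp (- r * (u - t)) * ?\<psi> (Y s \<omega> + z - \<sigma> * (u - s)))
         * ennreal (normal_density 0 (sqrt (u - s)) z) \<partial>lborel)
       = (\<integral>\<^sup>+z. ennreal (exp (- r * (u - t))) * (ennreal (?\<psi> (Y s \<omega> + z - \<sigma> * (u - s)))
         * ennreal (normal_density 0 (sqrt (u - s)) z)) \<partial>lborel)"
      by (intro nn_integral_cong) (simp only: ennreal_exp_mult mult.assoc[symmetric])
    also have "\<dots> = ennreal (exp (- r * (u - t))) * (\<integral>\<^sup>+z. ennreal (?\<psi> (Y s \<omega> + z - \<sigma> * (u - s)))
         * ennreal (normal_density 0 (sqrt (u - s)) z) \<partial>lborel)"
      by (rule nn_integral_cmult) measurable
    also have "\<dots> = ennreal (exp (- r * (u - t)) * L (T - s) (u - s) (Y s \<omega>))"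
    proof -
      have "T - s - (u - s) = T - u" by simp
      then show ?thesis
        by (simp only: truncated_put_integral(1)[OF h pos, of "Y s \<omega>"] ennreal_exp_mult L_def)
    qed
    finally show "(\<integral>\<^sup>+z. ennreal (exp (- r * (u - t)) * ?\<psi> (Y s \<omega> + z - \<sigma> * (u - s)))
         * ennreal (normal_density 0 (sqrt (u - s)) z) \<partial>lborel)
       = ennreal (exp (- r * (u - t)) * L (T - s) (u - s) (Y s \<omega>))" .
  qed
  finally show ?thesis .
qed

lemma final_conditional:
  assumes s: "t \<le> s" "s < T" and A: "A \<in> sets (F s)"
  shows "(\<integral>\<^sup>+\<omega>\<in>A. ennreal (final \<omega>) \<partial>M)
    = (\<integral>\<^sup>+\<omega>\<in>A. ennreal (exp (- r * (s - t)) * Euro (T - s) (Y s \<omega>)) \<partial>M)"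
proof -
  let ?\<psi> = "\<lambda>y. if y < 0 then 1 - 1 * exp (\<sigma> * y) else 0"
  have h: "T - s > 0" using s by simp
  have pos: "1 * exp (\<sigma> * y) \<le> 1" if "y < 0" for y
    using that \<sigma>_pos by (simp add: mult_pos_neg less_imp_le)
  have pay: "max 0 (1 - exp (\<sigma> * y)) = ?\<psi> y" for y
    using \<sigma>_pos by (auto simp: max_def mult_pos_neg less_imp_le not_less zero_le_mult_iff mult_le_0_iff)
  have ex: "exp (- r * (T - t)) = exp (- r * (s - t)) * exp (- r * (T - s))"
    unfolding exp_add[symmetric] by (rule arg_cong[where f = exp]) (simp add: algebra_simps)
  have "(\<integral>\<^sup>+\<omega>\<in>A. ennreal (final \<omega>) \<partial>M)
      = (\<integral>\<^sup>+\<omega>\<in>A. ennreal (exp (- r * (T - t)) * ?\<psi> (Y s \<omega> + inc s T \<omega> - \<sigma> * (T - s))) \<partial>M)"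
    unfolding final_def pay using s by (intro nn_integral_cong) (simp add: Y_step[of s T])
  also have "\<dots> = (\<integral>\<^sup>+\<omega>\<in>A. (\<integral>\<^sup>+z. ennreal (exp (- r * (T - t)) * ?\<psi> (Y s \<omega> + z - \<sigma> * (T - s)))
       * ennreal (normal_density 0 (sqrt (T - s)) z) \<partial>lborel) \<partial>M)"
    using s t_nonneg
    by (intro conditional_nn_integral[where \<psi> = "\<lambda>x. ennreal (exp (- r * (T - t)) * ?\<psi> (x - \<sigma> * (T - s)))"]
        A Y_adapted) auto
  also have "\<dots> = (\<integral>\<^sup>+\<omega>\<in>A. ennreal (exp (- r * (s - t)) * Euro (T - s) (Y s \<omega>)) \<partial>M)"
  proof (intro nn_integral_cong arg_cong2[where f = "(*)"] refl)
    fix \<omega>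
    have "(\<integral>\<^sup>+z. ennreal (exp (- r * (T - t)) * ?\<psi> (Y s \<omega> + z - \<sigma> * (T - s)))
         * ennreal (normal_density 0 (sqrt (T - s)) z) \<partial>lborel)
       = (\<integral>\<^sup>+z. ennreal (exp (- r * (T - t))) * (ennreal (?\<psi> (Y s \<omega> + z - \<sigma> * (T - s)))
         * ennreal (normal_density 0 (sqrt (T - s)) z)) \<partial>lborel)"
      by (intro nn_integral_cong) (simp only: ennreal_exp_mult mult.assoc[symmetric])
    also have "\<dots> = ennreal (exp (- r * (T - t))) * (\<integral>\<^sup>+z. ennreal (?\<psi> (Y s \<omega> + z - \<sigma> * (T - s)))
         * ennreal (normal_density 0 (sqrt (T - s)) z) \<partial>lborel)"
      by (rule nn_integral_cmult) measurable
    also have "\<dots> = ennreal (exp (- r * (s - t)) * Euro (T - s) (Y s \<omega>))"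
      by (simp only: truncated_put_integral(1)[OF h pos, of "Y s \<omega>", unfolded mult_1] Euro_def ex
          ennreal_mult'[OF exp_ge_zero] mult.assoc mult_1)
    finally show "(\<integral>\<^sup>+z. ennreal (exp (- r * (T - t)) * ?\<psi> (Y s \<omega> + z - \<sigma> * (T - s)))
         * ennreal (normal_density 0 (sqrt (T - s)) z) \<partial>lborel)
       = ennreal (exp (- r * (s - t)) * Euro (T - s) (Y s \<omega>))" .
  qed
  finally show ?thesis .
qed

text \<open>The early exercise premium representation, conditionally on \<open>F s\<close>.\<close>

lemma premium_identity:
  assumes s: "t \<le> s" "s < T" and A: "A \<in> sets (F s)"
  shows "(\<integral>\<^sup>+\<omega>\<in>A. ennreal (exp (- r * (s - t)) * U (T - s) (Y s \<omega>)) \<partial>M)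
    = (\<integral>\<^sup>+\<omega>\<in>A. (ennreal (final \<omega>) + (\<integral>\<^sup>+u\<in>{s<..<T}. ennreal (lam u \<omega>) \<partial>lborel)) \<partial>M)"
proof -
  interpret P: pair_sigma_finite M lborel ..
  have A_M[measurable]: "A \<in> events"
    using A subalg[of s] s t_nonneg by (auto simp: subalgebra_def)
  define K where "K u y = exp (- r * (u - t)) * L (T - s) (u - s) y" for u y
  have [measurable]: "(\<lambda>x. K (snd x) (Y s (fst x))) \<in> borel_measurable (M \<Otimes>\<^sub>M lborel)"
    unfolding K_def L_def by measurable
  have [measurable]: "(\<lambda>u. K u y) \<in> borel_measurable lborel" for y
    unfolding K_def L_def by measurable
  have [measurable]: "(\<lambda>x. lam (snd x) (fst x)) \<in> borel_measurable (M \<Otimes>\<^sub>M lborel)"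
    using lam_pair_measurable by (simp add: split_beta')
  have [measurable]: "(\<lambda>\<omega>. \<integral>\<^sup>+u\<in>{s<..<T}. ennreal (K u (Y s \<omega>)) \<partial>lborel) \<in> borel_measurable M"
    by measurable
  have [measurable]: "(\<lambda>\<omega>. \<integral>\<^sup>+u\<in>{s<..<T}. ennreal (lam u \<omega>) \<partial>lborel) \<in> borel_measurable M"
    by measurable
  have ex: "exp (- r * (s - t)) * exp (- r * (u - s)) = exp (- r * (u - t))" for u
    unfolding exp_add[symmetric] by (rule arg_cong[where f = exp]) (simp add: algebra_simps)
  have U: "ennreal (exp (- r * (s - t)) * U (T - s) y) = ennreal (exp (- r * (s - t)) * Euro (T - s) y)
       + (\<integral>\<^sup>+u\<in>{s<..<T}. ennreal (K u y) \<partial>lborel)" for y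
  proof -
    have "ennreal (exp (- r * (s - t))) * (\<integral>\<^sup>+u\<in>{s<..<T}. ennreal (exp (- r * (u - s)) * L (T - s) (u - s) y) \<partial>lborel)
        = (\<integral>\<^sup>+u\<in>{s<..<T}. ennreal (K u y) \<partial>lborel)"
    proof -
      have [measurable]: "(\<lambda>u. L (T - s) (u - s) y) \<in> borel_measurable lborel"
        unfolding L_def by measurable
      have "ennreal (exp (- r * (s - t))) * (\<integral>\<^sup>+u\<in>{s<..<T}. ennreal (exp (- r * (u - s)) * L (T - s) (u - s) y) \<partial>lborel)
          = (\<integral>\<^sup>+u. ennreal (exp (- r * (s - t))) * (ennreal (exp (- r * (u - s)) * L (T - s) (u - s) y) * indicator {s<..<T} u) \<partial>lborel)"
        by (rule nn_integral_cmult[symmetric]) measurable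
      also have "\<dots> = (\<integral>\<^sup>+u\<in>{s<..<T}. ennreal (K u y) \<partial>lborel)"
        unfolding K_def
        by (intro nn_integral_cong) (simp only: mult.assoc[symmetric] ennreal_exp_mult ex)
      finally show ?thesis .
    qed
    moreover have "ennreal (exp (- r * (s - t)) * U (T - s) y) = ennreal (exp (- r * (s - t))) *
       (ennreal (Euro (T - s) y) + (\<integral>\<^sup>+u\<in>{s<..<T}. ennreal (exp (- r * (u - s)) * L (T - s) (u - s) y) \<partial>lborel))"
      by (simp only: U_decomposition[OF s(2), symmetric] ennreal_exp_mult)
    ultimately show ?thesis by (simp only: distrib_left ennreal_exp_mult)
  qed
  have "(\<integral>\<^sup>+\<omega>\<in>A. (\<integral>\<^sup>+u\<in>{s<..<T}. ennreal (K u (Y s \<omega>)) \<partial>lborel) \<partial>M)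
      = (\<integral>\<^sup>+\<omega>. (\<integral>\<^sup>+u. ennreal (K u (Y s \<omega>)) * indicator {s<..<T} u * indicator A \<omega> \<partial>lborel) \<partial>M)"
    by (intro nn_integral_cong nn_integral_multc[symmetric]) measurable
  also have "\<dots> = (\<integral>\<^sup>+u. (\<integral>\<^sup>+\<omega>. ennreal (K u (Y s \<omega>)) * indicator {s<..<T} u * indicator A \<omega> \<partial>M) \<partial>lborel)"
    by (rule P.Fubini[where f = "\<lambda>(\<omega>, u). ennreal (K u (Y s \<omega>)) * indicator {s<..<T} u * indicator A \<omega>", simplified, symmetric])
  also have "\<dots> = (\<integral>\<^sup>+u. (\<integral>\<^sup>+\<omega>. ennreal (lam u \<omega>) * indicator {s<..<T} u * indicator A \<omega> \<partial>M) \<partial>lborel)"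
  proof (rule nn_integral_cong)
    fix u
    show "(\<integral>\<^sup>+\<omega>. ennreal (K u (Y s \<omega>)) * indicator {s<..<T} u * indicator A \<omega> \<partial>M)
        = (\<integral>\<^sup>+\<omega>. ennreal (lam u \<omega>) * indicator {s<..<T} u * indicator A \<omega> \<partial>M)"
    proof (cases "u \<in> {s<..<T}")
      case True
      then show ?thesis using lam_conditional[OF s(1) _ _ A, of u] by (simp add: K_def)
    qed simp
  qed
  also have "\<dots> = (\<integral>\<^sup>+\<omega>. (\<integral>\<^sup>+u. ennreal (lam u \<omega>) * indicator {s<..<T} u * indicator A \<omega> \<partial>lborel) \<partial>M)"
    by (rule P.Fubini[where f = "\<lambda>(\<omega>, u). ennreal (lam u \<omega>) * indicator {s<..<T} u * indicator A \<omega>", simplified])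
  also have "\<dots> = (\<integral>\<^sup>+\<omega>\<in>A. (\<integral>\<^sup>+u\<in>{s<..<T}. ennreal (lam u \<omega>) \<partial>lborel) \<partial>M)"
    using lam_measurable by (intro nn_integral_cong nn_integral_multc) measurable
  finally have prem: "(\<integral>\<^sup>+\<omega>\<in>A. (\<integral>\<^sup>+u\<in>{s<..<T}. ennreal (K u (Y s \<omega>)) \<partial>lborel) \<partial>M)
      = (\<integral>\<^sup>+\<omega>\<in>A. (\<integral>\<^sup>+u\<in>{s<..<T}. ennreal (lam u \<omega>) \<partial>lborel) \<partial>M)" .
  have "(\<integral>\<^sup>+\<omega>\<in>A. ennreal (exp (- r * (s - t)) * U (T - s) (Y s \<omega>)) \<partial>M)
     = (\<integral>\<^sup>+\<omega>\<in>A. ennreal (exp (- r * (s - t)) * Euro (T - s) (Y s \<omega>)) \<partial>M)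
       + (\<integral>\<^sup>+\<omega>\<in>A. (\<integral>\<^sup>+u\<in>{s<..<T}. ennreal (K u (Y s \<omega>)) \<partial>lborel) \<partial>M)"
    unfolding U distrib_right by (rule nn_integral_add) measurable
  also have "\<dots> = (\<integral>\<^sup>+\<omega>\<in>A. ennreal (final \<omega>) \<partial>M) + (\<integral>\<^sup>+\<omega>\<in>A. (\<integral>\<^sup>+u\<in>{s<..<T}. ennreal (lam u \<omega>) \<partial>lborel) \<partial>M)"
    unfolding prem final_conditional[OF s A] ..
  also have "\<dots> = (\<integral>\<^sup>+\<omega>\<in>A. (ennreal (final \<omega>) + (\<integral>\<^sup>+u\<in>{s<..<T}. ennreal (lam u \<omega>) \<partial>lborel)) \<partial>M)"
    unfolding distrib_right by (rule nn_integral_add[symmetric]) measurable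
  finally show ?thesis .
qed

text \<open>The value \<open>\<nu> \<omega>\<close> is an index into the time grid \<open>p\<close>,
  whose last point is the maturity. There \<open>final\<close> takes the place of the candidate
  value, as the formula for \<open>G\<close> divides by \<open>sqrt 0\<close>.\<close>

definition stopped :: "nat \<Rightarrow> (nat \<Rightarrow> real) \<Rightarrow> ('a \<Rightarrow> nat) \<Rightarrow> 'a \<Rightarrow> real" where
  "stopped n p \<nu> \<omega> = (if \<nu> \<omega> < n then exp (- r * (p (\<nu> \<omega>) - t)) * U (T - p (\<nu> \<omega>)) (Y (p (\<nu> \<omega>)) \<omega>)
     else final \<omega>)"

lemma lam_int_measurable:
  assumes [measurable]: "\<rho> \<in> borel_measurable M"
  shows "(\<lambda>\<omega>. \<integral>\<^sup>+u\<in>{\<rho> \<omega><..<T}. ennreal (lam u \<omega>) \<partial>lborel) \<in> borel_measurable M"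
proof -
  have [measurable]: "(\<lambda>x. lam (snd x) (fst x)) \<in> borel_measurable (M \<Otimes>\<^sub>M lborel)"
    using lam_pair_measurable by (simp add: split_beta')
  have "(\<lambda>\<omega>. \<integral>\<^sup>+u. ennreal (lam u \<omega>) * (if \<rho> \<omega> < u \<and> u < T then 1 else 0) \<partial>lborel) \<in> borel_measurable M"
    by measurable
  also have "(\<lambda>\<omega>. \<integral>\<^sup>+u. ennreal (lam u \<omega>) * (if \<rho> \<omega> < u \<and> u < T then 1 else 0) \<partial>lborel)
      = (\<lambda>\<omega>. \<integral>\<^sup>+u\<in>{\<rho> \<omega><..<T}. ennreal (lam u \<omega>) \<partial>lborel)"
    by (intro ext nn_integral_cong) (auto simp: indicator_def)
  finally show ?thesis .
qed

lemma U_start: "ennreal (U (T - t) y0)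
    = (\<integral>\<^sup>+\<omega>. ennreal (final \<omega>) + (\<integral>\<^sup>+u\<in>{t<..<T}. ennreal (lam u \<omega>) \<partial>lborel) \<partial>M)"
proof -
  have "space M \<in> sets (F t)" using sets.top[of "F t"] by (simp add: space_F)
  from premium_identity[OF order_refl t_less this]
  have "(\<integral>\<^sup>+\<omega>. ennreal (U (T - t) y0) * indicator (space M) \<omega> \<partial>M)
    = (\<integral>\<^sup>+\<omega>. (ennreal (final \<omega>) + (\<integral>\<^sup>+u\<in>{t<..<T}. ennreal (lam u \<omega>) \<partial>lborel)) * indicator (space M) \<omega> \<partial>M)"
    by (simp add: Y_start)
  moreover have "(\<integral>\<^sup>+\<omega>. (ennreal (final \<omega>) + (\<integral>\<^sup>+u\<in>{t<..<T}. ennreal (lam u \<omega>) \<partial>lborel)) * indicator (space M) \<omega> \<partial>M)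
    = (\<integral>\<^sup>+\<omega>. ennreal (final \<omega>) + (\<integral>\<^sup>+u\<in>{t<..<T}. ennreal (lam u \<omega>) \<partial>lborel) \<partial>M)"
    by (intro nn_integral_cong) simp
  ultimately show ?thesis by (simp add: emeasure_space_1)
qed

text \<open>Optional sampling for finitely many values: on each event \<open>\<nu> = i\<close>,
  which belongs to \<open>F (p i)\<close>, the premium identity is applied at time
  \<open>p i\<close>. At the last index nothing remains to be integrated.\<close>

lemma stopped_integral:
  assumes p: "\<And>i. i < n \<Longrightarrow> t \<le> p i \<and> p i < T" and pn: "p n = T"
    and \<nu>_le: "\<And>\<omega>. \<omega> \<in> space M \<Longrightarrow> \<nu> \<omega> \<le> n"
    and \<nu>_F: "\<And>i. i \<le> n \<Longrightarrow> {\<omega> \<in> space M. \<nu> \<omega> = i} \<in> sets (F (p i))"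
  shows "(\<integral>\<^sup>+\<omega>. ennreal (stopped n p \<nu> \<omega>) \<partial>M)
    = (\<integral>\<^sup>+\<omega>. ennreal (final \<omega>) + (\<integral>\<^sup>+u\<in>{p (\<nu> \<omega>)<..<T}. ennreal (lam u \<omega>) \<partial>lborel) \<partial>M)"
proof -
  define A where "A i = {\<omega> \<in> space M. \<nu> \<omega> = i}" for i
  define f where "f i \<omega> = ennreal (if i < n then exp (- r * (p i - t)) * U (T - p i) (Y (p i) \<omega>) else final \<omega>)" for i \<omega>
  define g where "g i \<omega> = ennreal (final \<omega>) + (\<integral>\<^sup>+u\<in>{p i<..<T}. ennreal (lam u \<omega>) \<partial>lborel)" for i \<omega>
  have A_F: "A i \<in> sets (F (p i))" if "i \<le> n" for i using \<nu>_F[OF that] by (simp add: A_def)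
  have p0: "0 \<le> p i" if "i \<le> n" for i
    using p[of i] pn t_nonneg t_less that by (cases "i = n") auto
  have A_M: "A i \<in> events" if "i \<le> n" for i
    using A_F[OF that] subalg[OF p0[OF that]] by (auto simp: subalgebra_def)
  have [measurable]: "f i \<in> borel_measurable M" for i unfolding f_def[abs_def] by measurable
  have [measurable]: "g i \<in> borel_measurable M" for i
    unfolding g_def[abs_def] using lam_int_measurable[of "\<lambda>_. p i"] by measurable
  have split: "(\<integral>\<^sup>+\<omega>. k (\<nu> \<omega>) \<omega> \<partial>M) = (\<Sum>i\<le>n. \<integral>\<^sup>+\<omega>\<in>A i. k i \<omega> \<partial>M)"
    if k: "\<And>i. k i \<in> borel_measurable M" for k :: "nat \<Rightarrow> 'a \<Rightarrow> ennreal"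
  proof -
    have "(\<integral>\<^sup>+\<omega>. k (\<nu> \<omega>) \<omega> \<partial>M) = (\<integral>\<^sup>+\<omega>. (\<Sum>i\<le>n. k i \<omega> * indicator (A i) \<omega>) \<partial>M)"
    proof (intro nn_integral_cong)
      fix \<omega> assume \<omega>: "\<omega> \<in> space M"
      have "(\<Sum>i\<le>n. k i \<omega> * indicator (A i) \<omega>) = (\<Sum>i\<le>n. if i = \<nu> \<omega> then k (\<nu> \<omega>) \<omega> else 0)"
        using \<omega> by (intro sum.cong) (auto simp: A_def indicator_def)
      also have "\<dots> = k (\<nu> \<omega>) \<omega>" using \<nu>_le[OF \<omega>] by (simp add: sum.delta)
      finally show "k (\<nu> \<omega>) \<omega> = (\<Sum>i\<le>n. k i \<omega> * indicator (A i) \<omega>)" ..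
    qed
    also have "\<dots> = (\<Sum>i\<le>n. \<integral>\<^sup>+\<omega>\<in>A i. k i \<omega> \<partial>M)"
      using k A_M by (intro nn_integral_sum) auto
    finally show ?thesis .
  qed
  have "(\<integral>\<^sup>+\<omega>\<in>A i. f i \<omega> \<partial>M) = (\<integral>\<^sup>+\<omega>\<in>A i. g i \<omega> \<partial>M)" if "i \<le> n" for i
  proof (cases "i = n")
    case True
    then show ?thesis by (simp add: f_def g_def pn)
  next
    case False
    then have i: "i < n" using that by simp
    then show ?thesis
      using premium_identity[OF _ _ A_F[OF that]] p[OF i] by (simp add: f_def g_def)
  qed
  then have "(\<integral>\<^sup>+\<omega>. f (\<nu> \<omega>) \<omega> \<partial>M) = (\<integral>\<^sup>+\<omega>. g (\<nu> \<omega>) \<omega> \<partial>M)"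
    by (subst (1 2) split) auto
  then show ?thesis by (simp add: f_def g_def stopped_def)
qed

text \<open>Relative to the representation of \<open>U\<close> at the start, the stopped quantity
  lacks exactly the loss accumulated before stopping, which is nonnegative.\<close>

lemma stopped_le:
  assumes p: "\<And>i. i < n \<Longrightarrow> t \<le> p i \<and> p i < T" and pn: "p n = T"
    and \<nu>_le: "\<And>\<omega>. \<omega> \<in> space M \<Longrightarrow> \<nu> \<omega> \<le> n"
    and \<nu>_F: "\<And>i. i \<le> n \<Longrightarrow> {\<omega> \<in> space M. \<nu> \<omega> = i} \<in> sets (F (p i))"
  shows "(\<integral>\<^sup>+\<omega>. ennreal (stopped n p \<nu> \<omega>) \<partial>M) \<le> ennreal (U (T - t) y0)"
proof -
  have "t \<le> p (\<nu> \<omega>)" if "\<omega> \<in> space M" for \<omega>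
    using p[of "\<nu> \<omega>"] pn \<nu>_le[OF that] t_less by (cases "\<nu> \<omega> = n") auto
  then have "(\<integral>\<^sup>+\<omega>. ennreal (final \<omega>) + (\<integral>\<^sup>+u\<in>{p (\<nu> \<omega>)<..<T}. ennreal (lam u \<omega>) \<partial>lborel) \<partial>M)
      \<le> ennreal (U (T - t) y0)"
    unfolding U_start
    by (intro nn_integral_mono add_left_mono) (auto simp: indicator_def dest: less_le_trans le_less_trans)
  moreover have "(\<integral>\<^sup>+\<omega>. ennreal (stopped n p \<nu> \<omega>) \<partial>M)
    = (\<integral>\<^sup>+\<omega>. ennreal (final \<omega>) + (\<integral>\<^sup>+u\<in>{p (\<nu> \<omega>)<..<T}. ennreal (lam u \<omega>) \<partial>lborel) \<partial>M)"
    by (rule stopped_integral[OF assms])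
  ultimately show ?thesis by (simp only:)
qed

text \<open>The bound in the other direction: what separates the start value from the stopped value
  is at most the expected loss before stopping. A good rule is therefore one that makes this term
  small.\<close>

lemma stopped_loss:
  assumes p: "\<And>i. i < n \<Longrightarrow> t \<le> p i \<and> p i < T" and pn: "p n = T"
    and \<nu>_le: "\<And>\<omega>. \<omega> \<in> space M \<Longrightarrow> \<nu> \<omega> \<le> n"
    and \<nu>_F: "\<And>i. i \<le> n \<Longrightarrow> {\<omega> \<in> space M. \<nu> \<omega> = i} \<in> sets (F (p i))"
    and \<nu>_M[measurable]: "\<nu> \<in> measurable M (count_space UNIV)"
  shows "ennreal (U (T - t) y0) \<le> (\<integral>\<^sup>+\<omega>. ennreal (stopped n p \<nu> \<omega>) \<partial>M)
    + (\<integral>\<^sup>+\<omega>. (\<integral>\<^sup>+u. ennreal (lam u \<omega>) * indicator {u. t < u \<and> u < T \<and> u \<le> p (\<nu> \<omega>)} u \<partial>lborel) \<partial>M)"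
proof -
  have [measurable]: "(\<lambda>x. lam (snd x) (fst x)) \<in> borel_measurable (M \<Otimes>\<^sub>M lborel)"
    using lam_pair_measurable by (simp add: split_beta')
  have [measurable]: "(\<lambda>\<omega>. \<integral>\<^sup>+u\<in>{p (\<nu> \<omega>)<..<T}. ennreal (lam u \<omega>) \<partial>lborel) \<in> borel_measurable M"
    by (rule lam_int_measurable) measurable
  have "(\<lambda>\<omega>. \<integral>\<^sup>+u. ennreal (lam u \<omega>) * (if t < u \<and> u < T \<and> u \<le> p (\<nu> \<omega>) then 1 else 0) \<partial>lborel) \<in> borel_measurable M"
    by measurable
  also have "(\<lambda>\<omega>. \<integral>\<^sup>+u. ennreal (lam u \<omega>) * (if t < u \<and> u < T \<and> u \<le> p (\<nu> \<omega>) then 1 else 0) \<partial>lborel)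
      = (\<lambda>\<omega>. \<integral>\<^sup>+u. ennreal (lam u \<omega>) * indicator {u. t < u \<and> u < T \<and> u \<le> p (\<nu> \<omega>)} u \<partial>lborel)"
    by (intro ext nn_integral_cong) (auto simp: indicator_def)
  finally have [measurable]: "(\<lambda>\<omega>. \<integral>\<^sup>+u. ennreal (lam u \<omega>) * indicator {u. t < u \<and> u < T \<and> u \<le> p (\<nu> \<omega>)} u \<partial>lborel) \<in> borel_measurable M" .
  have "(\<integral>\<^sup>+u\<in>{t<..<T}. ennreal (lam u \<omega>) \<partial>lborel) \<le> (\<integral>\<^sup>+u\<in>{p (\<nu> \<omega>)<..<T}. ennreal (lam u \<omega>) \<partial>lborel)
      + (\<integral>\<^sup>+u. ennreal (lam u \<omega>) * indicator {u. t < u \<and> u < T \<and> u \<le> p (\<nu> \<omega>)} u \<partial>lborel)"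
    if \<omega>: "\<omega> \<in> space M" for \<omega>
  proof -
    note [measurable] = lam_measurable[OF \<omega>]
    have "(\<integral>\<^sup>+u\<in>{t<..<T}. ennreal (lam u \<omega>) \<partial>lborel) \<le> (\<integral>\<^sup>+u. ennreal (lam u \<omega>) * indicator {p (\<nu> \<omega>)<..<T} u
      + ennreal (lam u \<omega>) * indicator {u. t < u \<and> u < T \<and> u \<le> p (\<nu> \<omega>)} u \<partial>lborel)"
      by (intro nn_integral_mono) (auto simp: indicator_def)
    also have "\<dots> = (\<integral>\<^sup>+u\<in>{p (\<nu> \<omega>)<..<T}. ennreal (lam u \<omega>) \<partial>lborel)
      + (\<integral>\<^sup>+u. ennreal (lam u \<omega>) * indicator {u. t < u \<and> u < T \<and> u \<le> p (\<nu> \<omega>)} u \<partial>lborel)"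
      by (rule nn_integral_add) measurable
    finally show ?thesis .
  qed
  then have "ennreal (U (T - t) y0) \<le> (\<integral>\<^sup>+\<omega>. (ennreal (final \<omega>) + (\<integral>\<^sup>+u\<in>{p (\<nu> \<omega>)<..<T}. ennreal (lam u \<omega>) \<partial>lborel))
      + (\<integral>\<^sup>+u. ennreal (lam u \<omega>) * indicator {u. t < u \<and> u < T \<and> u \<le> p (\<nu> \<omega>)} u \<partial>lborel) \<partial>M)"
    unfolding U_start add.assoc by (intro nn_integral_mono add_left_mono)
  also have "\<dots> = (\<integral>\<^sup>+\<omega>. ennreal (final \<omega>) + (\<integral>\<^sup>+u\<in>{p (\<nu> \<omega>)<..<T}. ennreal (lam u \<omega>) \<partial>lborel) \<partial>M)
      + (\<integral>\<^sup>+\<omega>. (\<integral>\<^sup>+u. ennreal (lam u \<omega>) * indicator {u. t < u \<and> u < T \<and> u \<le> p (\<nu> \<omega>)} u \<partial>lborel) \<partial>M)"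
    by (rule nn_integral_add) measurable
  also have "(\<integral>\<^sup>+\<omega>. ennreal (final \<omega>) + (\<integral>\<^sup>+u\<in>{p (\<nu> \<omega>)<..<T}. ennreal (lam u \<omega>) \<partial>lborel) \<partial>M)
      = (\<integral>\<^sup>+\<omega>. ennreal (stopped n p \<nu> \<omega>) \<partial>M)"
    by (rule stopped_integral[OF p pn \<nu>_le \<nu>_F, symmetric])
  finally show ?thesis .
qed

text \<open>Discounting and the exponential of \<open>Y\<close> below 0 contribute factors at most
  1. The unbounded contribution is \<open>- dB\<close>, of order \<open>1 / sqrt (T - u)\<close> and
  integrable up to maturity; the bound serves as dominating function for the loss.\<close>

lemma lam_bound:
  "u < T \<Longrightarrow> t \<le> u \<Longrightarrow> lam u \<omega> \<le> r + \<alpha>\<^sup>2 / 2 + \<sigma> * phi 0 / sqrt (T - u)"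
proof -
  assume u: "u < T" "t \<le> u"
  let ?c = "T - u"
  have c: "?c > 0" using u by simp
  have "phi (\<alpha> * sqrt ?c) \<le> phi 0"
    unfolding std_normal_density_def by (intro mult_left_mono) simp_all
  then have "\<sigma> * phi (\<alpha> * sqrt ?c) / sqrt ?c \<le> \<sigma> * phi 0 / sqrt ?c"
    using \<sigma>_pos c by (intro divide_right_mono mult_left_mono) auto
  moreover have "0 \<le> \<alpha>\<^sup>2 / 2 * B ?c" using B_pos[of ?c] by simp
  ultimately have "- D ?c \<le> \<sigma> * phi 0 / sqrt ?c"
    unfolding D_def dB_def by simp
  then have d: "- D ?c \<le> \<alpha>\<^sup>2 / 2 + \<sigma> * phi 0 / sqrt ?c" by (simp add: add_increasing)
  have b0: "0 \<le> \<alpha>\<^sup>2 / 2 + \<sigma> * phi 0 / sqrt ?c"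
    using \<sigma>_pos c by (intro add_nonneg_nonneg) auto
  have e: "exp (- r * (u - t)) \<le> 1" "0 < exp (- r * (u - t))"
    using r_pos u by (auto simp: mult_nonpos_nonneg)
  show ?thesis
  proof (cases "Y u \<omega> < 0")
    case True
    let ?x = "exp (\<sigma> * Y u \<omega>)"
    have x: "0 < ?x" "?x \<le> 1" using True \<sigma>_pos by (auto simp: mult_pos_neg less_imp_le)
    have "- D ?c * ?x \<le> (\<alpha>\<^sup>2 / 2 + \<sigma> * phi 0 / sqrt ?c) * ?x"
      using d x by (intro mult_right_mono) auto
    also have "\<dots> \<le> (\<alpha>\<^sup>2 / 2 + \<sigma> * phi 0 / sqrt ?c) * 1"
      using b0 x by (intro mult_left_mono) auto
    finally have "r - D ?c * ?x \<le> r + \<alpha>\<^sup>2 / 2 + \<sigma> * phi 0 / sqrt ?c" by simp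
    moreover have "exp (- r * (u - t)) * (r - D ?c * ?x) \<le> 1 * (r - D ?c * ?x)"
      using e D_exp_le[OF c True] by (intro mult_right_mono) auto
    ultimately show ?thesis using True by (simp add: lam_def)
  next
    case False
    then show ?thesis using b0 r_pos by (simp add: lam_def)
  qed
qed

lemma lam_bound_integral:
  "(\<integral>\<^sup>+u\<in>{t<..<T}. ennreal (r + \<alpha>\<^sup>2 / 2 + \<sigma> * phi 0 / sqrt (T - u)) \<partial>lborel) < \<infinity>"
proof -
  define k where "k = r + \<alpha>\<^sup>2 / 2"
  define q where "q = \<sigma> * phi 0"
  have kq: "k \<ge> 0" "q \<ge> 0" using r_pos \<sigma>_pos by (auto simp: k_def q_def)
  have "((\<lambda>u. k + q / sqrt (T - u)) has_integral (k * T - 2 * q * sqrt (T - T)) - (k * t - 2 * q * sqrt (T - t))) {t..T}"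
  proof (rule has_integral_ftc_limits[OF t_less])
    show "((\<lambda>u. k * u - 2 * q * sqrt (T - u)) has_real_derivative k + q / sqrt (T - x)) (at x)"
      if "t < x" "x < T" for x
      using that by (auto intro!: derivative_eq_intros simp: field_simps)
  qed (intro tendsto_intros)+
  then have "((\<lambda>u. k + q / sqrt (T - u)) has_integral (k * T - (k * t - 2 * q * sqrt (T - t)))) {t<..<T}"
    by (simp add: has_integral_Icc_iff_Ioo)
  then have "(\<integral>\<^sup>+u\<in>{t<..<T}. ennreal (k + q / sqrt (T - u)) \<partial>lborel) = ennreal (k * T - (k * t - 2 * q * sqrt (T - t)))"
    using kq by (intro nn_integral_has_integral_lebesgue') auto
  then show ?thesis by (simp add: k_def q_def)
qed

text \<open>Stopping at the first grid point where \<open>Y\<close> is nonpositive, the loss vanishes in the limit: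
  if \<open>Y u < 0\<close> then \<open>Y\<close> is negative at the last grid point before \<open>u\<close>.\<close>

lemma loss_tendsto_0:
  assumes \<nu>_M: "\<And>n. \<nu> n \<in> measurable M (count_space UNIV)"
    and \<nu>: "AE \<omega> in M. \<forall>n. \<forall>j\<le>n. Y (gp t T (Suc n) j) \<omega> \<le> 0 \<longrightarrow> \<nu> n \<omega> \<le> j"
  shows "(\<lambda>n. \<integral>\<^sup>+\<omega>. (\<integral>\<^sup>+u. ennreal (lam u \<omega>)
      * indicator {u. t < u \<and> u < T \<and> u \<le> gp t T (Suc n) (\<nu> n \<omega>)} u \<partial>lborel) \<partial>M) \<longlonglongrightarrow> 0"
proof -
  interpret P: pair_sigma_finite M lborel ..
  let ?p = "\<lambda>n. gp t T (Suc n)"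
  let ?w = "\<lambda>u. ennreal (r + \<alpha>\<^sup>2 / 2 + \<sigma> * phi 0 / sqrt (T - u)) * indicator {t<..<T} u"
  let ?f = "\<lambda>n \<omega> u. ennreal (lam u \<omega>) * indicator {u. t < u \<and> u < T \<and> u \<le> ?p n (\<nu> n \<omega>)} u"
  note [measurable] = \<nu>_M
  have [measurable]: "(\<lambda>x. lam (snd x) (fst x)) \<in> borel_measurable (M \<Otimes>\<^sub>M lborel)"
    using lam_pair_measurable by (simp add: split_beta')
  have f_meas[measurable]: "(\<lambda>x. ?f n (fst x) (snd x)) \<in> borel_measurable (M \<Otimes>\<^sub>M lborel)" for n
  proof -
    have "(\<lambda>x. ennreal (lam (snd x) (fst x)) * (if t < snd x \<and> snd x < T \<and> snd x \<le> ?p n (\<nu> n (fst x)) then 1 else 0))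
        \<in> borel_measurable (M \<Otimes>\<^sub>M lborel)" by measurable
    also have "(\<lambda>x. ennreal (lam (snd x) (fst x)) * (if t < snd x \<and> snd x < T \<and> snd x \<le> ?p n (\<nu> n (fst x)) then 1 else 0))
       = (\<lambda>x. ?f n (fst x) (snd x))" by (auto simp: indicator_def fun_eq_iff)
    finally show ?thesis .
  qed
  have f_le: "?f n \<omega> u \<le> ?w u" for n \<omega> u
    using lam_bound[of u \<omega>] by (auto simp: indicator_def intro!: ennreal_leI)
  have inner: "(\<lambda>n. \<integral>\<^sup>+u. ?f n \<omega> u \<partial>lborel) \<longlonglongrightarrow> 0"
    if \<omega>: "\<omega> \<in> space M" and h: "\<forall>n. \<forall>j\<le>n. Y (?p n j) \<omega> \<le> 0 \<longrightarrow> \<nu> n \<omega> \<le> j" for \<omega>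
  proof -
    have "(\<lambda>n. \<integral>\<^sup>+u. ?f n \<omega> u \<partial>lborel) \<longlonglongrightarrow> (\<integral>\<^sup>+u. 0 \<partial>(lborel :: real measure))"
    proof (rule nn_integral_dominated_convergence[where w = ?w])
      show "?f n \<omega> \<in> borel_measurable lborel" for n
        using measurable_compose_Pair1[OF \<omega>, of "\<lambda>x. ?f n (fst x) (snd x)"] f_meas by simp
      show "integral\<^sup>N lborel ?w < \<infinity>" by (rule lam_bound_integral)
      show "AE u in lborel. (\<lambda>n. ?f n \<omega> u) \<longlonglongrightarrow> 0"
      proof (rule AE_I2)
        fix u :: real
        show "(\<lambda>n. ?f n \<omega> u) \<longlonglongrightarrow> 0"
        proof (cases "t < u \<and> u < T \<and> Y u \<omega> < 0")
          case False
          then have "(\<lambda>n. ?f n \<omega> u) = (\<lambda>_. 0)"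
            by (auto simp: indicator_def lam_def fun_eq_iff)
          then show ?thesis by (simp only: tendsto_const)
        next
          case True
          have c: "continuous_on {t..T} (\<lambda>u. Y u \<omega>)"
            unfolding Y_def inc_def using t_nonneg
            by (intro continuous_intros continuous_on_compose2[OF W_continuous[OF \<omega>]]) auto
          have "\<forall>\<^sub>F n in sequentially. \<forall>j<Suc n. \<forall>v\<in>{?p n j..?p n (Suc j)}. \<bar>Y v \<omega> - Y (?p n j) \<omega>\<bar> < - Y u \<omega>"
            using True by (intro grid_uniform[OF t_less c]) auto
          then have "\<forall>\<^sub>F n in sequentially. ?f n \<omega> u = 0"
          proof eventually_elim
            case (elim n)
            obtain j where j: "j < Suc n" "u \<in> {?p n j<..?p n (Suc j)}"
              using chain_cover[of "Suc n" "?p n" u] gp_less[OF t_less] True by auto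
            have "Y (?p n j) \<omega> < 0" using elim j by (auto dest!: spec[of _ j] bspec[of _ _ u])
            then have "\<nu> n \<omega> \<le> j" using h j(1) by auto
            moreover have "?p n a \<le> ?p n b" if "a \<le> b" for a b
              using lift_Suc_mono_le[of "?p n"] gp_less[OF t_less, of "Suc n"] that by (simp add: less_imp_le)
            ultimately have "?p n (\<nu> n \<omega>) < u" using j(2) by fastforce
            then show ?case by simp
          qed
          then show ?thesis by (rule tendsto_eventually)
        qed
      qed
    qed (auto intro!: f_le)
    then show ?thesis by simp
  qed
  have "(\<lambda>n. \<integral>\<^sup>+\<omega>. (\<integral>\<^sup>+u. ?f n \<omega> u \<partial>lborel) \<partial>M) \<longlonglongrightarrow> (\<integral>\<^sup>+\<omega>. 0 \<partial>M)"
  proof (rule nn_integral_dominated_convergence[where w = "\<lambda>_. integral\<^sup>N lborel ?w"])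
    show "(\<lambda>\<omega>. \<integral>\<^sup>+u. ?f n \<omega> u \<partial>lborel) \<in> borel_measurable M" for n
      using lborel.borel_measurable_nn_integral[of "\<lambda>\<omega> u. ?f n \<omega> u" M] f_meas[of n]
      by (simp add: split_beta')
    show "(\<integral>\<^sup>+\<omega>. integral\<^sup>N lborel ?w \<partial>M) < \<infinity>"
      using lam_bound_integral by (simp add: emeasure_space_1)
    show "AE \<omega> in M. (\<lambda>n. \<integral>\<^sup>+u. ?f n \<omega> u \<partial>lborel) \<longlonglongrightarrow> 0"
      using \<nu> AE_space by eventually_elim (rule inner)
    show "AE \<omega> in M. (\<integral>\<^sup>+u. ?f n \<omega> u \<partial>lborel) \<le> integral\<^sup>N lborel ?w" for n
      by (intro AE_I2 nn_integral_mono f_le)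
  qed auto
  then show ?thesis by simp
qed

end

section \<open>Optimal stopping on grids\<close>

context brownian
begin

text \<open>The first index at which one of the adapted events occurs is a stopping rule:
  \<open>\<nu> = i\<close> means \<open>E i\<close> without the earlier events. The condition on
  \<open>E N\<close> makes \<open>LEAST\<close> meaningful for every path.\<close>

lemma least_adapted:
  assumes p_mono: "\<forall>i j. i \<le> j \<longrightarrow> j \<le> N \<longrightarrow> p i \<le> p j" and p0: "0 \<le> p 0"
    and E_all: "\<forall>i\<le>N. E i \<in> sets (F (p i))" and EN: "E N = space M"
  defines "\<nu> \<equiv> \<lambda>\<omega>. LEAST i::nat. \<omega> \<in> E i"
  shows "\<omega> \<in> space M \<Longrightarrow> \<nu> \<omega> \<le> N" "\<omega> \<in> space M \<Longrightarrow> \<omega> \<in> E (\<nu> \<omega>)"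
    "i \<le> N \<Longrightarrow> {\<omega> \<in> space M. \<nu> \<omega> = i} \<in> sets (F (p i))"
    "\<nu> \<in> measurable M (count_space UNIV)"
proof -
  note p = p_mono[rule_format] and E = E_all[rule_format]
  show le: "\<nu> \<omega> \<le> N" if "\<omega> \<in> space M" for \<omega>
    unfolding \<nu>_def by (rule Least_le[of "\<lambda>i. \<omega> \<in> E i" N]) (use that EN in simp)
  show in_E: "\<omega> \<in> E (\<nu> \<omega>)" if "\<omega> \<in> space M" for \<omega>
    unfolding \<nu>_def by (rule LeastI[of "\<lambda>i. \<omega> \<in> E i" N]) (use that EN in simp)
  show ev: "{\<omega> \<in> space M. \<nu> \<omega> = i} \<in> sets (F (p i))" if i: "i \<le> N" for i
  proof -
    have E': "E j \<in> sets (F (p i))" if "j \<le> i" for j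
      using E[of j] p[OF that i] subalg_mono[of "p j" "p i"] that i by (auto simp: subalgebra_def)
    have "{\<omega> \<in> space M. \<nu> \<omega> = i} = E i - (\<Union>j<i. E j)"
    proof (intro set_eqI iffI)
      fix \<omega> assume "\<omega> \<in> {\<omega> \<in> space M. \<nu> \<omega> = i}"
      then have \<omega>: "\<omega> \<in> space M" "\<nu> \<omega> = i" by auto
      have "\<omega> \<notin> E j" if "j < i" for j
        by (rule not_less_Least[of j "\<lambda>i. \<omega> \<in> E i"]) (use that \<omega>(2) in \<open>simp add: \<nu>_def\<close>)
      then show "\<omega> \<in> E i - (\<Union>j<i. E j)"
        using in_E[OF \<omega>(1)] \<omega>(2) by auto
    next
      fix \<omega> assume \<omega>: "\<omega> \<in> E i - (\<Union>j<i. E j)"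
      then have "\<omega> \<in> space M" using sets.sets_into_space[OF E[OF i]] by (auto simp: space_F)
      moreover have "\<nu> \<omega> = i"
        unfolding \<nu>_def
      proof (rule Least_equality)
        show "\<omega> \<in> E i" using \<omega> by simp
        show "i \<le> j" if "\<omega> \<in> E j" for j using \<omega> that by (cases "i \<le> j") auto
      qed
      ultimately show "\<omega> \<in> {\<omega> \<in> space M. \<nu> \<omega> = i}" by simp
    qed
    also have "\<dots> \<in> sets (F (p i))" using E' by (intro sets.Diff sets.finite_UN) auto
    finally show ?thesis .
  qed
  show "\<nu> \<in> measurable M (count_space UNIV)"
  proof (subst measurable_count_space_eq2_countable)
    have "\<nu> -` {i} \<inter> space M \<in> events" for i
    proof (cases "i \<le> N")
      case True
      have "0 \<le> p i" using p0 p[of 0 i] True by simp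
      then show ?thesis
        using ev[OF True] subalg[of "p i"] by (auto simp: subalgebra_def vimage_def Int_def conj_commute)
    next
      case False
      then have "\<nu> -` {i} \<inter> space M = {}" using le by auto
      then show ?thesis by simp
    qed
    then show "\<nu> \<in> space M \<rightarrow> UNIV \<and> (\<forall>a\<in>UNIV. \<nu> -` {a} \<inter> space M \<in> events)" by simp
  qed
qed

text \<open>Every rule allowed in the definition of the value is thereby a rule for
  \<open>F\<close>, where the premium identity holds.\<close>

lemma natural_filtration_subset:
  assumes "\<And>u. u \<in> {t..T} \<Longrightarrow> X u \<in> borel_measurable (F u)" and "s \<le> T"
  shows "sets (natural_filtration M t T X s) \<subseteq> sets (F s)"
proof -
  have "{X u -` B \<inter> space M |u B. u \<in> {t..min s T} \<and> B \<in> sets borel} \<subseteq> sets (F s)"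
  proof safe
    fix u and B :: "real set" assume "u \<in> {t..min s T}" "B \<in> sets borel"
    then have "X u \<in> borel_measurable (F s)"
      by (intro measurable_F_mono[OF assms(1)]) auto
    from measurable_sets[OF this \<open>B \<in> sets borel\<close>] show "X u -` B \<inter> space M \<in> sets (F s)"
      by (simp add: space_F)
  qed
  then have "sigma_sets (space (F s)) {X u -` B \<inter> space M |u B. u \<in> {t..min s T} \<and> B \<in> sets borel} \<subseteq> sets (F s)"
    by (rule sets.sigma_sets_subset)
  then show ?thesis
    unfolding natural_filtration_def
    by (subst sets_measure_of) (auto simp: space_F)
qed

end

lemma natural_filtration_measurable:
  assumes "u \<in> {t..min s T}"
  shows "X u \<in> borel_measurable (natural_filtration M t T X s)"
proof (rule measurableI)
  fix B :: "real set" assume "B \<in> sets borel"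
  then have "X u -` B \<inter> space M \<in> sigma_sets (space M) {X u -` B \<inter> space M |u B. u \<in> {t..min s T} \<and> B \<in> sets borel}"
    using assms by (intro sigma_sets.Basic) blast
  then show "X u -` B \<inter> space (natural_filtration M t T X s) \<in> sets (natural_filtration M t T X s)"
    unfolding natural_filtration_def by (subst sets_measure_of) (auto simp: space_measure_of_conv)
qed simp

text \<open>In the price formula one null set serves all times simultaneously, so that the formula
  may be evaluated at random times.\<close>

locale put_price = put_model r \<sigma> M F W t T y0
  for r \<sigma> :: real and M :: "'a measure" and F W t T y0 +
  fixes K :: real and X :: "real \<Rightarrow> 'a \<Rightarrow> real"
  assumes K_pos: "K > 0"
    and X_F: "\<And>s. s \<in> {t..T} \<Longrightarrow> X s \<in> borel_measurable (F s)"
    and X_cont: "\<And>\<omega>. \<omega> \<in> space M \<Longrightarrow> continuous_on {t..T} (\<lambda>s. X s \<omega>)"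
    and X_eq: "AE \<omega> in M. \<forall>s\<in>{t..T}. X s \<omega> = K * B (T - s) * exp (\<sigma> * Y s \<omega>)"
begin

definition payoff :: "real \<Rightarrow> 'a \<Rightarrow> real" where
  "payoff s \<omega> = exp (- r * (s - t)) * max 0 (K - X s \<omega>)"

lemma X_M: "s \<in> {t..T} \<Longrightarrow> X s \<in> borel_measurable M"
  using measurable_F_M[OF X_F] t_nonneg by auto

lemma X_nonneg: "AE \<omega> in M. \<forall>s\<in>{t..T}. 0 \<le> X s \<omega>"
  using X_eq by eventually_elim (use K_pos B_pos in \<open>simp add: less_imp_le\<close>)

lemma payoff_nonneg: "payoff s \<omega> \<ge> 0"
  by (simp add: payoff_def)

lemma payoff_le: "AE \<omega> in M. \<forall>s\<in>{t..T}. payoff s \<omega> \<le> K"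
  using X_nonneg
proof eventually_elim
  case (elim \<omega>)
  have "payoff s \<omega> \<le> 1 * K" if "s \<in> {t..T}" for s
    unfolding payoff_def using elim that K_pos r_pos
    by (intro mult_mono) (auto simp: mult_nonneg_nonneg)
  then show ?case by simp
qed

lemma payoff_cont: "\<omega> \<in> space M \<Longrightarrow> continuous_on {t..T} (\<lambda>s. payoff s \<omega>)"
  unfolding payoff_def by (intro continuous_intros X_cont)

abbreviation p :: "nat \<Rightarrow> nat \<Rightarrow> real" where "p n \<equiv> gp t T (Suc n)"

lemma p_facts:
  "p n 0 = t" "p n (Suc n) = T" "i \<le> Suc n \<Longrightarrow> p n i \<in> {t..T}" "i < Suc n \<Longrightarrow> t \<le> p n i \<and> p n i < T"
  "i \<le> j \<Longrightarrow> p n i \<le> p n j"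
proof -
  have mono: "p n i \<le> p n j" if "i \<le> j" for i j
    using lift_Suc_mono_le[of "p n"] gp_less[OF t_less, of "Suc n"] that by (simp add: less_imp_le)
  then show "i \<le> j \<Longrightarrow> p n i \<le> p n j" .
  show "p n 0 = t" "p n (Suc n) = T" by auto
  show "i \<le> Suc n \<Longrightarrow> p n i \<in> {t..T}"
    using gp_ge[of t T "Suc n" i] gp_le[of t T i "Suc n"] t_less by simp
  show "t \<le> p n i \<and> p n i < T" if "i < Suc n"
  proof -
    have "p n i < p n (Suc i)" using gp_less[OF t_less] by simp
    also have "\<dots> \<le> T" using gp_le[of t T "Suc i" "Suc n"] that t_less by simp
    finally show ?thesis using gp_ge[of t T "Suc n" i] t_less by simp
  qed
qed

lemma payoff_grid_measurable:
  assumes [measurable]: "\<nu> \<in> measurable M (count_space UNIV)" and le: "\<And>\<omega>. \<omega> \<in> space M \<Longrightarrow> \<nu> \<omega> \<le> Suc n"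
  shows "(\<lambda>\<omega>. payoff (p n (\<nu> \<omega>)) \<omega>) \<in> borel_measurable M"
proof -
  have m: "(\<lambda>\<omega>. payoff (p n (min i (Suc n))) \<omega>) \<in> borel_measurable M" for i
    unfolding payoff_def using X_M[OF p_facts(3)[of "min i (Suc n)" n]] by measurable
  have "(\<lambda>\<omega>. payoff (p n (min (\<nu> \<omega>) (Suc n))) \<omega>) \<in> borel_measurable M"
    by (rule measurable_compose_countable[OF m]) measurable
  then show ?thesis
    by (rule measurable_cong[THEN iffD1, rotated]) (simp add: le min_absorb1)
qed

text \<open>Before maturity this is \<open>U_ge_payoff\<close>; at maturity both sides agree because
  \<open>B 0 = 1\<close>.\<close>

lemma payoff_le_stopped:
  "AE \<omega> in M. \<forall>i\<le>Suc n. \<nu> \<omega> = i \<longrightarrow> payoff (p n i) \<omega> \<le> K * stopped (Suc n) (p n) \<nu> \<omega>"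
  using X_eq
proof eventually_elim
  case (elim \<omega>)
  have pay: "payoff (p n i) \<omega> = K * (exp (- r * (p n i - t)) * max 0 (1 - B (T - p n i) * exp (\<sigma> * Y (p n i) \<omega>)))"
    if "i \<le> Suc n" for i
  proof -
    have "K - X (p n i) \<omega> = K * (1 - B (T - p n i) * exp (\<sigma> * Y (p n i) \<omega>))"
      using elim p_facts(3)[OF that] by (simp add: algebra_simps)
    then have "max 0 (K - X (p n i) \<omega>) = K * max 0 (1 - B (T - p n i) * exp (\<sigma> * Y (p n i) \<omega>))"
      using K_pos by (simp add: max_def zero_le_mult_iff)
    then show ?thesis by (simp add: payoff_def)
  qed
  show ?case
  proof (intro allI impI)
    fix i assume i: "i \<le> Suc n" "\<nu> \<omega> = i"
    show "payoff (p n i) \<omega> \<le> K * stopped (Suc n) (p n) \<nu> \<omega>"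
    proof (cases "i = Suc n")
      case True
      have "payoff T \<omega> = K * final \<omega>"
        using pay[of "Suc n"] p_facts(2)[of n] by (simp add: final_def B_0)
      then show ?thesis using i True p_facts(2)[of n] by (simp add: stopped_def)
    next
      case False
      then have "i < Suc n" using i by simp
      then show ?thesis
        using i p_facts(4)[of i n] K_pos U_ge_payoff[of "T - p n i" "Y (p n i) \<omega>"]
        by (simp add: pay stopped_def)
    qed
  qed
qed

lemma expectation_payoff_le:
  assumes \<nu>_M: "\<nu> \<in> measurable M (count_space UNIV)" and le: "\<And>\<omega>. \<omega> \<in> space M \<Longrightarrow> \<nu> \<omega> \<le> Suc n"
    and \<nu>_F: "\<And>i. i \<le> Suc n \<Longrightarrow> {\<omega> \<in> space M. \<nu> \<omega> = i} \<in> sets (F (p n i))"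
  shows "expectation (\<lambda>\<omega>. payoff (p n (\<nu> \<omega>)) \<omega>) \<le> K * U (T - t) y0"
proof -
  note m = payoff_grid_measurable[OF \<nu>_M le]
  have U0: "U (T - t) y0 \<ge> 0" using U_nonneg t_less by simp
  have "(\<integral>\<^sup>+\<omega>. ennreal (payoff (p n (\<nu> \<omega>)) \<omega>) \<partial>M) \<le> (\<integral>\<^sup>+\<omega>. ennreal K * ennreal (stopped (Suc n) (p n) \<nu> \<omega>) \<partial>M)"
  proof (rule nn_integral_mono_AE)
    show "AE \<omega> in M. ennreal (payoff (p n (\<nu> \<omega>)) \<omega>) \<le> ennreal K * ennreal (stopped (Suc n) (p n) \<nu> \<omega>)"
      using payoff_le_stopped[of n \<nu>] AE_space
    proof eventually_elim
      case (elim \<omega>)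
      then show ?case using le[of \<omega>] K_pos by (simp add: ennreal_mult'[symmetric] ennreal_leI)
    qed
  qed
  also have "\<dots> \<le> ennreal K * ennreal (U (T - t) y0)"
  proof -
    have "(\<integral>\<^sup>+\<omega>. ennreal K * ennreal (stopped (Suc n) (p n) \<nu> \<omega>) \<partial>M)
      = ennreal K * (\<integral>\<^sup>+\<omega>. ennreal (stopped (Suc n) (p n) \<nu> \<omega>) \<partial>M)"
    proof (rule nn_integral_cmult)
      have "(\<lambda>\<omega>. if i < Suc n then exp (- r * (p n i - t)) * U (T - p n i) (Y (p n i) \<omega>) else final \<omega>)
         \<in> borel_measurable M" for i
        by measurable
      from measurable_compose_countable[OF this \<nu>_M]
      show "(\<lambda>\<omega>. ennreal (stopped (Suc n) (p n) \<nu> \<omega>)) \<in> borel_measurable M"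
        unfolding stopped_def by measurable
    qed
    also have "(\<integral>\<^sup>+\<omega>. ennreal (stopped (Suc n) (p n) \<nu> \<omega>) \<partial>M) \<le> ennreal (U (T - t) y0)"
      by (rule stopped_le) (use p_facts le \<nu>_F in auto)
    finally show ?thesis by (simp add: mult_left_mono)
  qed
  finally have "(\<integral>\<^sup>+\<omega>. ennreal (payoff (p n (\<nu> \<omega>)) \<omega>) \<partial>M) \<le> ennreal (K * U (T - t) y0)"
    using K_pos by (simp add: ennreal_mult')
  moreover have "expectation (\<lambda>\<omega>. payoff (p n (\<nu> \<omega>)) \<omega>) = enn2real (\<integral>\<^sup>+\<omega>. ennreal (payoff (p n (\<nu> \<omega>)) \<omega>) \<partial>M)"
    using m payoff_nonneg by (intro integral_eq_nn_integral) auto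
  ultimately show ?thesis
    using K_pos U0 by (simp add: enn2real_leI)
qed

text \<open>Round \<tau> up to the next grid point. The result is a stopping rule with finitely many
  values, covered by \<open>expectation_payoff_le\<close>; as the grid is refined the payoffs
  converge by path continuity, and they are bounded by \<open>K\<close>.\<close>

lemma expectation_stopping_le:
  assumes \<tau>: "stopping_time (natural_filtration M t T X) \<tau>" and \<tau>_in: "\<And>\<omega>. \<omega> \<in> space M \<Longrightarrow> \<tau> \<omega> \<in> {t..T}"
  shows "expectation (\<lambda>\<omega>. payoff (\<tau> \<omega>) \<omega>) \<le> K * U (T - t) y0"
proof -
  define E where "E n i = {\<omega> \<in> space M. \<tau> \<omega> \<le> p n i}" for n i
  define \<nu> where "\<nu> n \<omega> = (LEAST i. \<omega> \<in> E n i)" for n \<omega>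
  have E_F: "E n i \<in> sets (F (p n i))" if "i \<le> Suc n" for n i
  proof -
    have "space (natural_filtration M t T X (p n i)) = space M"
      by (simp add: natural_filtration_def space_measure_of_conv)
    with predE[OF stopping_timeD[OF \<tau>, of "p n i"]]
    have "E n i \<in> sets (natural_filtration M t T X (p n i))" by (simp add: E_def)
    moreover have "p n i \<le> T" using p_facts(3)[OF that] by simp
    ultimately show ?thesis using natural_filtration_subset[of t T X "p n i", OF X_F] by blast
  qed
  have EN: "E n (Suc n) = space M" for n using \<tau>_in by (auto simp: E_def)
  have p0: "0 \<le> p n 0" for n using t_nonneg by simp
  have "\<forall>i j. i \<le> j \<longrightarrow> j \<le> Suc n \<longrightarrow> p n i \<le> p n j" "\<forall>i\<le>Suc n. E n i \<in> sets (F (p n i))" for n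
    using p_facts(5) E_F by auto
  note la = least_adapted[OF this(1) p0 this(2) EN, folded \<nu>_def]
  have close: "\<bar>p n (\<nu> n \<omega>) - \<tau> \<omega>\<bar> \<le> (T - t) / real (Suc n)" if \<omega>: "\<omega> \<in> space M" for n \<omega>
  proof -
    have "\<tau> \<omega> \<le> p n (\<nu> n \<omega>)" using la(2)[OF \<omega>] by (simp add: E_def)
    moreover have "p n (\<nu> n \<omega>) \<le> \<tau> \<omega> + (T - t) / real (Suc n)"
    proof (cases "\<nu> n \<omega>")
      case 0
      then show ?thesis using \<tau>_in[OF \<omega>] t_less by (simp add: add_increasing2)
    next
      case (Suc k)
      then have "\<omega> \<notin> E n k" using not_less_Least[of k "\<lambda>i. \<omega> \<in> E n i"] by (simp add: \<nu>_def)
      then have "p n k < \<tau> \<omega>" using \<omega> by (simp add: E_def)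
      then show ?thesis using gp_diff[of t T "Suc n" k] Suc by simp
    qed
    ultimately show ?thesis by simp
  qed
  have lim: "(\<lambda>n. payoff (p n (\<nu> n \<omega>)) \<omega>) \<longlonglongrightarrow> payoff (\<tau> \<omega>) \<omega>" if \<omega>: "\<omega> \<in> space M" for \<omega>
  proof -
    have "(\<lambda>n. p n (\<nu> n \<omega>)) \<longlonglongrightarrow> \<tau> \<omega>"
    proof (rule LIM_zero_cancel, rule tendsto_rabs_zero_cancel, rule tendsto_sandwich[OF _ _ tendsto_const])
      show "(\<lambda>n. (T - t) / real (Suc n)) \<longlonglongrightarrow> 0" by real_asymp
      show "\<forall>\<^sub>F n in sequentially. \<bar>p n (\<nu> n \<omega>) - \<tau> \<omega>\<bar> \<le> (T - t) / real (Suc n)"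
        using close[OF \<omega>] by (intro always_eventually allI)
    qed simp
    moreover have "p n (\<nu> n \<omega>) \<in> {t..T}" for n
      using la(1)[OF \<omega>] by (intro p_facts(3)) simp
    ultimately show ?thesis
      using payoff_cont[OF \<omega>] \<tau>_in[OF \<omega>] unfolding continuous_on_sequentially by (auto simp: comp_def)
  qed
  have meas: "(\<lambda>\<omega>. payoff (p n (\<nu> n \<omega>)) \<omega>) \<in> borel_measurable M" for n
    by (rule payoff_grid_measurable) (use la(1,4) in auto)
  have "(\<lambda>n. expectation (\<lambda>\<omega>. payoff (p n (\<nu> n \<omega>)) \<omega>)) \<longlonglongrightarrow> expectation (\<lambda>\<omega>. payoff (\<tau> \<omega>) \<omega>)"
  proof (rule integral_dominated_convergence[where w = "\<lambda>_. K"])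
    show "(\<lambda>\<omega>. payoff (\<tau> \<omega>) \<omega>) \<in> borel_measurable M"
      by (rule borel_measurable_LIMSEQ_real[OF lim meas])
    show "AE \<omega> in M. norm (payoff (p n (\<nu> n \<omega>)) \<omega>) \<le> K" for n
      using payoff_le AE_space
    proof eventually_elim
      case (elim \<omega>)
      have "p n (\<nu> n \<omega>) \<in> {t..T}" using la(1)[OF elim(2)] by (intro p_facts(3)) simp
      then show ?case using elim payoff_nonneg by simp
    qed
  qed (use meas lim in auto)
  then show ?thesis
  proof (rule LIMSEQ_le_const2)
    show "\<exists>N. \<forall>n\<ge>N. expectation (\<lambda>\<omega>. payoff (p n (\<nu> n \<omega>)) \<omega>) \<le> K * U (T - t) y0"
      by (intro exI allI impI expectation_payoff_le) (use la(1,3,4) in auto)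
  qed
qed

lemma payoff_eq_stopped:
  "AE \<omega> in M. \<forall>i\<le>Suc n. \<nu> \<omega> = i \<and> (i < Suc n \<longrightarrow> X (p n i) \<omega> \<le> K * B (T - p n i)) \<longrightarrow>
     payoff (p n i) \<omega> = K * stopped (Suc n) (p n) \<nu> \<omega>"
  using X_eq
proof eventually_elim
  case (elim \<omega>)
  show ?case
  proof (intro allI impI, elim conjE)
    fix i assume i: "i \<le> Suc n" "\<nu> \<omega> = i" and below: "i < Suc n \<longrightarrow> X (p n i) \<omega> \<le> K * B (T - p n i)"
    let ?e = "exp (\<sigma> * Y (p n i) \<omega>)"
    have x: "X (p n i) \<omega> = K * B (T - p n i) * ?e"
      using elim p_facts(3)[OF i(1)] by simp
    then have kx: "K - X (p n i) \<omega> = K * (1 - B (T - p n i) * ?e)"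
      by (simp add: algebra_simps)
    show "payoff (p n i) \<omega> = K * stopped (Suc n) (p n) \<nu> \<omega>"
    proof (cases "i = Suc n")
      case True
      have "max 0 (K - X T \<omega>) = K * max 0 (1 - exp (\<sigma> * Y T \<omega>))"
        using kx True K_pos p_facts(2)[of n] by (simp add: B_0 max_def zero_le_mult_iff)
      then show ?thesis using i True p_facts(2)[of n] by (simp add: stopped_def payoff_def final_def)
    next
      case False
      then have lt: "i < Suc n" using i by simp
      then have "K * B (T - p n i) * ?e \<le> K * B (T - p n i) * 1" using below x by simp
      moreover have "K * B (T - p n i) > 0" using K_pos B_pos by simp
      ultimately have "?e \<le> 1" by (simp only: mult_le_cancel_left_pos)
      then have y: "Y (p n i) \<omega> \<le> 0" using \<sigma>_pos by (simp add: mult_le_0_iff)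
      then have u: "U (T - p n i) (Y (p n i) \<omega>) = 1 - B (T - p n i) * ?e" by (simp add: U_def)
      moreover have "U (T - p n i) (Y (p n i) \<omega>) \<ge> 0" using U_nonneg p_facts(4)[OF lt] by simp
      ultimately have "max 0 (K - X (p n i) \<omega>) = K * U (T - p n i) (Y (p n i) \<omega>)"
        using K_pos kx by simp
      then show ?thesis using i lt by (simp add: stopped_def payoff_def)
    qed
  qed
qed

text \<open>The number \<open>v\<close> stands for the supremum and is used only through its bounds.
  The rule that stops at the first grid point at or below the boundary earns \<open>K\<close> times
  the stopped candidate value, by \<open>payoff_eq_stopped\<close>, so its shortfall is controlled
  by \<open>stopped_loss\<close>.\<close>

lemma value_ge:
  assumes V: "\<And>\<tau>. stopping_time (natural_filtration M t T X) \<tau> \<Longrightarrow> (\<forall>\<omega>\<in>space M. \<tau> \<omega> \<in> {t..T}) \<Longrightarrow>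
      expectation (\<lambda>\<omega>. payoff (\<tau> \<omega>) \<omega>) \<le> v"
    and v: "v \<ge> 0"
  shows "K * U (T - t) y0 \<le> v"
proof -
  \<comment> \<open>The test uses \<open>X\<close> and not \<open>Y\<close>: the two agree only
    almost surely, and without completeness only the test on \<open>X\<close> is certain to belong
    to the natural filtration of the price. The last event is the whole space, so the rule stops at
    maturity at the latest.\<close>
  define E where "E n i = (if i < Suc n then {\<omega> \<in> space M. X (p n i) \<omega> \<le> K * B (T - p n i)} else space M)" for n i
  define \<nu> where "\<nu> n \<omega> = (LEAST i. \<omega> \<in> E n i)" for n \<omega>
  have "E n i \<in> sets (F (p n i))" if "i \<le> Suc n" for n i
  proof -
    have "{\<omega> \<in> space (F (p n i)). X (p n i) \<omega> \<le> K * B (T - p n i)} \<in> sets (F (p n i))"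
      using X_F[OF p_facts(3)[OF that]] by measurable
    then show ?thesis using sets.top[of "F (p n i)"] by (simp add: E_def space_F)
  qed
  then have E_F: "\<forall>i\<le>Suc n. E n i \<in> sets (F (p n i))" for n by simp
  have EN: "E n (Suc n) = space M" for n by (simp add: E_def)
  have mono: "\<forall>i j. i \<le> j \<longrightarrow> j \<le> Suc n \<longrightarrow> p n i \<le> p n j" for n using p_facts(5) by simp
  have p0: "0 \<le> p n 0" for n using t_nonneg by simp
  note la = least_adapted[OF mono p0 E_F EN, folded \<nu>_def]
  have la1: "\<nu> n \<omega> \<le> Suc n" and la2: "\<omega> \<in> E n (\<nu> n \<omega>)" if "\<omega> \<in> space M" for n \<omega>
    by (rule la(1)[OF that], rule la(2)[OF that])
  have in_grid: "p n (\<nu> n \<omega>) \<in> {t..T}" if "\<omega> \<in> space M" for n \<omega>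
    using la1[OF that] by (rule p_facts(3))
  have stop: "stopping_time (natural_filtration M t T X) (\<lambda>\<omega>. p n (\<nu> n \<omega>))" for n
  proof
    fix s
    let ?N = "natural_filtration M t T X s"
    have sp: "space ?N = space M" by (simp add: natural_filtration_def space_measure_of_conv)
    show "Measurable.pred ?N (\<lambda>\<omega>. p n (\<nu> n \<omega>) \<le> s)"
    \<comment> \<open>If \<open>s < T\<close>, the last index cannot have been chosen yet, and only
      events that inspect the price up to time \<open>s\<close> are involved.\<close>
    proof (cases "T \<le> s")
      case True
      have "Measurable.pred ?N (\<lambda>\<omega>. True)" by simp
      then show ?thesis
      proof (rule measurable_cong[THEN iffD1, rotated])
        fix \<omega> assume "\<omega> \<in> space ?N"
        then show "True = (p n (\<nu> n \<omega>) \<le> s)" using in_grid[of \<omega> n] True by (simp add: sp)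
      qed
    next
      case False
      have "{\<omega> \<in> space ?N. p n (\<nu> n \<omega>) \<le> s}
          = (\<Union>i\<in>{i. i < Suc n \<and> p n i \<le> s}. {\<omega> \<in> space ?N. X (p n i) \<omega> \<le> K * B (T - p n i)})"
      proof (intro set_eqI iffI)
        fix \<omega> assume "\<omega> \<in> {\<omega> \<in> space ?N. p n (\<nu> n \<omega>) \<le> s}"
        then have \<omega>: "\<omega> \<in> space M" "p n (\<nu> n \<omega>) \<le> s" by (auto simp: sp)
        have "\<nu> n \<omega> \<noteq> Suc n"
          using \<omega>(2) False p_facts(2)[of n] by auto
        then have "\<nu> n \<omega> < Suc n"
          by (rule le_neq_implies_less[OF la1[OF \<omega>(1)]])
        moreover have "\<omega> \<in> E n (\<nu> n \<omega>)" by (rule la2[OF \<omega>(1)])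
        ultimately have "\<nu> n \<omega> < Suc n" "X (p n (\<nu> n \<omega>)) \<omega> \<le> K * B (T - p n (\<nu> n \<omega>))"
          by (simp_all add: E_def)
        then show "\<omega> \<in> (\<Union>i\<in>{i. i < Suc n \<and> p n i \<le> s}. {\<omega> \<in> space ?N. X (p n i) \<omega> \<le> K * B (T - p n i)})"
          using \<omega> by (auto simp: sp)
      next
        fix \<omega> assume "\<omega> \<in> (\<Union>i\<in>{i. i < Suc n \<and> p n i \<le> s}. {\<omega> \<in> space ?N. X (p n i) \<omega> \<le> K * B (T - p n i)})"
        then obtain i where i: "i < Suc n" "p n i \<le> s" "\<omega> \<in> space M" "\<omega> \<in> E n i"
          by (auto simp: sp E_def)
        have "\<nu> n \<omega> \<le> i" unfolding \<nu>_def by (rule Least_le[of "\<lambda>i. \<omega> \<in> E n i" i]) (rule i(4))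
        then have "p n (\<nu> n \<omega>) \<le> s" using p_facts(5)[of "\<nu> n \<omega>" i n] i(2) by simp
        then show "\<omega> \<in> {\<omega> \<in> space ?N. p n (\<nu> n \<omega>) \<le> s}" using i(3) by (simp add: sp)
      qed
      also have "\<dots> \<in> sets ?N"
      proof (intro sets.finite_UN)
        fix i assume "i \<in> {i. i < Suc n \<and> p n i \<le> s}"
        then have "X (p n i) \<in> borel_measurable ?N"
          using p_facts(3)[of i n] by (intro natural_filtration_measurable) auto
        then show "{\<omega> \<in> space ?N. X (p n i) \<omega> \<le> K * B (T - p n i)} \<in> sets ?N" by measurable
      qed auto
      finally show ?thesis by (simp add: pred_def)
    qed
  qed
  let ?R = "\<lambda>n. \<integral>\<^sup>+\<omega>. (\<integral>\<^sup>+u. ennreal (lam u \<omega>) * indicator {u. t < u \<and> u < T \<and> u \<le> p n (\<nu> n \<omega>)} u \<partial>lborel) \<partial>M"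
  have R: "?R \<longlonglongrightarrow> 0"
  proof (rule loss_tendsto_0)
    show "\<nu> n \<in> measurable M (count_space UNIV)" for n by (rule la(4))
    show "AE \<omega> in M. \<forall>n. \<forall>j\<le>n. Y (p n j) \<omega> \<le> 0 \<longrightarrow> \<nu> n \<omega> \<le> j"
      using X_eq AE_space
    proof eventually_elim
      case (elim \<omega>)
      show ?case
      proof (intro allI impI)
        fix n j assume j: "j \<le> n" and y: "Y (p n j) \<omega> \<le> 0"
        have "exp (\<sigma> * Y (p n j) \<omega>) \<le> 1" using y \<sigma>_pos by (simp add: mult_nonneg_nonpos)
        then have "K * B (T - p n j) * exp (\<sigma> * Y (p n j) \<omega>) \<le> K * B (T - p n j) * 1"
          using K_pos B_pos[of "T - p n j"] by (intro mult_left_mono) (auto simp: less_imp_le)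
        then have "\<omega> \<in> E n j" using elim j p_facts(3)[of j n] by (simp add: E_def)
        then show "\<nu> n \<omega> \<le> j" unfolding \<nu>_def by (rule Least_le[of "\<lambda>i. \<omega> \<in> E n i" j])
      qed
    qed
  qed
  have bound: "ennreal (K * U (T - t) y0) \<le> ennreal v + ennreal K * ?R n" for n
  proof -
    have m: "(\<lambda>\<omega>. payoff (p n (\<nu> n \<omega>)) \<omega>) \<in> borel_measurable M"
      by (rule payoff_grid_measurable) (use la(1,4) in auto)
    have "(\<integral>\<^sup>+\<omega>. ennreal K * ennreal (stopped (Suc n) (p n) (\<nu> n) \<omega>) \<partial>M)
        = (\<integral>\<^sup>+\<omega>. ennreal (payoff (p n (\<nu> n \<omega>)) \<omega>) \<partial>M)"
    proof (rule nn_integral_cong_AE)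
      show "AE \<omega> in M. ennreal K * ennreal (stopped (Suc n) (p n) (\<nu> n) \<omega>) = ennreal (payoff (p n (\<nu> n \<omega>)) \<omega>)"
        using payoff_eq_stopped[of n "\<nu> n"] AE_space
      proof eventually_elim
        case (elim \<omega>)
        have "\<nu> n \<omega> < Suc n \<longrightarrow> X (p n (\<nu> n \<omega>)) \<omega> \<le> K * B (T - p n (\<nu> n \<omega>))"
        proof
          assume "\<nu> n \<omega> < Suc n"
          moreover have "\<omega> \<in> E n (\<nu> n \<omega>)" by (rule la2[OF elim(2)])
          ultimately show "X (p n (\<nu> n \<omega>)) \<omega> \<le> K * B (T - p n (\<nu> n \<omega>))" by (simp add: E_def)
        qed
        moreover have "\<nu> n \<omega> \<le> Suc n" by (rule la1[OF elim(2)])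
        ultimately have "payoff (p n (\<nu> n \<omega>)) \<omega> = K * stopped (Suc n) (p n) (\<nu> n) \<omega>"
          using elim(1) by blast
        then show ?case using K_pos by (simp add: ennreal_mult')
      qed
    qed
    also have "\<dots> = ennreal (expectation (\<lambda>\<omega>. payoff (p n (\<nu> n \<omega>)) \<omega>))"
    proof (rule nn_integral_eq_integral)
      show "integrable M (\<lambda>\<omega>. payoff (p n (\<nu> n \<omega>)) \<omega>)"
      proof (rule integrable_const_bound[where B = K])
        show "AE \<omega> in M. norm (payoff (p n (\<nu> n \<omega>)) \<omega>) \<le> K"
          using payoff_le AE_space by eventually_elim (use in_grid payoff_nonneg in simp)
      qed (rule m)
    qed (use payoff_nonneg in simp)
    also have "\<dots> \<le> ennreal v"
      using V[OF stop] in_grid by (intro ennreal_leI) simp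
    finally have le: "(\<integral>\<^sup>+\<omega>. ennreal K * ennreal (stopped (Suc n) (p n) (\<nu> n) \<omega>) \<partial>M) \<le> ennreal v" .
    have sm: "(\<lambda>\<omega>. ennreal (stopped (Suc n) (p n) (\<nu> n) \<omega>)) \<in> borel_measurable M"
    proof -
      have "(\<lambda>\<omega>. if i < Suc n then exp (- r * (p n i - t)) * U (T - p n i) (Y (p n i) \<omega>) else final \<omega>)
         \<in> borel_measurable M" for i
        by measurable
      from measurable_compose_countable[OF this la(4)]
      show ?thesis unfolding stopped_def by measurable
    qed
    have "ennreal (U (T - t) y0) \<le> (\<integral>\<^sup>+\<omega>. ennreal (stopped (Suc n) (p n) (\<nu> n) \<omega>) \<partial>M) + ?R n"
      by (rule stopped_loss) (use p_facts la in auto)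
    then have "ennreal K * ennreal (U (T - t) y0)
        \<le> ennreal K * ((\<integral>\<^sup>+\<omega>. ennreal (stopped (Suc n) (p n) (\<nu> n) \<omega>) \<partial>M) + ?R n)"
      by (rule mult_left_mono) simp
    also have "\<dots> = (\<integral>\<^sup>+\<omega>. ennreal K * ennreal (stopped (Suc n) (p n) (\<nu> n) \<omega>) \<partial>M) + ennreal K * ?R n"
      unfolding distrib_left nn_integral_cmult[OF sm] ..
    also have "\<dots> \<le> ennreal v + ennreal K * ?R n"
      using le by (rule add_right_mono)
    finally show ?thesis using K_pos by (simp add: ennreal_mult')
  qed
  have "(\<lambda>n. ennreal v + ennreal K * ?R n) \<longlonglongrightarrow> ennreal v + ennreal K * 0"
    using R by (intro tendsto_add tendsto_const ennreal_tendsto_cmult) auto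
  then have "ennreal (K * U (T - t) y0) \<le> ennreal v + ennreal K * 0"
    using bound by (intro LIMSEQ_le_const) auto
  then show ?thesis using v by (simp add: ennreal_le_iff)
qed

end

section \<open>Identification of the price process\<close>

context put_model
begin

text \<open>The coefficient is singular at \<open>T\<close>, so \<open>sde_explicit\<close> is
  applied on \<open>[t, s]\<close> for each \<open>s < T\<close>. Rational times give a common null
  set, and path continuity extends the formula to all times, including \<open>T\<close>.\<close>

lemma price_explicit:
  assumes K: "K > 0" and x: "x > 0" and y0: "y0 = ln (x / (K * B (T - t))) / \<sigma>"
    and sde: "sde_solution M F W (\<lambda>s y. (r - \<delta> s) * y) (\<lambda>s y. \<sigma> * y) t T x X"
    and \<delta>: "\<And>s. t \<le> s \<Longrightarrow> s < T \<Longrightarrow> r - \<delta> s = - dB (T - s) / B (T - s) - \<sigma>\<^sup>2 / 2"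
  shows "AE \<omega> in M. \<forall>s\<in>{t..T}. X s \<omega> = K * B (T - s) * exp (\<sigma> * Y s \<omega>)"
proof -
  \<comment> \<open>The product \<open>G s = B (T - s) * e s\<close> is the deterministic factor
    with logarithmic derivative \<open>r - \<delta> s\<close>. The exponents of \<open>e\<close> and
    \<open>gbm\<close> each contribute \<open>- \<sigma>\<^sup>2 / 2\<close> per unit time; together
    they give \<sigma> times the drift \<open>- \<sigma>\<close> of \<open>Y\<close>.\<close>
  define e where "e s = exp (- \<sigma>\<^sup>2 / 2 * (s - t))" for s
  define G where "G s = B (T - s) * e s" for s
  define G' where "G' s = - dB (T - s) * e s + B (T - s) * (e s * (- \<sigma>\<^sup>2 / 2))" for s
  have e_pos: "e s > 0" for s by (simp add: e_def)
  have G_pos: "G s > 0" for s using B_pos e_pos by (simp add: G_def)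
  have start: "exp (\<sigma> * y0) = x / (K * B (T - t))"
    using \<sigma>_pos K x B_pos[of "T - t"] by (simp add: y0)
  have G_deriv: "(G has_real_derivative G' s) (at s)" if "s < T" for s
  proof -
    have "((\<lambda>s. T - s) has_real_derivative - 1) (at s)" by (auto intro!: derivative_eq_intros)
    from DERIV_chain2[OF B_deriv this] that
    have 1: "((\<lambda>s. B (T - s)) has_real_derivative dB (T - s) * - 1) (at s)" by simp
    have 2: "(e has_real_derivative e s * (- \<sigma>\<^sup>2 / 2)) (at s)"
      unfolding e_def[abs_def] by (auto intro!: derivative_eq_intros)
    show ?thesis
      unfolding G_def[abs_def] G'_def by (rule DERIV_cong[OF DERIV_mult[OF 1 2]]) (simp add: algebra_simps)
  qed
  have each: "AE \<omega> in M. X s \<omega> = K * B (T - s) * exp (\<sigma> * Y s \<omega>)" if s: "t \<le> s" "s < T" for s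
  proof -
    have "AE \<omega> in M. X s \<omega> = x / G t * G s * gbm \<sigma> t s \<omega>"
    proof (rule sde_explicit[OF t_nonneg less_imp_le[OF s(2)] \<sigma>_pos _ _ _ _ sde])
      show "G u > 0" for u by (rule G_pos)
      show "(G has_real_derivative G' u) (at u)" if "u \<in> {t..s}" for u
        using that s by (intro G_deriv) auto
      show "continuous_on {t..s} G'"
      proof -
        have 1: "continuous_on {t..s} (\<lambda>u. B (T - u))"
          by (rule continuous_on_compose2[of UNIV B])
             (auto simp: continuous_on_eq_continuous_at isCont_B intro!: continuous_intros)
        have 2: "continuous_on {t..s} (\<lambda>u. phi (\<alpha> * sqrt (T - u)))"
          by (rule continuous_on_compose2[OF continuous_phi[of UNIV]]) (auto intro!: continuous_intros)
        have 3: "continuous_on {t..s} e" unfolding e_def by (intro continuous_intros)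
        have "sqrt (T - u) \<noteq> 0" if "u \<in> {t..s}" for u using that s by auto
        then show ?thesis
          unfolding G'_def dB_def by (intro continuous_intros 1 2 3) auto
      qed
      show "r - \<delta> u = G' u / G u" if "u \<in> {t..s}" for u
      proof -
        have "G' u / G u = - dB (T - u) / B (T - u) - \<sigma>\<^sup>2 / 2"
          using e_pos[of u] B_pos[of "T - u"] by (simp add: G_def G'_def field_simps)
        then show ?thesis using \<delta>[of u] that s by simp
      qed
    qed (use s in auto)
    then show ?thesis
    proof eventually_elim
      case (elim \<omega>)
      have "exp (\<sigma> * Y s \<omega>) = exp (\<sigma> * y0) * (e s * gbm \<sigma> t s \<omega>)"
        unfolding e_def gbm_def exp_add[symmetric] using s t_nonneg
        by (intro arg_cong[where f = exp]) (simp add: Y_def max_def power2_eq_square field_simps)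
      moreover have "G t = B (T - t)" by (simp add: G_def e_def)
      ultimately show ?case
        using elim K B_pos[of "T - t"] unfolding start G_def by simp
    qed
  qed
  have "AE \<omega> in M. \<forall>q::rat. t \<le> of_rat q \<and> of_rat q < T \<longrightarrow> X (of_rat q) \<omega> = K * B (T - of_rat q) * exp (\<sigma> * Y (of_rat q) \<omega>)"
    unfolding AE_all_countable using each by (auto simp: AE_conj_iff)
  then show ?thesis
    using AE_space
  proof eventually_elim
    case (elim \<omega>)
    define d where "d s = \<bar>X s \<omega> - K * B (T - s) * exp (\<sigma> * Y s \<omega>)\<bar>" for s
    have B_cont: "continuous_on {t..T} (\<lambda>s. B (T - s))"
      by (rule continuous_on_compose2[of UNIV B])
         (auto simp: continuous_on_eq_continuous_at isCont_B intro!: continuous_intros)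
    have "continuous_on {t..T} (\<lambda>s. Y s \<omega>)"
      unfolding Y_def inc_def using t_nonneg
      by (intro continuous_intros continuous_on_compose2[OF W_continuous[OF elim(2)]]) auto
    moreover have "continuous_on {t..T} (\<lambda>s. X s \<omega>)" using sde elim(2) by (simp add: sde_solution_def)
    ultimately have d_cont: "continuous_on {t..T} d"
      unfolding d_def by (intro continuous_intros B_cont)
    show ?case
    proof (rule ccontr)
      assume "\<not> ?case"
      then obtain s where s: "s \<in> {t..T}" "d s > 0" by (auto simp: d_def)
      then obtain \<eta> where \<eta>: "\<eta> > 0" "\<And>v. v \<in> {t..T} \<Longrightarrow> dist v s < \<eta> \<Longrightarrow> dist (d v) (d s) < d s"
        using d_cont unfolding continuous_on_iff by blast
      \<comment> \<open>A discrepancy at \<open>s\<close> would persist nearby. The interval is cut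
        off strictly below \<open>T\<close> so that it supplies a rational time at which the formula
        is known, even when \<open>s = T\<close>.\<close>
      have "max t (s - \<eta>) < min T (s + \<eta>)" using s \<eta>(1) t_less by auto
      then obtain q where q: "q \<in> \<rat>" "max t (s - \<eta>) < q" "q < min T (s + \<eta>)"
        using Rats_dense_in_real by blast
      then obtain q' where "q = of_rat q'" by (auto simp: Rats_def)
      then have "d q = 0" using elim(1) q by (simp add: d_def)
      moreover have "dist (d q) (d s) < d s" using q by (intro \<eta>(2)) (auto simp: dist_real_def abs_less_iff)
      ultimately show False using s by (simp add: dist_real_def)
    qed
  qed
qed

end

section \<open>The value function and the exercise region\<close>

theorem theorem4p1:
  fixes M :: "'a measure" and F :: "real \<Rightarrow> 'a measure" and W :: "real \<Rightarrow> 'a \<Rightarrow> real"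
    and X :: "real \<Rightarrow> real \<Rightarrow> real \<Rightarrow> 'a \<Rightarrow> real"
    and K T r \<sigma> :: real and \<delta> :: "real \<Rightarrow> real" and N n :: "real \<Rightarrow> real"
  assumes "K > 0" and "T > 0" and "r > 0" and "\<sigma> > 0"
    and N: "N = cdf std_normal_distribution" and n: "n = std_normal_density"
    and delta: "\<And>t. t \<in> {0..<T} \<Longrightarrow>
      \<delta> t = r
        - n (sqrt ((2 * r + \<sigma>\<^sup>2) * (T - t)))
          / (1 - 2 * \<sigma> / sqrt (2 * r + \<sigma>\<^sup>2) * (N (sqrt ((2 * r + \<sigma>\<^sup>2) * (T - t))) - 1 / 2))
          * (\<sigma> / sqrt (T - t))
        + \<sigma>\<^sup>2 / 2"
    and "brownian_motion M F W"
    and "\<And>t x. t \<in> {0..<T} \<Longrightarrow> x > 0 \<Longrightarrow>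
      sde_solution M F W (\<lambda>s y. (r - \<delta> s) * y) (\<lambda>s y. \<sigma> * y) t T x (X t x)"
  shows "optimal_exercise_boundary (american_put_value M X r K T) K T
    (\<lambda>t. K * (1 - 2 * \<sigma> / sqrt (2 * r + \<sigma>\<^sup>2) * (N (sqrt ((2 * r + \<sigma>\<^sup>2) * (T - t))) - 1 / 2)))"
proof -
  interpret PB: put_boundary r \<sigma> using assms by unfold_locales auto
  interpret BM: brownian M F W
    using assms(8) by (intro brownian.intro brownian_axioms.intro) (auto simp: brownian_motion_def)
  have sqrt_eq: "sqrt ((2 * r + \<sigma>\<^sup>2) * c) = PB.\<alpha> * sqrt c" for c
    by (simp add: PB.\<alpha>_def real_sqrt_mult)
  have bd: "1 - 2 * \<sigma> / sqrt (2 * r + \<sigma>\<^sup>2) * (N (sqrt ((2 * r + \<sigma>\<^sup>2) * (T - t))) - 1 / 2) = PB.B (T - t)" for t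
    unfolding sqrt_eq by (simp add: PB.B_def PB.\<alpha>_def N Phi_def)
  have \<delta>: "r - \<delta> s = - PB.dB (T - s) / PB.B (T - s) - \<sigma>\<^sup>2 / 2" if "s \<in> {0..<T}" for s
    unfolding delta[OF that] unfolding bd unfolding sqrt_eq by (simp add: PB.dB_def n mult.commute)
  have val: "american_put_value M X r K T t x = K * PB.U (T - t) (ln (x / (K * PB.B (T - t))) / \<sigma>)"
    if t: "t \<in> {0..<T}" and x: "x > 0" for t x
  proof -
    define y0 where "y0 = ln (x / (K * PB.B (T - t))) / \<sigma>"
    interpret PM: put_model r \<sigma> M F W t T y0
      using t by unfold_locales auto
    note sde = assms(9)[OF t x]
    interpret PP: put_price r \<sigma> M F W t T y0 K "X t x"
    proof
      show "AE \<omega> in M. \<forall>s\<in>{t..T}. X t x s \<omega> = K * PB.B (T - s) * exp (\<sigma> * PM.Y s \<omega>)"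
        by (rule PM.price_explicit[OF assms(1) x y0_def sde \<delta>]) (use t in auto)
    qed (use assms(1) sde in \<open>auto simp: sde_solution_def\<close>)
    let ?S = "{\<tau>. stopping_time (natural_filtration M t T (X t x)) \<tau> \<and> (\<forall>\<omega>\<in>space M. \<tau> \<omega> \<in> {t..T})}"
    let ?J = "\<lambda>\<tau>. \<integral>\<omega>. PP.payoff (\<tau> \<omega>) \<omega> \<partial>M"
    have V: "american_put_value M X r K T t x = (SUP \<tau>\<in>?S. ?J \<tau>)"
      by (simp add: american_put_value_def PP.payoff_def)
    have le: "?J \<tau> \<le> K * PB.U (T - t) y0" if "\<tau> \<in> ?S" for \<tau>
      using that by (intro PP.expectation_stopping_le) auto
    \<comment> \<open>Immediate exercise shows that the set of rules is nonempty, which the rules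
      for a real supremum require along with boundedness.\<close>
    have const: "(\<lambda>_. t) \<in> ?S" using t by (auto intro: stopping_time_const)
    have bdd: "bdd_above (?J ` ?S)" using le by (rule bdd_aboveI2)
    have "(SUP \<tau>\<in>?S. ?J \<tau>) \<le> K * PB.U (T - t) y0"
      using const le by (intro cSUP_least) auto
    moreover have "K * PB.U (T - t) y0 \<le> (SUP \<tau>\<in>?S. ?J \<tau>)"
    proof (rule PP.value_ge)
      show up: "?J \<tau> \<le> (SUP \<tau>\<in>?S. ?J \<tau>)"
        if "stopping_time (natural_filtration M t T (X t x)) \<tau>" "\<forall>\<omega>\<in>space M. \<tau> \<omega> \<in> {t..T}" for \<tau>
        using that by (intro cSUP_upper bdd) auto
      have "0 \<le> ?J (\<lambda>_. t)" using PP.payoff_nonneg by simp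
      also have "\<dots> \<le> (SUP \<tau>\<in>?S. ?J \<tau>)" using const by (intro cSUP_upper bdd)
      finally show "0 \<le> (SUP \<tau>\<in>?S. ?J \<tau>)" .
    qed
    ultimately show ?thesis unfolding V y0_def by (rule antisym)
  qed
  \<comment> \<open>At or below the boundary \<open>U\<close> is the payoff by definition; above it
    the strict inequality \<open>U_gt\<close> excludes equality.\<close>
  have iff: "american_put_value M X r K T t x = K - x \<longleftrightarrow> x \<le> K * PB.B (T - t)"
    if t: "t \<in> {0..<T}" and x: "x > 0" for t x
  proof -
    define b where "b = K * PB.B (T - t)"
    define y0 where "y0 = ln (x / b) / \<sigma>"
    have b: "b > 0" using assms(1) PB.B_pos by (simp add: b_def)
    have y: "y0 \<le> 0 \<longleftrightarrow> x \<le> b" using b x assms(4) by (simp add: y0_def divide_le_0_iff ln_le_zero_iff)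
    have "exp (\<sigma> * y0) = x / b" using b x assms(4) by (simp add: y0_def)
    then have x_eq: "K - x = K * (1 - PB.B (T - t) * exp (\<sigma> * y0))"
      using assms(1) PB.B_pos[of "T - t"] by (simp add: b_def field_simps)
    have v: "american_put_value M X r K T t x = K * PB.U (T - t) y0"
      using val[OF t x] by (simp add: y0_def b_def)
    show ?thesis
    proof (cases "y0 \<le> 0")
      case True
      then show ?thesis using y unfolding v x_eq b_def[symmetric] by (simp add: PB.U_def)
    next
      case False
      then have "1 - PB.B (T - t) * exp (\<sigma> * y0) < PB.U (T - t) y0"
        using t by (intro PB.U_gt) auto
      then show ?thesis using False y assms(1) unfolding v x_eq b_def[symmetric] by simp
    qed
  qed
  show ?thesis
    unfolding optimal_exercise_boundary_def exercise_region_def bd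
    using assms(1) PB.B_pos iff by auto
qed

end
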